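(* Let $k$ be a perfect field and let $A$ be a reduced $k$-algebra of finite type of dimension $1$. Then $\operatorname{Leaps}_k(A)$ is finite.
   Context: All rings are commutative with unit. $\operatorname{Der}_k(A)$ is the $A$-module of $k$-derivations $A\to A$. For $m\in\mathbb N_{\ge1}$, a Hasse-Schmidt derivation of $A$ over $k$ of length $m$ is a sequence $D=(D_0,D_1,\ldots,D_m)$ of $k$-linear maps $D_\alpha:A\to A$ with $D_0=\mathrm{Id}_A$ and $D_\alpha(xy)=\sum_{i+j=\alpha}D_i(x)D_j(y)$ for all $x,y\in A$ and all $\alpha$. $\operatorname{IDer}_k(A;m)$ is the $A$-submodule of $\operatorname{Der}_k(A)$ of those $\delta$ for which there is such a $D$ of length $m$ with $D_1=\delta$. $A$ has a leap at an integer $s>1$ if the inclusion $\operatorname{IDer}_k(A;s-1)\supsetneq\operatorname{IDer}_k(A;s)$ is proper; $\operatorname{Leaps}_k(A)$ is the set of leaps of $A$ over $k$. *)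

theory Defs
  imports "HOL-Computational_Algebra.Computational_Algebra" "HOL-Library.Extended_Nat"
begin

text \<open>The structure map of the algebra is \<open>\<lambda>c. scale c 1\<close>.\<close>

locale comm_algebra = vector_space scale
  for scale :: "'k::field \<Rightarrow> 'a::comm_ring_1 \<Rightarrow> 'a" +
  assumes scale_mult_left: "scale c x * y = scale c (x * y)"

definition perfect_field :: "'k::field itself \<Rightarrow> bool" where
  "perfect_field _ \<longleftrightarrow> CHAR('k) = 0 \<or> (\<forall>x::'k. \<exists>y. y ^ CHAR('k) = x)"

definition reduced_ring :: "'a::comm_ring_1 itself \<Rightarrow> bool" where
  "reduced_ring _ \<longleftrightarrow> (\<forall>(x::'a) n. x ^ n = 0 \<longrightarrow> x = 0)"

definition subalgebra :: "('k::field \<Rightarrow> 'a::comm_ring_1 \<Rightarrow> 'a) \<Rightarrow> 'a set \<Rightarrow> bool" where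
  "subalgebra scale B \<longleftrightarrow>
     module.subspace scale B \<and> 1 \<in> B \<and> (\<forall>x\<in>B. \<forall>y\<in>B. x * y \<in> B)"

definition finite_type :: "('k::field \<Rightarrow> 'a::comm_ring_1 \<Rightarrow> 'a) \<Rightarrow> bool" where
  "finite_type scale \<longleftrightarrow> (\<exists>S. finite S \<and> subalgebra scale hull S = UNIV)"

definition ring_ideal :: "'a::comm_ring_1 set \<Rightarrow> bool" where
  "ring_ideal I \<longleftrightarrow>
     0 \<in> I \<and> (\<forall>x\<in>I. \<forall>y\<in>I. x + y \<in> I) \<and> (\<forall>a. \<forall>x\<in>I. a * x \<in> I)"

definition prime_ideal :: "'a::comm_ring_1 set \<Rightarrow> bool" where
  "prime_ideal P \<longleftrightarrow>
     ring_ideal P \<and> P \<noteq> UNIV \<and> (\<forall>x y. x * y \<in> P \<longrightarrow> x \<in> P \<or> y \<in> P)"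

text \<open>
  Krull dimension. The class \<^class>\<open>comm_ring_1\<close> excludes the zero ring, so the supremum is never
  taken over the empty set.
\<close>

definition krull_dim :: "'a::comm_ring_1 itself \<Rightarrow> enat" where
  "krull_dim _ = Sup {enat n | n. \<exists>P :: nat \<Rightarrow> 'a set.
     (\<forall>i\<le>n. prime_ideal (P i)) \<and> (\<forall>i<n. P i \<subset> P (Suc i))}"

definition Der :: "('k::field \<Rightarrow> 'a::comm_ring_1 \<Rightarrow> 'a) \<Rightarrow> ('a \<Rightarrow> 'a) set" where
  "Der scale = {\<delta>. Vector_Spaces.linear scale scale \<delta> \<and>
     (\<forall>x y. \<delta> (x * y) = x * \<delta> y + \<delta> x * y)}"

text \<open>
  A sequence of length \<open>m\<close> is represented by a function on \<^typ>\<open>nat\<close> whose values beyond \<open>m\<close> are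
  irrelevant.
\<close>

definition hasse_schmidt ::
  "('k::field \<Rightarrow> 'a::comm_ring_1 \<Rightarrow> 'a) \<Rightarrow> nat \<Rightarrow> (nat \<Rightarrow> 'a \<Rightarrow> 'a) \<Rightarrow> bool" where
  "hasse_schmidt scale m D \<longleftrightarrow> D 0 = id \<and>
     (\<forall>\<alpha>\<le>m. Vector_Spaces.linear scale scale (D \<alpha>) \<and>
       (\<forall>x y. D \<alpha> (x * y) = (\<Sum>i\<le>\<alpha>. D i x * D (\<alpha> - i) y)))"

text \<open>Only meaningful for \<open>m \<ge> 1\<close>; this is the only case used below.\<close>

definition IDer :: "('k::field \<Rightarrow> 'a::comm_ring_1 \<Rightarrow> 'a) \<Rightarrow> nat \<Rightarrow> ('a \<Rightarrow> 'a) set" where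
  "IDer scale m = {\<delta> \<in> Der scale. \<exists>D. hasse_schmidt scale m D \<and> D 1 = \<delta>}"

definition Leaps :: "('k::field \<Rightarrow> 'a::comm_ring_1 \<Rightarrow> 'a) \<Rightarrow> nat set" where
  "Leaps scale = {s. s > 1 \<and> IDer scale s \<subset> IDer scale (s - 1)}"

lemma hasse_schmidt_truncate:
  "hasse_schmidt scale m D \<Longrightarrow> n \<le> m \<Longrightarrow> hasse_schmidt scale n D"
  by (auto simp: hasse_schmidt_def)

lemma IDer_antimono: "n \<le> m \<Longrightarrow> IDer scale m \<subseteq> IDer scale n"
  by (auto simp: IDer_def intro: hasse_schmidt_truncate)

end

theory Submission
  imports Defs
begin

text \<open>
  Leaps are the places where the descending chain of subspaces \<open>IDer scale m\<close> of \<open>Der scale\<close>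
  drops. The chain can drop only finitely often if all its members contain one subspace of
  finite codimension in \<open>Der scale\<close> (\<open>finite_Leaps_of_fin_codim\<close>). So it suffices to integrate
  sufficiently many derivations to infinite order.

  Suppose first that \<open>A\<close> is a domain of transcendence degree one over \<open>k\<close>. As \<open>k\<close> is perfect,
  there is an element \<open>t\<close> over which the other generators are separable, and a derivation \<open>\<delta>\<close> is
  determined by \<open>\<delta> t\<close>. Newton's method, applied to the separable equations of the generators,
  shows that for a suitable \<open>c \<noteq> 0\<close> the deformation \<open>t \<mapsto> t + c s\<close> lifts to all generators as
  power series in \<open>s\<close> with coefficients in \<open>A\<close> (\<open>lift_sep_tower\<close>). The algebra of these power
  series is algebraic over \<open>k[t + c s]\<close>, so that reduction to constant terms is injective on it.
  It is therefore isomorphic to \<open>A\<close>, and the resulting homomorphism from \<open>A\<close> to power series is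
  a Hasse-Schmidt derivation of infinite length with \<open>D 1 t = c\<close>. Multiplying the parameter \<open>s\<close>
  by \<open>a\<close> integrates \<open>a * D 1\<close> as well. Under the injection \<open>\<delta> \<mapsto> \<delta> t\<close> the integrable derivations
  thus contain \<open>c A\<close>, and \<open>A/cA\<close> has finite dimension.

  Both the algebraicity and the last finiteness come from counting: a finitely generated domain
  that is algebraic over \<open>k[t]\<close> has linear growth (\<open>linear_growth_insert\<close>), whereas an element
  transcendental over \<open>k[t]\<close> would produce quadratic growth (\<open>lift_zero_if_constant_zero\<close>), and
  infinitely many independent elements of \<open>A/cA\<close> would produce growth faster than any linear
  bound (\<open>finite_codim_of_growth\<close>).

  In general the reduced ring \<open>A\<close> has finitely many minimal primes, which are annihilators of
  mutually orthogonal elements \<open>u i\<close> (\<open>ex_orthogonal_prime_annihilators\<close>). The construction is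
  carried out modulo each of them with \<open>c\<close> divisible by \<open>u i\<close>, so that the deformation moves one
  component only. That the transcendence degree is at most one on each component follows from
  the dimension by constructing a chain of primes (\<open>transcendence_degree_le_one\<close>), and the
  separable tower exists because a shortest algebraic relation over a perfect field is separable
  in one of its variables (\<open>ex_sep_tower\<close>).
\<close>

section \<open>Ideals, primes and chains of primes\<close>

lemma ideal_0: "ring_ideal I \<Longrightarrow> 0 \<in> I"
  and ideal_add: "ring_ideal I \<Longrightarrow> x \<in> I \<Longrightarrow> y \<in> I \<Longrightarrow> x + y \<in> I"
  and ideal_mult_left: "ring_ideal I \<Longrightarrow> x \<in> I \<Longrightarrow> a * x \<in> I"
  by (auto simp: ring_ideal_def)

lemma ideal_mult_right: "ring_ideal I \<Longrightarrow> x \<in> I \<Longrightarrow> x * a \<in> I"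
  using ideal_mult_left[of I x a] by (simp add: mult.commute)

lemma ideal_minus: "ring_ideal I \<Longrightarrow> x \<in> I \<Longrightarrow> - x \<in> I"
  using ideal_mult_left[of I x "- 1"] by simp

lemma ideal_diff: "ring_ideal I \<Longrightarrow> x \<in> I \<Longrightarrow> y \<in> I \<Longrightarrow> x - y \<in> I"
  using ideal_add[of I x "- y"] ideal_minus[of I y] by simp

lemma ideal_sum: "ring_ideal I \<Longrightarrow> (\<And>i. i \<in> S \<Longrightarrow> f i \<in> I) \<Longrightarrow> sum f S \<in> I"
  by (induction S rule: infinite_finite_induct) (auto intro: ideal_0 ideal_add)

lemma ideal_cong_iff: "ring_ideal I \<Longrightarrow> x - y \<in> I \<Longrightarrow> x \<in> I \<longleftrightarrow> y \<in> I"
  using ideal_add[of I "x - y" y] ideal_diff[of I x "x - y"] by auto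

lemma prime_ideal_ideal: "prime_ideal P \<Longrightarrow> ring_ideal P"
  and prime_idealD: "prime_ideal P \<Longrightarrow> x * y \<in> P \<Longrightarrow> x \<in> P \<or> y \<in> P"
  by (auto simp: prime_ideal_def)

lemma prime_ideal_one: "prime_ideal P \<Longrightarrow> 1 \<notin> P"
  using ideal_mult_left[of P 1] by (auto simp: prime_ideal_def)

lemma prime_ideal_power: "prime_ideal P \<Longrightarrow> x ^ n \<in> P \<Longrightarrow> x \<in> P"
  by (induction n) (auto dest: prime_idealD prime_ideal_one)

lemma ideal_adjoin:
  fixes x :: "'a::comm_ring_1"
  assumes M: "ring_ideal M"
  defines "J \<equiv> {m + x * a | m a. m \<in> M}"
  shows "ring_ideal J" "M \<subseteq> J" "x \<in> J"
proof -
  have J: "m + x * a \<in> J" if "m \<in> M" for m a unfolding J_def using that by blast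
  show "M \<subseteq> J" using J[of _ 0] by auto
  show "x \<in> J" using J[OF ideal_0[OF M], of 1] by simp
  show "ring_ideal J"
    unfolding ring_ideal_def
  proof (intro conjI ballI allI)
    show "0 \<in> J" using J[OF ideal_0[OF M], of 0] by simp
  next
    fix y z assume "y \<in> J" "z \<in> J"
    then obtain m a n b where "y = m + x * a" "z = n + x * b" "m \<in> M" "n \<in> M"
      by (auto simp: J_def)
    then show "y + z \<in> J" using J[OF ideal_add[OF M], of m n "a + b"] by (simp add: algebra_simps)
  next
    fix c y assume "y \<in> J"
    then obtain m a where "y = m + x * a" "m \<in> M" by (auto simp: J_def)
    then show "c * y \<in> J" using J[OF ideal_mult_left[OF M], of m c "c * a"] by (simp add: algebra_simps)
  qed
qed

text \<open>
  By Zorn's lemma; an ideal that is maximal among those disjoint from a multiplicative set is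
  prime.
\<close>

lemma ex_prime_ideal_disjoint:
  fixes I S :: "'a::comm_ring_1 set"
  assumes I: "ring_ideal I" and one: "1 \<in> S"
    and mult: "\<And>x y. x \<in> S \<Longrightarrow> y \<in> S \<Longrightarrow> x * y \<in> S" and disj: "I \<inter> S = {}"
  shows "\<exists>P. prime_ideal P \<and> I \<subseteq> P \<and> P \<inter> S = {}"
proof -
  define A where "A = {J. ring_ideal J \<and> I \<subseteq> J \<and> J \<inter> S = {}}"
  have "\<exists>M\<in>A. \<forall>X\<in>A. M \<subseteq> X \<longrightarrow> X = M"
  proof (rule subset_Zorn_nonempty)
    show "A \<noteq> {}" using I disj by (auto simp: A_def)
  next
    fix C assume ne: "C \<noteq> {}" and ch: "subset.chain A C"
    have CA: "C \<subseteq> A" and tot: "\<And>X Y. X \<in> C \<Longrightarrow> Y \<in> C \<Longrightarrow> X \<subseteq> Y \<or> Y \<subseteq> X"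
      using ch by (auto simp: subset.chain_def)
    have "ring_ideal (\<Union>C)"
      unfolding ring_ideal_def
    proof (intro conjI ballI allI)
      show "0 \<in> \<Union>C" using ne CA by (auto simp: A_def intro: ideal_0)
    next
      fix x y assume "x \<in> \<Union>C" "y \<in> \<Union>C"
      then obtain X Y where "X \<in> C" "x \<in> X" "Y \<in> C" "y \<in> Y" by blast
      then have "\<exists>Z\<in>C. x \<in> Z \<and> y \<in> Z" using tot[of X Y] by blast
      then obtain Z where "Z \<in> C" "x \<in> Z" "y \<in> Z" by blast
      then show "x + y \<in> \<Union>C" using CA by (auto simp: A_def intro: ideal_add)
    next
      fix a x assume "x \<in> \<Union>C"
      then show "a * x \<in> \<Union>C" using CA by (auto simp: A_def intro: ideal_mult_left)
    qed
    then show "\<Union>C \<in> A" using ne CA by (auto simp: A_def)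
  qed
  then obtain M where MA: "M \<in> A" and max: "\<And>X. X \<in> A \<Longrightarrow> M \<subseteq> X \<Longrightarrow> X = M" by blast
  have M: "ring_ideal M" "I \<subseteq> M" "M \<inter> S = {}" using MA by (auto simp: A_def)
  have key: "\<exists>m\<in>M. \<exists>a. m + x * a \<in> S" if "x \<notin> M" for x
  proof (rule ccontr)
    assume neg: "\<not> ?thesis"
    let ?J = "{m + x * a | m a. m \<in> M}"
    note J = ideal_adjoin[OF M(1), of x]
    have "?J \<in> A" using J M(2) neg by (auto simp: A_def)
    then show False using max[OF _ J(2)] J(3) that by blast
  qed
  have "prime_ideal M"
    unfolding prime_ideal_def
  proof (intro conjI allI impI)
    show "ring_ideal M" "M \<noteq> UNIV" using M one by auto
  next
    fix x y assume xy: "x * y \<in> M"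
    show "x \<in> M \<or> y \<in> M"
    proof (rule ccontr)
      assume "\<not> ?thesis"
      then obtain m a n b where mn: "m \<in> M" "n \<in> M" and S: "m + x * a \<in> S" "n + y * b \<in> S"
        using key by blast
      have "(m + x * a) * (n + y * b) = m * (n + y * b) + (n * (x * a) + (a * b) * (x * y))"
        by (simp add: algebra_simps)
      also have "\<dots> \<in> M"
        using ideal_add[OF M(1) ideal_mult_right[OF M(1) mn(1)] ideal_add[OF M(1)
            ideal_mult_right[OF M(1) mn(2)] ideal_mult_left[OF M(1) xy]]] .
      finally show False using mult[OF S] M(3) by blast
    qed
  qed
  then show ?thesis using M by blast
qed

lemma no_prime_chain_of_length_two:
  fixes P0 P1 P2 :: "'a::comm_ring_1 set"
  assumes "krull_dim TYPE('a) = 1" "prime_ideal P0" "prime_ideal P1" "prime_ideal P2"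
    "P0 \<subset> P1" "P1 \<subset> P2"
  shows False
proof -
  define P where "P i = (if i = 0 then P0 else if i = 1 then P1 else P2)" for i :: nat
  have "(\<forall>i\<le>2. prime_ideal (P i)) \<and> (\<forall>i<2. P i \<subset> P (Suc i))"
    using assms by (auto simp: P_def)
  then have "enat 2 \<le> krull_dim TYPE('a)"
    unfolding krull_dim_def by (intro Sup_upper) blast
  then show False using assms(1) by (simp add: one_enat_def)
qed

section \<open>Subrings, polynomials over them, and linear dependence modulo a prime\<close>

definition subring :: "'r::comm_ring_1 set \<Rightarrow> bool" where
  "subring B \<longleftrightarrow> 1 \<in> B \<and> (\<forall>x\<in>B. \<forall>y\<in>B. x - y \<in> B \<and> x * y \<in> B)"

lemma subring_1: "subring B \<Longrightarrow> 1 \<in> B"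
  and subring_diff: "subring B \<Longrightarrow> x \<in> B \<Longrightarrow> y \<in> B \<Longrightarrow> x - y \<in> B"
  and subring_mult: "subring B \<Longrightarrow> x \<in> B \<Longrightarrow> y \<in> B \<Longrightarrow> x * y \<in> B"
  by (auto simp: subring_def)

lemma subring_0: "subring B \<Longrightarrow> 0 \<in> B"
  using subring_diff[of B 1 1] subring_1 by auto

lemma subring_minus: "subring B \<Longrightarrow> x \<in> B \<Longrightarrow> - x \<in> B"
  using subring_diff[of B 0 x] subring_0 by auto

lemma subring_add: "subring B \<Longrightarrow> x \<in> B \<Longrightarrow> y \<in> B \<Longrightarrow> x + y \<in> B"
  using subring_diff[of B x "- y"] subring_minus by auto

lemma subring_sum: "subring B \<Longrightarrow> (\<And>i. i \<in> S \<Longrightarrow> f i \<in> B) \<Longrightarrow> sum f S \<in> B"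
  by (induction S rule: infinite_finite_induct) (auto intro: subring_0 subring_add)

lemma subring_power: "subring B \<Longrightarrow> x \<in> B \<Longrightarrow> x ^ n \<in> B"
  by (induction n) (auto intro: subring_1 subring_mult)

lemmas subring_rules = subring_0 subring_1 subring_add subring_diff subring_minus subring_mult
  subring_sum subring_power

definition poly_over :: "'r::comm_ring_1 set \<Rightarrow> 'r poly set" where
  "poly_over B = {p. \<forall>i. coeff p i \<in> B}"

lemma poly_overD: "p \<in> poly_over B \<Longrightarrow> coeff p i \<in> B"
  by (auto simp: poly_over_def)

lemma subring_poly_over: "subring B \<Longrightarrow> subring (poly_over B)"
  unfolding subring_def[of "poly_over B"]
  by (auto simp: poly_over_def coeff_mult intro!: subring_rules)

lemma pCons_poly_over: "subring B \<Longrightarrow> pCons a p \<in> poly_over B \<longleftrightarrow> a \<in> B \<and> p \<in> poly_over B"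
  by (auto simp: poly_over_def coeff_pCons split: nat.splits)

lemma monom_poly_over: "subring B \<Longrightarrow> a \<in> B \<Longrightarrow> monom a n \<in> poly_over B"
  by (auto simp: poly_over_def intro: subring_0)

lemma smult_poly_over: "subring B \<Longrightarrow> a \<in> B \<Longrightarrow> p \<in> poly_over B \<Longrightarrow> smult a p \<in> poly_over B"
  by (auto simp: poly_over_def intro: subring_mult)

lemma const_poly_over: "subring B \<Longrightarrow> a \<in> B \<Longrightarrow> [:a:] \<in> poly_over B"
  using monom_poly_over[of B a 0] by (simp add: monom_0)

lemma poly_over_mono: "B \<subseteq> C \<Longrightarrow> poly_over B \<subseteq> poly_over C"
  by (auto simp: poly_over_def)

lemma poly_over_eval: "subring B \<Longrightarrow> p \<in> poly_over B \<Longrightarrow> x \<in> B \<Longrightarrow> poly p x \<in> B"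
  by (auto simp: poly_altdef poly_over_def intro!: subring_rules)

lemma poly_as_sum_upto:
  fixes x :: "'r::comm_ring_1"
  shows "degree p \<le> n \<Longrightarrow> poly p x = (\<Sum>i\<le>n. coeff p i * x ^ i)"
  unfolding poly_altdef by (rule sum.mono_neutral_left) (auto simp: coeff_eq_0)

text \<open>
  Gaussian elimination without division over the domain \<open>B/(P \<inter> B)\<close>. As everywhere below, the
  quotient \<open>A/P\<close> is never formed: one works with representatives and with membership in \<open>P\<close>. For
  \<open>B = k \<cdot> 1\<close> this is linear algebra over the ground field, for a larger \<open>B\<close> it is linear algebra
  over its field of fractions.
\<close>

lemma dependent_mod_prime:
  assumes P: "prime_ideal P" and B: "subring B" and "finite J"
    and "finite I" and "card J < card I"
    and "\<And>i. i \<in> I \<Longrightarrow> \<exists>\<beta>. (\<forall>j\<in>J. \<beta> j \<in> B) \<and> v i - (\<Sum>j\<in>J. \<beta> j * e j) \<in> P"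
  shows "\<exists>\<kappa>. (\<forall>i\<in>I. \<kappa> i \<in> B) \<and> (\<exists>i\<in>I. \<kappa> i \<notin> P) \<and> (\<Sum>i\<in>I. \<kappa> i * v i) \<in> P"
  using assms(3-6)
proof (induction J arbitrary: I v rule: finite_induct)
  case empty
  then obtain i where i: "i \<in> I" by fastforce
  have vP: "v j \<in> P" if "j \<in> I" for j using empty(3)[OF that] by simp
  show ?case
    using i vP prime_ideal_one[OF P] subring_1[OF B]
    by (intro exI[of _ "\<lambda>_. 1"]) (auto intro!: ideal_sum prime_ideal_ideal P)
next
  case (insert k J)
  note idP = prime_ideal_ideal[OF P]
  obtain \<beta> where \<beta>: "\<And>i j. i \<in> I \<Longrightarrow> j \<in> insert k J \<Longrightarrow> \<beta> i j \<in> B"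
    "\<And>i. i \<in> I \<Longrightarrow> v i - (\<Sum>j\<in>insert k J. \<beta> i j * e j) \<in> P"
    using insert.prems(3) by metis
  have \<beta>2: "v i - (\<beta> i k * e k + (\<Sum>j\<in>J. \<beta> i j * e j)) \<in> P" if "i \<in> I" for i
    using \<beta>(2)[OF that] insert.hyps by simp
  show ?case
  proof (cases "\<forall>i\<in>I. \<beta> i k \<in> P")
    case True
    show ?thesis
    proof (rule insert.IH)
      fix i assume i: "i \<in> I"
      have "(v i - (\<beta> i k * e k + (\<Sum>j\<in>J. \<beta> i j * e j))) + \<beta> i k * e k \<in> P"
        using \<beta>2[OF i] True i by (intro ideal_add[OF idP] ideal_mult_right[OF idP]) auto
      then show "\<exists>\<beta>. (\<forall>j\<in>J. \<beta> j \<in> B) \<and> v i - (\<Sum>j\<in>J. \<beta> j * e j) \<in> P"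
        using \<beta>(1)[OF i] by (intro exI[of _ "\<beta> i"]) (auto simp: algebra_simps)
    qed (use insert in auto)
  next
    case False
    then obtain i0 where i0: "i0 \<in> I" "\<beta> i0 k \<notin> P" by blast
    define \<pi> where "\<pi> = \<beta> i0 k"
    have \<pi>: "\<pi> \<in> B" "\<pi> \<notin> P" using i0 \<beta>(1) by (auto simp: \<pi>_def)
    define I' where "I' = I - {i0}"
    have I: "I = insert i0 I'" "i0 \<notin> I'" "finite I'" using i0 insert.prems by (auto simp: I'_def)
    define w where "w i = \<pi> * v i - \<beta> i k * v i0" for i
    have "\<exists>\<kappa>. (\<forall>i\<in>I'. \<kappa> i \<in> B) \<and> (\<exists>i\<in>I'. \<kappa> i \<notin> P) \<and> (\<Sum>i\<in>I'. \<kappa> i * w i) \<in> P"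
    proof (rule insert.IH)
      show "card J < card I'" using insert.prems insert.hyps I by auto
      fix i assume i: "i \<in> I'"
      then have iI: "i \<in> I" by (auto simp: I)
      let ?S = "\<lambda>i. \<Sum>j\<in>J. \<beta> i j * e j"
      have "\<pi> * (v i - (\<beta> i k * e k + ?S i)) - \<beta> i k * (v i0 - (\<pi> * e k + ?S i0)) \<in> P"
        using ideal_diff[OF idP ideal_mult_left[OF idP \<beta>2[OF iI]] ideal_mult_left[OF idP \<beta>2[OF i0(1)]]]
        unfolding \<pi>_def .
      also have "\<pi> * (v i - (\<beta> i k * e k + ?S i)) - \<beta> i k * (v i0 - (\<pi> * e k + ?S i0))
        = w i - (\<pi> * ?S i - \<beta> i k * ?S i0)"
        by (simp add: w_def algebra_simps)
      also have "\<pi> * ?S i - \<beta> i k * ?S i0 = (\<Sum>j\<in>J. (\<pi> * \<beta> i j - \<beta> i k * \<beta> i0 j) * e j)"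
        by (simp add: sum_distrib_left sum_subtractf algebra_simps)
      finally show "\<exists>\<beta>. (\<forall>j\<in>J. \<beta> j \<in> B) \<and> w i - (\<Sum>j\<in>J. \<beta> j * e j) \<in> P"
        using \<beta>(1) iI i0 \<pi>
        by (intro exI[of _ "\<lambda>j. \<pi> * \<beta> i j - \<beta> i k * \<beta> i0 j"]) (auto intro!: subring_rules[OF B])
    qed (use I in auto)
    then obtain \<mu> where \<mu>: "\<And>i. i \<in> I' \<Longrightarrow> \<mu> i \<in> B" "\<exists>i\<in>I'. \<mu> i \<notin> P" "(\<Sum>i\<in>I'. \<mu> i * w i) \<in> P"
      by blast
    define \<kappa> where "\<kappa> i = (if i = i0 then - (\<Sum>i\<in>I'. \<mu> i * \<beta> i k) else \<pi> * \<mu> i)" for i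
    have "(\<Sum>i\<in>I. \<kappa> i * v i) = (\<Sum>i\<in>I'. \<mu> i * w i)"
    proof -
      have "(\<Sum>i\<in>I. \<kappa> i * v i) = \<kappa> i0 * v i0 + (\<Sum>i\<in>I'. \<kappa> i * v i)"
        using I by simp
      also have "(\<Sum>i\<in>I'. \<kappa> i * v i) = (\<Sum>i\<in>I'. \<pi> * \<mu> i * v i)"
        using I by (intro sum.cong) (auto simp: \<kappa>_def)
      finally have "(\<Sum>i\<in>I. \<kappa> i * v i)
        = - (\<Sum>i\<in>I'. \<mu> i * \<beta> i k) * v i0 + (\<Sum>i\<in>I'. \<pi> * \<mu> i * v i)"
        by (simp only: \<kappa>_def if_True refl)
      also have "\<dots> = (\<Sum>i\<in>I'. \<mu> i * w i)"
        by (simp add: w_def sum_distrib_left sum_subtractf algebra_simps)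
      finally show ?thesis .
    qed
    moreover have "\<exists>i\<in>I. \<kappa> i \<notin> P"
    proof -
      obtain i where i: "i \<in> I'" "\<mu> i \<notin> P" using \<mu> by blast
      then have "\<kappa> i \<notin> P" using I \<pi> prime_idealD[OF P] by (auto simp: \<kappa>_def)
      then show ?thesis using i I by blast
    qed
    moreover have "\<kappa> i \<in> B" if "i \<in> I" for i
      using that \<mu>(1) \<beta>(1) \<pi> I by (auto simp: \<kappa>_def intro!: subring_rules[OF B])
    ultimately show ?thesis using \<mu>(3) by (intro exI[of _ \<kappa>]) auto
  qed
qed

text \<open>
  Division with remainder by a polynomial whose leading coefficient is not a unit, carried out on
  the powers of a root. The sets \<open>V d\<close> keep track of the coefficients: for the filtration of an
  algebra by degree they show that the degrees grow linearly in \<open>j\<close>, and for a constant family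
  \<open>V d = B\<close> only that the coefficients stay in \<open>B\<close>.
\<close>

lemma reduce_powers_mod:
  fixes V :: "nat \<Rightarrow> 'r::comm_ring_1 set"
  assumes I: "ring_ideal I" and m: "0 < m"
    and V0: "1 \<in> V 0" "\<And>d. 0 \<in> V d"
    and Vdiff: "\<And>d x y. x \<in> V d \<Longrightarrow> y \<in> V d \<Longrightarrow> x - y \<in> V d"
    and Vmult: "\<And>d e x y. x \<in> V d \<Longrightarrow> y \<in> V e \<Longrightarrow> x * y \<in> V (d + e)"
    and a: "\<And>i. i \<le> m \<Longrightarrow> a i \<in> V d" and root: "(\<Sum>i\<le>m. a i * x ^ i) \<in> I"
  shows "\<exists>\<beta>. (\<forall>i<m. \<beta> i \<in> V (d * j)) \<and> a m ^ j * x ^ j - (\<Sum>i<m. \<beta> i * x ^ i) \<in> I"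
proof (induction j)
  case 0
  have "1 - (\<Sum>i<m. (if i = 0 then 1 else 0) * x ^ i) = 0"
    using m by (subst sum.remove[of _ 0]) auto
  then show ?case using V0 ideal_0[OF I]
    by (intro exI[of _ "\<lambda>i. if i = 0 then 1 else 0"]) auto
next
  case (Suc j)
  then obtain \<beta> where \<beta>: "\<And>i. i < m \<Longrightarrow> \<beta> i \<in> V (d * j)"
    "a m ^ j * x ^ j - (\<Sum>i<m. \<beta> i * x ^ i) \<in> I" by blast
  obtain n where n: "m = Suc n" using m by (cases m) auto
  define \<gamma> where "\<gamma> i = a m * (case i of 0 \<Rightarrow> 0 | Suc i \<Rightarrow> \<beta> i) - \<beta> n * a i" for i
  have root': "a m * x ^ m + (\<Sum>i<m. a i * x ^ i) \<in> I"
    using root by (simp add: lessThan_Suc_atMost[symmetric] add.commute)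
  have s1: "(\<Sum>i<m. (case i of 0 \<Rightarrow> 0 | Suc i \<Rightarrow> \<beta> i) * x ^ i) = (\<Sum>i<n. \<beta> i * x ^ Suc i)"
    unfolding n by (subst sum.lessThan_Suc_shift) simp
  have s2: "(\<Sum>i<m. \<beta> i * x ^ i) * x = (\<Sum>i<n. \<beta> i * x ^ Suc i) + \<beta> n * x ^ m"
    unfolding n by (simp add: sum_distrib_left algebra_simps)
  have s3: "(\<Sum>i<m. \<gamma> i * x ^ i) = a m * (\<Sum>i<n. \<beta> i * x ^ Suc i) - \<beta> n * (\<Sum>i<m. a i * x ^ i)"
    unfolding s1[symmetric]
    by (simp add: \<gamma>_def sum_distrib_left sum_subtractf algebra_simps)
  have "a m ^ Suc j * x ^ Suc j - (\<Sum>i<m. \<gamma> i * x ^ i)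
    = (a m * x) * (a m ^ j * x ^ j - (\<Sum>i<m. \<beta> i * x ^ i)) + \<beta> n * (a m * x ^ m + (\<Sum>i<m. a i * x ^ i))"
  proof -
    have "(a m * x) * (a m ^ j * x ^ j - (\<Sum>i<m. \<beta> i * x ^ i))
      = a m ^ Suc j * x ^ Suc j - a m * ((\<Sum>i<m. \<beta> i * x ^ i) * x)"
      by (simp add: algebra_simps)
    then show ?thesis unfolding s2 s3 by (simp add: algebra_simps)
  qed
  then have "a m ^ Suc j * x ^ Suc j - (\<Sum>i<m. \<gamma> i * x ^ i) \<in> I"
    using ideal_add[OF I ideal_mult_left[OF I \<beta>(2)] ideal_mult_left[OF I root']] by simp
  moreover have "\<gamma> i \<in> V (d * Suc j)" if "i < m" for i
  proof -
    have "(case i of 0 \<Rightarrow> 0 | Suc i \<Rightarrow> \<beta> i) \<in> V (d * j)"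
      using that \<beta>(1) V0 by (auto split: nat.splits)
    then have "a m * (case i of 0 \<Rightarrow> 0 | Suc i \<Rightarrow> \<beta> i) \<in> V (d + d * j)"
      using a by (intro Vmult) auto
    moreover have "\<beta> n * a i \<in> V (d * j + d)" using a that n by (intro Vmult \<beta>) auto
    ultimately show ?thesis unfolding \<gamma>_def by (intro Vdiff) (auto simp: add.commute)
  qed
  ultimately show ?case by blast
qed

context comm_algebra
begin

section \<open>Generated subalgebras\<close>

lemma scale_conv: "scale c x = scale c 1 * x"
  by (simp add: scale_mult_left)

lemma scale_mult_right: "x * scale c y = scale c (x * y)"
  by (metis mult.commute scale_mult_left)

lemma scale_of_nat: "scale (of_nat n) x = of_nat n * x"
  by (induction n) (auto simp: scale_left_distrib algebra_simps)

lemma scale_power: "scale c x ^ n = scale (c ^ n) (x ^ n)"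
  by (induction n) (auto simp: scale_mult_left scale_mult_right mult.commute)

lemma scale_in_ideal: "ring_ideal I \<Longrightarrow> x \<in> I \<Longrightarrow> scale c x \<in> I"
  by (subst scale_conv) (rule ideal_mult_left)

lemma scale_in_prime_iff: "prime_ideal P \<Longrightarrow> scale c x \<in> P \<longleftrightarrow> c = 0 \<or> x \<in> P"
  by (metis field_class.field_inverse ideal_0 prime_ideal_ideal scale_in_ideal scale_one scale_scale
      scale_zero_left)

abbreviation alg :: "'a set \<Rightarrow> 'a set" where
  "alg S \<equiv> subalgebra scale hull S"

lemma subalgebraI:
  assumes "1 \<in> B" "\<And>x y. x \<in> B \<Longrightarrow> y \<in> B \<Longrightarrow> x + y \<in> B"
    "\<And>x y. x \<in> B \<Longrightarrow> y \<in> B \<Longrightarrow> x * y \<in> B" "\<And>c x. x \<in> B \<Longrightarrow> scale c x \<in> B"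
  shows "subalgebra scale B"
proof -
  have "0 \<in> B" using assms(4)[OF assms(1), of 0] by simp
  then show ?thesis using assms by (auto simp: subalgebra_def subspace_def)
qed

lemma subalgebraD:
  assumes "subalgebra scale B"
  shows subalgebra_1: "1 \<in> B"
    and subalgebra_scale: "x \<in> B \<Longrightarrow> scale c x \<in> B"
    and subalgebra_subring: "subring B"
  using assms by (auto simp: subalgebra_def subring_def intro: subspace_scale subspace_diff)

lemma subalgebra_alg: "subalgebra scale (alg S)"
  unfolding hull_def
  by (intro subalgebraI) (auto dest: subalgebraD intro: subring_rules subalgebra_subring)

lemma subring_alg: "subring (alg S)"
  by (rule subalgebra_subring[OF subalgebra_alg])

lemma alg_inc: "S \<subseteq> alg S"
  by (rule hull_subset)

lemma alg_subset: "subalgebra scale B \<Longrightarrow> S \<subseteq> B \<Longrightarrow> alg S \<subseteq> B"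
  by (rule hull_minimal)

lemma alg_mono: "S \<subseteq> T \<Longrightarrow> alg S \<subseteq> alg T"
  by (rule hull_mono)

lemma alg_empty: "alg {} = range (\<lambda>c. scale c 1)"
proof
  show "alg {} \<subseteq> range (\<lambda>c. scale c 1)"
  proof (rule alg_subset[OF subalgebraI])
    show "1 \<in> range (\<lambda>c. scale c 1)" by (rule image_eqI[of _ _ 1]) auto
  qed (auto simp: scale_left_distrib[symmetric] scale_mult_left)
  show "range (\<lambda>c. scale c 1) \<subseteq> alg {}"
    using subalgebra_scale subalgebra_1 subalgebra_alg by blast
qed

lemma adjoin_eq:
  assumes B: "subalgebra scale B"
  shows "alg (insert x B) = (\<lambda>p. poly p x) ` poly_over B"
proof
  note sB = subalgebra_subring[OF B]
  note sP = subring_poly_over[OF sB]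
  show "alg (insert x B) \<subseteq> (\<lambda>p. poly p x) ` poly_over B"
  proof (rule alg_subset[OF subalgebraI])
    show "1 \<in> (\<lambda>p. poly p x) ` poly_over B"
      using subring_1[OF sP] by (intro image_eqI[of _ _ 1]) auto
    show "y + z \<in> (\<lambda>p. poly p x) ` poly_over B" "y * z \<in> (\<lambda>p. poly p x) ` poly_over B"
      if yz: "y \<in> (\<lambda>p. poly p x) ` poly_over B" "z \<in> (\<lambda>p. poly p x) ` poly_over B" for y z
    proof -
      obtain p q where pq: "p \<in> poly_over B" "q \<in> poly_over B" "y = poly p x" "z = poly q x"
        using yz by auto
      show "y + z \<in> (\<lambda>p. poly p x) ` poly_over B"
        using pq subring_add[OF sP] by (intro image_eqI[of _ _ "p + q"]) auto
      show "y * z \<in> (\<lambda>p. poly p x) ` poly_over B"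
        using pq subring_mult[OF sP] by (intro image_eqI[of _ _ "p * q"]) auto
    qed
    show "scale c y \<in> (\<lambda>p. poly p x) ` poly_over B" if y: "y \<in> (\<lambda>p. poly p x) ` poly_over B" for c y
    proof -
      obtain p where p: "p \<in> poly_over B" "y = poly p x" using y by auto
      have "scale c y = poly (smult (scale c 1) p) x" using p scale_conv[of c y] by simp
      then show ?thesis
        using p smult_poly_over[OF sB subalgebra_scale[OF B subalgebra_1[OF B]]] by blast
    qed
    have "x = poly (monom 1 1) x" by (simp add: poly_monom)
    then have "x \<in> (\<lambda>p. poly p x) ` poly_over B"
      using monom_poly_over[OF sB subring_1[OF sB]] by blast
    moreover have "b \<in> (\<lambda>p. poly p x) ` poly_over B" if "b \<in> B" for b
      using const_poly_over[OF sB that] by (intro image_eqI[of _ _ "[:b:]"]) auto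
    ultimately show "insert x B \<subseteq> (\<lambda>p. poly p x) ` poly_over B" by blast
  qed
  have "insert x B \<subseteq> alg (insert x B)" by (rule alg_inc)
  then have "poly_over B \<subseteq> poly_over (alg (insert x B))" "x \<in> alg (insert x B)"
    by (auto intro!: poly_over_mono)
  then show "(\<lambda>p. poly p x) ` poly_over B \<subseteq> alg (insert x B)"
    by (auto intro!: poly_over_eval subring_alg)
qed

lemma finite_subset_of_chain:
  assumes "finite F" "F \<subseteq> (\<Union>n. V n)" "\<And>m n. m \<le> n \<Longrightarrow> V m \<subseteq> V n"
  shows "\<exists>n::nat. F \<subseteq> V n"
  using assms(1,2)
proof (induction F rule: finite_induct)
  case (insert x F)
  then obtain m n where "x \<in> V m" "F \<subseteq> V n" by auto
  then have "insert x F \<subseteq> V (max m n)" using assms(3)[of m "max m n"] assms(3)[of n "max m n"] by auto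
  then show ?case by blast
qed auto

section \<open>Growth of finitely generated algebras modulo a prime\<close>

primrec monomials :: "'a set \<Rightarrow> nat \<Rightarrow> 'a set" where
  "monomials S 0 = {1}"
| "monomials S (Suc n) = monomials S n \<union> (\<Union>s\<in>S. (*) s ` monomials S n)"

definition filtration :: "'a set \<Rightarrow> nat \<Rightarrow> 'a set" where
  "filtration S n = span (monomials S n)"

lemma monomials_mono: "m \<le> n \<Longrightarrow> monomials S m \<subseteq> monomials S n"
  by (rule lift_Suc_mono_le) auto

lemma monomials_mult: "x \<in> monomials S m \<Longrightarrow> y \<in> monomials S n \<Longrightarrow> x * y \<in> monomials S (m + n)"
proof (induction m arbitrary: x)
  case 0
  then show ?case by simp
next
  case (Suc m)
  then consider "x \<in> monomials S m" | s z where "s \<in> S" "z \<in> monomials S m" "x = s * z" by auto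
  then show ?case
  proof cases
    case 1
    then show ?thesis using Suc by simp
  next
    case 2
    then have "z * y \<in> monomials S (m + n)" using Suc by blast
    then show ?thesis using 2 by (auto simp: mult.assoc)
  qed
qed

lemma filtration_mono: "m \<le> n \<Longrightarrow> filtration S m \<subseteq> filtration S n"
  unfolding filtration_def by (intro span_mono monomials_mono)

lemma subspace_filtration: "subspace (filtration S n)"
  unfolding filtration_def by (rule subspace_span)

lemma span_mult:
  assumes "x \<in> span X" "y \<in> span Y" "\<And>a b. a \<in> X \<Longrightarrow> b \<in> Y \<Longrightarrow> a * b \<in> span Z"
  shows "x * y \<in> span Z"
proof -
  have "a * y \<in> span Z" if "a \<in> X" for a
    using assms(2)
    by (induction rule: span_induct_alt)
      (auto simp: distrib_left scale_mult_right span_zero intro!: span_add span_scale assms(3) that)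
  with assms(1) show ?thesis
    by (induction rule: span_induct_alt)
      (auto simp: distrib_right scale_mult_left span_zero intro!: span_add span_scale)
qed

lemma filtration_mult: "x \<in> filtration S m \<Longrightarrow> y \<in> filtration S n \<Longrightarrow> x * y \<in> filtration S (m + n)"
  unfolding filtration_def by (erule (1) span_mult) (auto intro: span_base monomials_mult)

lemma one_in_filtration: "1 \<in> filtration S n"
  using filtration_mono[of 0 n S] unfolding filtration_def by (auto intro: span_base)

lemma filtration_power: "x \<in> filtration S d \<Longrightarrow> x ^ n \<in> filtration S (d * n)"
  by (induction n) (auto simp: one_in_filtration intro: filtration_mult)

lemma alg_eq_Union_filtration: "alg S = (\<Union>n. filtration S n)"
proof
  show "alg S \<subseteq> (\<Union>n. filtration S n)"
  proof (rule alg_subset[OF subalgebraI])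
    show "1 \<in> (\<Union>n. filtration S n)" using one_in_filtration by blast
    fix x y assume "x \<in> (\<Union>n. filtration S n)" "y \<in> (\<Union>n. filtration S n)"
    then obtain m n where mn: "x \<in> filtration S m" "y \<in> filtration S n" by blast
    then have "x \<in> filtration S (m + n)" "y \<in> filtration S (m + n)"
      using filtration_mono[of m "m + n"] filtration_mono[of n "m + n"] by auto
    then show "x + y \<in> (\<Union>n. filtration S n)" using subspace_add[OF subspace_filtration] by blast
    show "x * y \<in> (\<Union>n. filtration S n)" using filtration_mult[OF mn] by blast
  next
    fix c x assume "x \<in> (\<Union>n. filtration S n)"
    then show "scale c x \<in> (\<Union>n. filtration S n)" using subspace_scale[OF subspace_filtration] by blast
  next
    have "s \<in> filtration S 1" if "s \<in> S" for s
      unfolding filtration_def using that by (intro span_base) auto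
    then show "S \<subseteq> (\<Union>n. filtration S n)" by blast
  qed
  have "monomials S n \<subseteq> alg S" for n
  proof (induction n)
    case 0
    then show ?case using subring_1[OF subring_alg] by auto
  next
    case (Suc n)
    then show ?case using alg_inc[of S] by (auto intro!: subring_mult[OF subring_alg])
  qed
  moreover have "subspace (alg S)" using subalgebra_alg by (auto simp: subalgebra_def)
  ultimately have "filtration S n \<subseteq> alg S" for n unfolding filtration_def by (intro span_minimal)
  then show "(\<Union>n. filtration S n) \<subseteq> alg S" by blast
qed

lemma finite_subset_filtration: "finite F \<Longrightarrow> F \<subseteq> alg S \<Longrightarrow> \<exists>n. F \<subseteq> filtration S n"
  unfolding alg_eq_Union_filtration by (rule finite_subset_of_chain) (auto dest: filtration_mono)

text \<open>
  Up to the denominator \<open>l\<close>, which is harmless modulo a prime, the polynomials of degree at most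
  \<open>n\<close> in \<open>S\<close> span modulo \<open>P\<close> a space of dimension \<open>O(n)\<close>. This expresses that the algebra has
  dimension at most one modulo \<open>P\<close>, in a form that only needs counting.
\<close>

definition linear_growth :: "'a set \<Rightarrow> 'a set \<Rightarrow> bool" where
  "linear_growth P S \<longleftrightarrow> (\<exists>C. \<forall>n. \<exists>l Y. l \<notin> P \<and> finite Y \<and> card Y \<le> C * (n + 1) \<and>
     (\<forall>x\<in>filtration S n. \<exists>y\<in>span Y. l * x - y \<in> P))"

lemma linear_growth_singleton:
  assumes P: "prime_ideal P"
  shows "linear_growth P {t}"
proof -
  have monomials: "monomials {t} n = (\<lambda>i. t ^ i) ` {..n}" for n
  proof (induction n)
    case (Suc n)
    have "(*) t ` (\<lambda>i. t ^ i) ` {..n} = (\<lambda>i. t ^ i) ` Suc ` {..n}"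
      by (auto simp: image_image)
    then have "monomials {t} (Suc n) = (\<lambda>i. t ^ i) ` ({..n} \<union> Suc ` {..n})"
      using Suc by (simp add: image_Un)
    also have "{..n} \<union> Suc ` {..n} = {..Suc n}"
      by (auto simp: atMost_Suc)
    finally show ?case .
  qed auto
  have "\<exists>l Y. l \<notin> P \<and> finite Y \<and> card Y \<le> 1 * (n + 1) \<and> (\<forall>x\<in>filtration {t} n. \<exists>y\<in>span Y. l * x - y \<in> P)" for n
  proof (intro exI conjI ballI)
    show "1 \<notin> P" by (rule prime_ideal_one[OF P])
    show "finite (monomials {t} n)" by (simp add: monomials)
    show "card (monomials {t} n) \<le> 1 * (n + 1)"
      using card_image_le[of "{..n}" "\<lambda>i. t ^ i"] by (simp add: monomials)
    show "\<exists>y\<in>span (monomials {t} n). 1 * x - y \<in> P" if "x \<in> filtration {t} n" for x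
      using that by (intro bexI[of _ x]) (auto simp: filtration_def ideal_0 prime_ideal_ideal P)
  qed
  then show ?thesis unfolding linear_growth_def by blast
qed

lemma monomials_insert:
  "y \<in> monomials (insert x S) n \<Longrightarrow> \<exists>j\<le>n. \<exists>\<sigma>\<in>monomials S (n - j). y = \<sigma> * x ^ j"
proof (induction n arbitrary: y)
  case 0
  then show ?case by simp
next
  case (Suc n)
  then consider "y \<in> monomials (insert x S) n" | z where "z \<in> monomials (insert x S) n" "y = x * z"
    | s z where "s \<in> S" "z \<in> monomials (insert x S) n" "y = s * z" by auto
  then show ?case
  proof cases
    case 1
    then obtain j \<sigma> where "j \<le> n" "\<sigma> \<in> monomials S (n - j)" "y = \<sigma> * x ^ j" using Suc.IH by blast
    moreover have "monomials S (n - j) \<subseteq> monomials S (Suc n - j)" by (intro monomials_mono) simp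
    ultimately show ?thesis by (intro exI[of _ j]) (auto intro!: bexI[of _ \<sigma>])
  next
    case 2
    then obtain j \<sigma> where "j \<le> n" "\<sigma> \<in> monomials S (n - j)" "z = \<sigma> * x ^ j" using Suc.IH by blast
    then show ?thesis using 2 by (intro exI[of _ "Suc j"]) (auto intro!: bexI[of _ \<sigma>])
  next
    case 3
    then obtain j \<sigma> where j: "j \<le> n" "\<sigma> \<in> monomials S (n - j)" "z = \<sigma> * x ^ j" using Suc.IH by blast
    then have "s * \<sigma> \<in> monomials S (Suc n - j)" using 3 by (auto simp: Suc_diff_le)
    moreover have "y = (s * \<sigma>) * x ^ j" "j \<le> Suc n" using 3 j by (auto simp: mult.assoc)
    ultimately show ?thesis by blast
  qed
qed

text \<open>
  If \<open>x\<close> satisfies an equation of degree \<open>m\<close> over the algebra generated by \<open>S\<close>, then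
  multiplication by the \<open>n\<close>-th power of the leading coefficient turns a monomial of degree \<open>n\<close>
  into a combination of \<open>1, \<dots>, x ^ (m - 1)\<close> with coefficients of degree at most \<open>(d + 1) * n\<close>. So
  the dimension is multiplied by a constant only.
\<close>

lemma linear_growth_insert:
  assumes P: "prime_ideal P" and gr: "linear_growth P S" and m: "0 < m"
    and a: "\<And>i. i \<le> m \<Longrightarrow> a i \<in> alg S" and am: "a m \<notin> P"
    and root: "(\<Sum>i\<le>m. a i * x ^ i) \<in> P"
  shows "linear_growth P (insert x S)"
proof -
  note idP = prime_ideal_ideal[OF P]
  obtain C where C: "\<And>n. \<exists>l Y. l \<notin> P \<and> finite Y \<and> card Y \<le> C * (n + 1) \<and>
     (\<forall>x\<in>filtration S n. \<exists>y\<in>span Y. l * x - y \<in> P)" using gr by (auto simp: linear_growth_def)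
  have "\<exists>d. a ` {..m} \<subseteq> filtration S d" using a by (intro finite_subset_filtration) auto
  then obtain d where d: "\<And>i. i \<le> m \<Longrightarrow> a i \<in> filtration S d" by auto
  have red: "\<exists>\<beta>. (\<forall>i<m. \<beta> i \<in> filtration S (d * j)) \<and> a m ^ j * x ^ j - (\<Sum>i<m. \<beta> i * x ^ i) \<in> P" for j
    by (rule reduce_powers_mod[where V = "filtration S" and a = a and d = d, OF idP m])
      (auto intro: one_in_filtration filtration_mult subspace_diff[OF subspace_filtration] subspace_0[OF subspace_filtration] d root)
  have "\<exists>l Y. l \<notin> P \<and> finite Y \<and> card Y \<le> (C * (d + 1) * m) * (n + 1) \<and>
     (\<forall>y\<in>filtration (insert x S) n. \<exists>z\<in>span Y. l * y - z \<in> P)" for n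
  proof -
    let ?N = "(d + 1) * n"
    define W where "W = {y. \<exists>\<beta>. (\<forall>i<m. \<beta> i \<in> filtration S ?N) \<and> a m ^ n * y - (\<Sum>i<m. \<beta> i * x ^ i) \<in> P}"
    have "subspace W"
    proof (rule subspaceI)
      show "0 \<in> W" unfolding W_def
        by (auto intro!: exI[of _ "\<lambda>_. 0"] ideal_0 idP subspace_0[OF subspace_filtration])
    next
      fix y z assume "y \<in> W" "z \<in> W"
      then obtain \<beta> \<gamma> where *: "\<forall>i<m. \<beta> i \<in> filtration S ?N" "a m ^ n * y - (\<Sum>i<m. \<beta> i * x ^ i) \<in> P"
         "\<forall>i<m. \<gamma> i \<in> filtration S ?N" "a m ^ n * z - (\<Sum>i<m. \<gamma> i * x ^ i) \<in> P"
        unfolding W_def by blast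
      have "a m ^ n * (y + z) - (\<Sum>i<m. (\<beta> i + \<gamma> i) * x ^ i) \<in> P"
        using ideal_add[OF idP *(2,4)] by (simp add: algebra_simps sum.distrib)
      then show "y + z \<in> W" unfolding W_def using *
        by (intro CollectI exI[of _ "\<lambda>i. \<beta> i + \<gamma> i"]) (auto intro: subspace_add[OF subspace_filtration])
    next
      fix c y assume "y \<in> W"
      then obtain \<beta> where *: "\<forall>i<m. \<beta> i \<in> filtration S ?N" "a m ^ n * y - (\<Sum>i<m. \<beta> i * x ^ i) \<in> P"
        unfolding W_def by blast
      have "a m ^ n * scale c y - (\<Sum>i<m. scale c (\<beta> i) * x ^ i) \<in> P"
        using scale_in_ideal[OF idP *(2), of c]
        by (simp add: scale_right_diff_distrib scale_sum_right scale_mult_left scale_mult_right)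
      then show "scale c y \<in> W" unfolding W_def using *
        by (intro CollectI exI[of _ "\<lambda>i. scale c (\<beta> i)"]) (auto intro: subspace_scale[OF subspace_filtration])
    qed
    moreover have "monomials (insert x S) n \<subseteq> W"
    proof
      fix y assume "y \<in> monomials (insert x S) n"
      then obtain j \<sigma> where j: "j \<le> n" "\<sigma> \<in> monomials S (n - j)" "y = \<sigma> * x ^ j" using monomials_insert by blast
      obtain \<beta> where \<beta>: "\<And>i. i < m \<Longrightarrow> \<beta> i \<in> filtration S (d * j)"
        "a m ^ j * x ^ j - (\<Sum>i<m. \<beta> i * x ^ i) \<in> P" using red[of j] by blast
      let ?r = "a m ^ (n - j) * \<sigma>"
      have r: "?r \<in> filtration S (d * (n - j) + (n - j))"
        using j d[of m] by (intro filtration_mult filtration_power) (auto simp: filtration_def intro: span_base)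
      have e: "d * (n - j) + (n - j) + d * j \<le> ?N"
      proof -
        have "d * (n - j) + d * j = d * n" using j by (simp add: distrib_left[symmetric])
        then show ?thesis using j by simp
      qed
      have "a m ^ n = a m ^ (n - j) * a m ^ j" using j by (simp add: power_add[symmetric])
      then have "a m ^ n * y - (\<Sum>i<m. (?r * \<beta> i) * x ^ i) = ?r * (a m ^ j * x ^ j - (\<Sum>i<m. \<beta> i * x ^ i))"
        using j by (simp add: algebra_simps sum_distrib_left)
      then have "a m ^ n * y - (\<Sum>i<m. (?r * \<beta> i) * x ^ i) \<in> P"
        using ideal_mult_left[OF idP \<beta>(2)] by simp
      moreover have "?r * \<beta> i \<in> filtration S ?N" if "i < m" for i
        using filtration_mult[OF r \<beta>(1)[OF that]] filtration_mono[OF e] by blast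
      ultimately show "y \<in> W" unfolding W_def by (intro CollectI exI[of _ "\<lambda>i. ?r * \<beta> i"]) auto
    qed
    ultimately have W: "filtration (insert x S) n \<subseteq> W" unfolding filtration_def by (intro span_minimal)
    obtain l Y where Y: "l \<notin> P" "finite Y" "card Y \<le> C * (?N + 1)"
      and lY: "\<And>x. x \<in> filtration S ?N \<Longrightarrow> \<exists>y\<in>span Y. l * x - y \<in> P" using C[of ?N] by blast
    define Z where "Z = (\<lambda>(y, i). y * x ^ i) ` (Y \<times> {..<m})"
    have "card Z \<le> card Y * m"
      unfolding Z_def using card_image_le[of "Y \<times> {..<m}" "\<lambda>(y, i). y * x ^ i"] Y by simp
    also have "\<dots> \<le> C * (?N + 1) * m" using Y by simp
    also have "\<dots> \<le> C * ((d + 1) * (n + 1)) * m" by (intro mult_le_mono) auto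
    finally have cZ: "card Z \<le> (C * (d + 1) * m) * (n + 1)" by (simp add: algebra_simps)
    have "\<exists>z\<in>span Z. (l * a m ^ n) * y - z \<in> P" if y: "y \<in> filtration (insert x S) n" for y
    proof -
      obtain \<beta> where \<beta>: "\<And>i. i < m \<Longrightarrow> \<beta> i \<in> filtration S ?N" "a m ^ n * y - (\<Sum>i<m. \<beta> i * x ^ i) \<in> P"
        using subsetD[OF W y] unfolding W_def by blast
      have "\<exists>\<gamma>. \<forall>i<m. \<gamma> i \<in> span Y \<and> l * \<beta> i - \<gamma> i \<in> P"
      proof -
        have "\<forall>i\<in>{..<m}. \<exists>g. g \<in> span Y \<and> l * \<beta> i - g \<in> P"
          using lY \<beta>(1) by blast
        from bchoice[OF this] show ?thesis by auto
      qed
      then obtain \<gamma> where \<gamma>: "\<And>i. i < m \<Longrightarrow> \<gamma> i \<in> span Y" "\<And>i. i < m \<Longrightarrow> l * \<beta> i - \<gamma> i \<in> P"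
        by blast
      have "(l * a m ^ n) * y - (\<Sum>i<m. \<gamma> i * x ^ i)
        = l * (a m ^ n * y - (\<Sum>i<m. \<beta> i * x ^ i)) + (\<Sum>i<m. (l * \<beta> i - \<gamma> i) * x ^ i)"
        by (simp add: algebra_simps sum_subtractf sum_distrib_left)
      also have "\<dots> \<in> P" using \<beta>(2) \<gamma>(2)
        by (intro ideal_add[OF idP] ideal_sum[OF idP]) (auto intro: ideal_mult_left[OF idP] ideal_mult_right[OF idP])
      finally have "(l * a m ^ n) * y - (\<Sum>i<m. \<gamma> i * x ^ i) \<in> P" .
      moreover have "(\<Sum>i<m. \<gamma> i * x ^ i) \<in> span Z"
      proof (rule span_sum)
        fix i assume i: "i \<in> {..<m}"
        have "\<gamma> i * x ^ i \<in> span Z"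
          using i by (intro span_mult[OF \<gamma>(1) span_base[of "x ^ i" "{x ^ i}"]])
            (auto simp: Z_def intro!: span_base imageI)
        then show "\<gamma> i * x ^ i \<in> span Z" .
      qed
      ultimately show ?thesis by blast
    qed
    moreover have "l * a m ^ n \<notin> P"
      using Y am prime_ideal_power[OF P] prime_idealD[OF P] by blast
    moreover have "finite Z" using Y by (auto simp: Z_def)
    ultimately show ?thesis using cZ by blast
  qed
  then show ?thesis unfolding linear_growth_def by blast
qed

text \<open>
  Growth enters the later proofs only through this consequence, applied to families of products
  that are too numerous.
\<close>

lemma linear_growth_dependent:
  assumes P: "prime_ideal P" and gr: "linear_growth P S"
  shows "\<exists>C. \<forall>n I (v :: 'i \<Rightarrow> 'a). finite I \<longrightarrow> C * (n + 1) < card I \<longrightarrow> (\<forall>i\<in>I. v i \<in> filtration S n) \<longrightarrow>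
    (\<exists>\<kappa>. (\<exists>i\<in>I. \<kappa> i \<noteq> 0) \<and> (\<Sum>i\<in>I. scale (\<kappa> i) (v i)) \<in> P)"
proof -
  note idP = prime_ideal_ideal[OF P]
  obtain C where C: "\<And>n. \<exists>l Y. l \<notin> P \<and> finite Y \<and> card Y \<le> C * (n + 1) \<and>
     (\<forall>x\<in>filtration S n. \<exists>y\<in>span Y. l * x - y \<in> P)" using gr by (auto simp: linear_growth_def)
  have "\<exists>\<kappa>. (\<exists>i\<in>I. \<kappa> i \<noteq> 0) \<and> (\<Sum>i\<in>I. scale (\<kappa> i) (v i)) \<in> P"
    if fin: "finite I" and card: "C * (n + 1) < card I" and v: "\<And>i. i \<in> I \<Longrightarrow> v i \<in> filtration S n" for n I and v :: "'i \<Rightarrow> 'a"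
  proof -
    obtain l Y where Y: "l \<notin> P" "finite Y" "card Y \<le> C * (n + 1)"
      and lY: "\<And>x. x \<in> filtration S n \<Longrightarrow> \<exists>y\<in>span Y. l * x - y \<in> P" using C[of n] by blast
    have "\<exists>\<kappa>. (\<forall>i\<in>I. \<kappa> i \<in> alg {}) \<and> (\<exists>i\<in>I. \<kappa> i \<notin> P) \<and> (\<Sum>i\<in>I. \<kappa> i * (l * v i)) \<in> P"
    proof (rule dependent_mod_prime[OF P subring_alg Y(2) fin])
      show "card Y < card I" using Y card by simp
      fix i assume i: "i \<in> I"
      obtain y where y: "y \<in> span Y" "l * v i - y \<in> P" using lY[OF v[OF i]] by blast
      obtain u where u: "y = (\<Sum>z\<in>Y. scale (u z) z)" using y(1) span_finite[OF Y(2)] by auto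
      have "y = (\<Sum>z\<in>Y. scale (u z) 1 * z)" unfolding u by (intro sum.cong scale_conv refl)
      then show "\<exists>\<beta>. (\<forall>z\<in>Y. \<beta> z \<in> alg {}) \<and> l * v i - (\<Sum>z\<in>Y. \<beta> z * z) \<in> P"
        using y(2) by (intro exI[of _ "\<lambda>z. scale (u z) 1"]) (auto simp: alg_empty)
    qed
    then obtain \<kappa> where \<kappa>: "\<And>i. i \<in> I \<Longrightarrow> \<kappa> i \<in> alg {}" "\<exists>i\<in>I. \<kappa> i \<notin> P" "(\<Sum>i\<in>I. \<kappa> i * (l * v i)) \<in> P"
      by blast
    have "\<exists>c. \<forall>i\<in>I. \<kappa> i = scale (c i) 1"
      by (rule bchoice) (use \<kappa>(1) in \<open>auto simp: alg_empty\<close>)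
    then obtain c where c: "\<And>i. i \<in> I \<Longrightarrow> \<kappa> i = scale (c i) 1" by blast
    have "(\<Sum>i\<in>I. \<kappa> i * (l * v i)) = l * (\<Sum>i\<in>I. scale (c i) (v i))"
      unfolding sum_distrib_left
      by (intro sum.cong refl) (simp add: c scale_mult_left scale_mult_right)
    then have "(\<Sum>i\<in>I. scale (c i) (v i)) \<in> P" using \<kappa>(3) Y(1) prime_idealD[OF P] by auto
    moreover have "\<exists>i\<in>I. c i \<noteq> 0" using \<kappa>(2) c ideal_0[OF idP] by (metis scale_zero_left)
    ultimately show ?thesis by blast
  qed
  then show ?thesis by (intro exI[of _ C]) blast
qed

end

section \<open>Algebraic elements modulo a prime, and the transcendence degree\<close>

definition alg_over :: "'r::comm_ring_1 set \<Rightarrow> 'r set \<Rightarrow> 'r \<Rightarrow> bool" where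
  "alg_over P B x \<longleftrightarrow> (\<exists>f\<in>poly_over B. poly f x \<in> P \<and> (\<exists>i. coeff f i \<notin> P))"

lemma poly_in_ideal: "ring_ideal I \<Longrightarrow> (\<And>i. coeff f i \<in> I) \<Longrightarrow> poly f x \<in> I"
  unfolding poly_altdef by (intro ideal_sum) (auto intro: ideal_mult_right)

text \<open>
  Leading coefficients multiply. Since \<open>I\<close> plays the role of zero, the leading coefficient is at
  an index beyond which all coefficients lie in \<open>I\<close>, which may be smaller than the degree.
\<close>

lemma coeff_mult_top_mod:
  assumes I: "ring_ideal I" and p: "\<And>i. m < i \<Longrightarrow> coeff p i \<in> I" and q: "\<And>i. n < i \<Longrightarrow> coeff q i \<in> I"
  shows "coeff (p * q) (m + n) - coeff p m * coeff q n \<in> I"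
    and "m + n < k \<Longrightarrow> coeff (p * q) k \<in> I"
proof -
  have "coeff (p * q) (m + n) - coeff p m * coeff q n = (\<Sum>i\<in>{..m + n} - {m}. coeff p i * coeff q (m + n - i))"
    by (simp add: coeff_mult sum_diff1)
  also have "\<dots> \<in> I"
  proof (rule ideal_sum[OF I])
    fix i assume "i \<in> {..m + n} - {m}"
    then have "m < i \<or> n < m + n - i" by auto
    then show "coeff p i * coeff q (m + n - i) \<in> I"
      using p q ideal_mult_left[OF I] ideal_mult_right[OF I] by blast
  qed
  finally show "coeff (p * q) (m + n) - coeff p m * coeff q n \<in> I" .
  assume k: "m + n < k"
  show "coeff (p * q) k \<in> I"
    unfolding coeff_mult
  proof (rule ideal_sum[OF I])
    fix i assume "i \<in> {..k}"
    then have "m < i \<or> n < k - i" using k by auto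
    then show "coeff p i * coeff q (k - i) \<in> I"
      using p q ideal_mult_left[OF I] ideal_mult_right[OF I] by blast
  qed
qed

lemma ideal_power_cong:
  assumes "ring_ideal I" "x - y \<in> I"
  shows "x ^ n - y ^ n \<in> I"
proof (induction n)
  case (Suc n)
  have "x ^ Suc n - y ^ Suc n = x * (x ^ n - y ^ n) + y ^ n * (x - y)" by (simp add: algebra_simps)
  then show ?case using assms Suc by (simp add: ideal_add ideal_mult_left)
qed (use assms ideal_0 in auto)

lemma coeff_power_top_mod:
  assumes I: "ring_ideal I" and p: "\<And>i. m < i \<Longrightarrow> coeff p i \<in> I"
  shows "coeff (p ^ n) (m * n) - coeff p m ^ n \<in> I" (is ?A)
    and "m * n < k \<Longrightarrow> coeff (p ^ n) k \<in> I"
proof -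
  have "?A \<and> (\<forall>k>m * n. coeff (p ^ n) k \<in> I)"
  proof (induction n)
    case 0
    then show ?case using ideal_0[OF I] by (auto simp: coeff_eq_0)
  next
    case (Suc n)
    note * = coeff_mult_top_mod[OF I p, where q = "p ^ n" and n = "m * n"]
    have "coeff (p * p ^ n) (m + m * n) - coeff p m ^ Suc n
      = (coeff (p * p ^ n) (m + m * n) - coeff p m * coeff (p ^ n) (m * n))
        + coeff p m * (coeff (p ^ n) (m * n) - coeff p m ^ n)"
      by (simp add: algebra_simps)
    also have "\<dots> \<in> I" using Suc * by (intro ideal_add[OF I] ideal_mult_left[OF I]) auto
    finally show ?case using *(2) Suc by auto
  qed
  then show ?A "m * n < k \<Longrightarrow> coeff (p ^ n) k \<in> I" by auto
qed

lemma ex_top_coeff_mod: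
  assumes "coeff f i \<notin> I" "0 \<in> I"
  shows "\<exists>m. coeff f m \<notin> I \<and> (\<forall>j>m. coeff f j \<in> I)"
proof -
  let ?M = "{i. coeff f i \<notin> I}"
  have "?M \<subseteq> {..degree f}" using assms(2) by (auto intro: le_degree)
  then have fin: "finite ?M" by (rule finite_subset) simp
  then have "Max ?M \<in> ?M" using assms(1) by (intro Max_in) auto
  moreover have "coeff f j \<in> I" if "j > Max ?M" for j
    using Max_ge[OF fin, of j] that by fastforce
  ultimately show ?thesis by blast
qed

lemma ex_truncated_relation_mod:
  assumes I: "ring_ideal I" and f: "poly f x \<in> I" "coeff f i \<notin> I"
  shows "\<exists>m. i \<le> m \<and> m \<le> degree f \<and> coeff f m \<notin> I \<and> (\<Sum>i\<le>m. coeff f i * x ^ i) \<in> I"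
proof -
  obtain m where m: "coeff f m \<notin> I" "\<And>j. m < j \<Longrightarrow> coeff f j \<in> I"
    using ex_top_coeff_mod[OF f(2)] ideal_0[OF I] by blast
  have im: "i \<le> m" using m(2)[of i] f(2) by (meson not_le)
  have md: "m \<le> degree f" using m(1) ideal_0[OF I] by (intro le_degree) auto
  then have "poly f x = (\<Sum>i\<in>{..degree f} - {..m}. coeff f i * x ^ i) + (\<Sum>i\<le>m. coeff f i * x ^ i)"
    unfolding poly_altdef by (intro sum.subset_diff) auto
  then have "(\<Sum>i\<le>m. coeff f i * x ^ i) = poly f x - (\<Sum>i\<in>{..degree f} - {..m}. coeff f i * x ^ i)"
    by simp
  also have "\<dots> \<in> I"
    using m(2) f(1) by (intro ideal_diff[OF I] ideal_sum[OF I]) (auto intro: ideal_mult_right[OF I])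
  finally show ?thesis using im md m(1) by blast
qed

text \<open>
  Dividing an algebraic relation for \<open>y\<close> by a power of \<open>y\<close> makes its constant term nonzero modulo
  \<open>P\<close>; this constant term is then a multiple of \<open>y\<close>. In terms of fields: the inverse of an
  algebraic element is a polynomial in it, up to a denominator.
\<close>

lemma alg_over_cofactor:
  assumes P: "prime_ideal P" and B: "subring B" and y: "y \<notin> P" and "alg_over P B y"
  shows "\<exists>b\<in>B. b \<notin> P \<and> (\<exists>h\<in>poly_over B. b - poly h y * y \<in> P)"
proof -
  note idP = prime_ideal_ideal[OF P]
  obtain f i where "f \<in> poly_over B" "poly f y \<in> P" "coeff f i \<notin> P"
    using assms by (auto simp: alg_over_def)
  then show ?thesis
  proof (induction f arbitrary: i)
    case 0
    then show ?case using ideal_0[OF idP] by auto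
  next
    case (pCons a q)
    have aq: "a \<in> B" "q \<in> poly_over B" using pCons.prems(1) by (auto simp: pCons_poly_over[OF B])
    show ?case
    proof (cases "a \<in> P")
      case False
      have "a - poly (- q) y * y \<in> P" using pCons.prems(2) by (simp add: algebra_simps)
      moreover have "- q \<in> poly_over B" using aq subring_minus[OF subring_poly_over[OF B]] by blast
      ultimately show ?thesis using False aq by blast
    next
      case True
      have "y * poly q y \<in> P" using ideal_diff[OF idP pCons.prems(2) True] by simp
      then have "poly q y \<in> P" using prime_idealD[OF P] y by blast
      moreover obtain j where "i = Suc j"
        using pCons.prems(3) True by (cases i) auto
      ultimately show ?thesis using pCons.IH[OF aq(2), of j] pCons.prems(3) by simp
    qed
  qed
qed

context comm_algebra
begin

text \<open>
  Divisibility \<open>w | r' ^ n * b\<close> modulo \<open>P\<close> is a linear equation between polynomials in \<open>x\<close> with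
  coefficients in \<open>B\<close>. If \<open>x\<close> is transcendental over \<open>B\<close>, compare the top coefficients. If \<open>x\<close> is
  algebraic, a relation of least degree \<open>m\<close> makes \<open>1, \<dots>, x ^ (m - 1)\<close> independent; after replacing
  \<open>r'\<close> by a multiple that lies in \<open>B\<close> and clearing the leading coefficient of the relation,
  compare the coefficients of \<open>x ^ 0\<close>.
\<close>

lemma divides_descend_step:
  assumes P: "prime_ideal P" and B: "subalgebra scale B"
    and r': "r' \<in> alg (insert x B)" "r' \<notin> P"
  shows "\<exists>r\<in>B. r \<notin> P \<and> (\<forall>w\<in>B. \<forall>b\<in>B. \<forall>a\<in>alg (insert x B). \<forall>n. r' ^ n * b - w * a \<in> P \<longrightarrow>
    (\<exists>k. \<exists>b'\<in>B. r ^ k * b - w * b' \<in> P))"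
proof (cases "alg_over P B x")
  case False
  note idP = prime_ideal_ideal[OF P]
  note sB = subalgebra_subring[OF B]
  note sPB = subring_poly_over[OF sB]
  obtain p where p: "p \<in> poly_over B" "r' = poly p x" using r'(1) adjoin_eq[OF B] by auto
  have "\<exists>i. coeff p i \<notin> P" using r'(2) p poly_in_ideal[OF idP] by metis
  then obtain d where d: "coeff p d \<notin> P" "\<And>j. d < j \<Longrightarrow> coeff p j \<in> P"
    using ex_top_coeff_mod ideal_0[OF idP] by metis
  show ?thesis
  proof (intro bexI[of _ "coeff p d"] conjI ballI allI impI)
    show "coeff p d \<notin> P" "coeff p d \<in> B" using d p by (auto dest: poly_overD)
    fix w b a n assume wb: "w \<in> B" "b \<in> B" "a \<in> alg (insert x B)" "r' ^ n * b - w * a \<in> P"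
    obtain q where q: "q \<in> poly_over B" "a = poly q x" using wb(3) adjoin_eq[OF B] by auto
    let ?f = "smult b (p ^ n) - smult w q"
    have "?f \<in> poly_over B"
      using wb p q by (intro subring_diff[OF sPB] smult_poly_over[OF sB] subring_power[OF sPB])
    moreover have "poly ?f x \<in> P" using wb(4) p q by (simp add: mult.commute)
    ultimately have "coeff ?f (d * n) \<in> P" using False by (auto simp: alg_over_def)
    then have "b * coeff (p ^ n) (d * n) - w * coeff q (d * n) \<in> P" by simp
    moreover have "coeff (p ^ n) (d * n) - coeff p d ^ n \<in> P" by (rule coeff_power_top_mod[OF idP d(2)])
    moreover have "coeff p d ^ n * b - w * coeff q (d * n)
      = (b * coeff (p ^ n) (d * n) - w * coeff q (d * n)) - b * (coeff (p ^ n) (d * n) - coeff p d ^ n)"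
      by (simp add: algebra_simps)
    ultimately have "coeff p d ^ n * b - w * coeff q (d * n) \<in> P"
      using ideal_diff[OF idP _ ideal_mult_left[OF idP]] by metis
    then show "\<exists>k. \<exists>b'\<in>B. coeff p d ^ k * b - w * b' \<in> P" using poly_overD[OF q(1)] by blast
  qed
next
  case True
  note idP = prime_ideal_ideal[OF P]
  note sB = subalgebra_subring[OF B]
  note sPB = subring_poly_over[OF sB]
  let ?B' = "alg (insert x B)"
  define Q where "Q m \<longleftrightarrow> (\<exists>a. (\<forall>i\<le>m. a i \<in> B) \<and> a m \<notin> P \<and> (\<Sum>i\<le>m. a i * x ^ i) \<in> P)" for m :: nat
  have Q_poly: "\<exists>m. Q m \<and> m \<le> degree f"
    if f: "f \<in> poly_over B" "poly f x \<in> P" "coeff f i \<notin> P" for f i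
    using ex_truncated_relation_mod[OF idP f(2,3)] poly_overD[OF f(1)] unfolding Q_def by blast
  have "\<exists>m. Q m"
  proof -
    obtain f i where "f \<in> poly_over B" "poly f x \<in> P" "coeff f i \<notin> P"
      using True by (auto simp: alg_over_def)
    then show ?thesis using Q_poly by blast
  qed
  define m where "m = (LEAST m. Q m)"
  have Qm: "Q m" and least: "\<And>n. Q n \<Longrightarrow> m \<le> n"
    using \<open>\<exists>m. Q m\<close> by (auto simp: m_def intro: LeastI_ex Least_le)
  obtain a where a: "\<And>i. i \<le> m \<Longrightarrow> a i \<in> B" "a m \<notin> P" and root: "(\<Sum>i\<le>m. a i * x ^ i) \<in> P"
    using Qm by (auto simp: Q_def)
  have m0: "0 < m" using a(2) root by (cases m) auto
  have indep: "\<beta> i \<in> P" if \<beta>: "\<And>i. i < m \<Longrightarrow> \<beta> i \<in> B" "(\<Sum>i<m. \<beta> i * x ^ i) \<in> P" and i: "i < m" for \<beta> i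
  proof (rule ccontr)
    assume n: "\<beta> i \<notin> P"
    define f where "f = (\<Sum>i<m. monom (\<beta> i) i)"
    have cf: "coeff f j = (if j < m then \<beta> j else 0)" for j
      by (auto simp: f_def coeff_sum)
    have "f \<in> poly_over B" using \<beta>(1) subring_0[OF sB] by (auto simp: poly_over_def cf)
    moreover have "poly f x \<in> P" using \<beta>(2) by (simp add: f_def poly_sum poly_monom)
    ultimately obtain k where "Q k" "k \<le> degree f" using n i Q_poly[of f i] by (auto simp: cf)
    moreover have "degree f \<le> m - 1" by (rule degree_le) (auto simp: cf)
    ultimately show False using least[of k] m0 by linarith
  qed
  have red: "\<exists>k \<beta>. (\<forall>i<m. \<beta> i \<in> B) \<and> a m ^ k * y - (\<Sum>i<m. \<beta> i * x ^ i) \<in> P" if y: "y \<in> ?B'" for y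
  proof -
    obtain p where p: "p \<in> poly_over B" "y = poly p x" using y adjoin_eq[OF B] by auto
    define k where "k = degree p"
    have "\<exists>\<beta>. (\<forall>i<m. \<beta> i \<in> B) \<and> a m ^ j * x ^ j - (\<Sum>i<m. \<beta> i * x ^ i) \<in> P" for j
      using reduce_powers_mod[where V = "\<lambda>_. B" and a = a and d = 0, OF idP m0 _ _ _ _ a(1) root]
        subring_rules[OF sB] by blast
    then obtain \<beta> where \<beta>: "\<And>j i. i < m \<Longrightarrow> \<beta> j i \<in> B"
      "\<And>j. a m ^ j * x ^ j - (\<Sum>i<m. \<beta> j i * x ^ i) \<in> P" by metis
    let ?c = "\<lambda>j. coeff p j * a m ^ (k - j)"
    define \<gamma> where "\<gamma> i = (\<Sum>j\<le>k. ?c j * \<beta> j i)" for i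
    have "a m ^ k * y = (\<Sum>j\<le>k. ?c j * (a m ^ j * x ^ j))"
    proof -
      have "a m ^ k * (coeff p j * x ^ j) = ?c j * (a m ^ j * x ^ j)" if "j \<le> k" for j
      proof -
        have "a m ^ k = a m ^ (k - j) * a m ^ j" using that by (simp add: power_add[symmetric])
        then show ?thesis by (simp add: algebra_simps)
      qed
      then show ?thesis unfolding p(2) poly_altdef k_def[symmetric] sum_distrib_left by simp
    qed
    moreover have "(\<Sum>i<m. \<gamma> i * x ^ i) = (\<Sum>j\<le>k. ?c j * (\<Sum>i<m. \<beta> j i * x ^ i))"
      unfolding \<gamma>_def sum_distrib_left sum_distrib_right by (subst sum.swap) (simp add: mult.assoc)
    ultimately have "a m ^ k * y - (\<Sum>i<m. \<gamma> i * x ^ i)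
      = (\<Sum>j\<le>k. ?c j * (a m ^ j * x ^ j - (\<Sum>i<m. \<beta> j i * x ^ i)))"
      by (simp add: sum_subtractf right_diff_distrib)
    also have "\<dots> \<in> P" by (intro ideal_sum[OF idP] ideal_mult_left[OF idP] \<beta>(2))
    finally have "a m ^ k * y - (\<Sum>i<m. \<gamma> i * x ^ i) \<in> P" .
    moreover have "\<forall>i<m. \<gamma> i \<in> B"
      using poly_overD[OF p(1)] \<beta>(1) a(1) by (auto simp: \<gamma>_def intro!: subring_rules sB)
    ultimately show ?thesis by blast
  qed
  have "alg_over P B r'"
  proof -
    have "r' ^ j \<in> ?B'" for j using r'(1) by (rule subring_power[OF subring_alg])
    then have "\<exists>k \<beta>. (\<forall>i<m. \<beta> i \<in> B) \<and> a m ^ k * r' ^ j - (\<Sum>i<m. \<beta> i * x ^ i) \<in> P" for j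
      by (rule red)
    then obtain k \<beta> where k\<beta>: "\<And>j i. i < m \<Longrightarrow> \<beta> j i \<in> B"
      "\<And>j. a m ^ k j * r' ^ j - (\<Sum>i<m. \<beta> j i * x ^ i) \<in> P" by metis
    have "\<exists>\<kappa>. (\<forall>j\<in>{..m}. \<kappa> j \<in> B) \<and> (\<exists>j\<in>{..m}. \<kappa> j \<notin> P) \<and> (\<Sum>j\<in>{..m}. \<kappa> j * (a m ^ k j * r' ^ j)) \<in> P"
      using k\<beta> by (intro dependent_mod_prime[OF P sB, where J = "{..<m}" and e = "\<lambda>i. x ^ i"]) auto
    then obtain \<kappa> where \<kappa>: "\<And>j. j \<le> m \<Longrightarrow> \<kappa> j \<in> B" "\<exists>j\<le>m. \<kappa> j \<notin> P"
      "(\<Sum>j\<le>m. \<kappa> j * (a m ^ k j * r' ^ j)) \<in> P" by auto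
    define f where "f = (\<Sum>j\<le>m. monom (\<kappa> j * a m ^ k j) j)"
    have cf: "coeff f j = (if j \<le> m then \<kappa> j * a m ^ k j else 0)" for j
      by (auto simp: f_def coeff_sum)
    have "f \<in> poly_over B" using \<kappa>(1) a by (auto simp: poly_over_def cf intro!: subring_rules sB)
    moreover have "poly f r' \<in> P" using \<kappa>(3) by (simp add: f_def poly_sum poly_monom mult.assoc)
    moreover have "\<exists>j. coeff f j \<notin> P"
    proof -
      obtain j where "j \<le> m" "\<kappa> j \<notin> P" using \<kappa>(2) by blast
      then have "coeff f j \<notin> P"
        using a(2) prime_ideal_power[OF P] prime_idealD[OF P] by (auto simp: cf)
      then show ?thesis by blast
    qed
    ultimately show ?thesis by (auto simp: alg_over_def)
  qed
  then obtain b0 h where b0: "b0 \<in> B" "b0 \<notin> P" "h \<in> poly_over B" "b0 - poly h r' * r' \<in> P"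
    using alg_over_cofactor[OF P sB r'(2)] by blast
  define a0 where "a0 = poly h r'"
  have "B \<subseteq> ?B'" using alg_inc[of "insert x B"] by blast
  then have a0: "a0 \<in> ?B'"
    unfolding a0_def using b0(3) r'(1) poly_over_mono by (intro poly_over_eval[OF subring_alg]) auto
  show ?thesis
  proof (intro bexI[of _ "a m * b0"] conjI ballI allI impI)
    show "a m * b0 \<notin> P" using a b0 prime_idealD[OF P] by blast
    show "a m * b0 \<in> B" using a b0 by (auto intro: subring_mult[OF sB])
    fix w b y n assume wb: "w \<in> B" "b \<in> B" "y \<in> ?B'" "r' ^ n * b - w * y \<in> P"
    have "y * a0 ^ n \<in> ?B'" using wb a0 by (intro subring_rules[OF subring_alg])
    then obtain k \<beta> where k: "\<And>i. i < m \<Longrightarrow> \<beta> i \<in> B" "a m ^ k * (y * a0 ^ n) - (\<Sum>i<m. \<beta> i * x ^ i) \<in> P"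
      using red by blast
    have 1: "b0 ^ n - (a0 * r') ^ n \<in> P" using b0(4) unfolding a0_def by (rule ideal_power_cong[OF idP])
    define c where "c = a m ^ k * b0 ^ n * b"
    define \<gamma> where "\<gamma> i = (if i = 0 then c else 0) - w * \<beta> i" for i
    have "(\<Sum>i<m. \<gamma> i * x ^ i) = c - w * (\<Sum>i<m. \<beta> i * x ^ i)"
    proof -
      have "(\<Sum>i<m. \<gamma> i * x ^ i) = (\<Sum>i<m. (if i = 0 then c else 0) * x ^ i) - w * (\<Sum>i<m. \<beta> i * x ^ i)"
        by (simp add: \<gamma>_def left_diff_distrib sum_subtractf sum_distrib_left mult.assoc)
      also have "(\<Sum>i<m. (if i = 0 then c else 0) * x ^ i) = c"
        using m0 by (subst sum.remove[of _ 0]) auto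
      finally show ?thesis .
    qed
    also have "\<dots> = (a m ^ k * b) * (b0 ^ n - (a0 * r') ^ n) + (a m ^ k * a0 ^ n) * (r' ^ n * b - w * y)
      + w * (a m ^ k * (y * a0 ^ n) - (\<Sum>i<m. \<beta> i * x ^ i))"
      by (simp add: c_def algebra_simps power_mult_distrib)
    also have "\<dots> \<in> P" by (intro ideal_add[OF idP] ideal_mult_left[OF idP] 1 wb(4) k(2))
    finally have "\<gamma> 0 \<in> P"
      using k(1) wb a b0 m0
      by (intro indep[of \<gamma> 0]) (auto simp: \<gamma>_def c_def intro!: subring_rules sB)
    then have "a m ^ n * b0 ^ k * (c - w * \<beta> 0) \<in> P" by (simp add: \<gamma>_def ideal_mult_left[OF idP])
    moreover have "a m ^ n * b0 ^ k * (c - w * \<beta> 0) = (a m * b0) ^ (k + n) * b - w * (a m ^ n * b0 ^ k * \<beta> 0)"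
      by (simp add: c_def algebra_simps power_mult_distrib power_add)
    moreover have "a m ^ n * b0 ^ k * \<beta> 0 \<in> B" using a b0 k m0 by (intro subring_rules[OF sB]) auto
    ultimately show "\<exists>k. \<exists>b'\<in>B. (a m * b0) ^ k * b - w * b' \<in> P" by metis
  qed
qed

text \<open>
  A weak form of generic freeness: divisibility in \<open>A/P\<close> between elements of \<open>B\<close> already holds
  over \<open>B\<close> after inverting a single element \<open>r\<close>, the same for all pairs.
\<close>

lemma divides_descend:
  assumes P: "prime_ideal P" and "finite S" and "subalgebra scale B" and "alg (B \<union> S) = UNIV"
  shows "\<exists>r\<in>B. r \<notin> P \<and> (\<forall>w\<in>B. \<forall>b\<in>B. \<forall>a. b - w * a \<in> P \<longrightarrow>
    (\<exists>n. \<exists>b'\<in>B. r ^ n * b - w * b' \<in> P))"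
  using assms(2-4)
proof (induction S arbitrary: B rule: finite_induct)
  case empty
  then have "B = UNIV" using hull_same[of "subalgebra scale" B] by simp
  then show ?case using prime_ideal_one[OF P]
    by (intro bexI[of _ 1]) (auto intro!: exI[of _ 0])
next
  case (insert x S)
  let ?B' = "alg (insert x B)"
  have sub: "B \<subseteq> ?B'" using alg_inc[of "insert x B"] by blast
  have "alg (?B' \<union> S) = UNIV"
  proof -
    have "alg (B \<union> insert x S) \<subseteq> alg (?B' \<union> S)"
      using alg_inc[of "insert x B"] by (intro alg_mono) blast
    then show ?thesis using insert.prems by auto
  qed
  then obtain r' where r': "r' \<in> ?B'" "r' \<notin> P"
    and *: "\<And>w b a. w \<in> ?B' \<Longrightarrow> b \<in> ?B' \<Longrightarrow> b - w * a \<in> P \<Longrightarrow> \<exists>n. \<exists>b'\<in>?B'. r' ^ n * b - w * b' \<in> P"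
    using insert.IH[OF subalgebra_alg] by metis
  obtain r where r: "r \<in> B" "r \<notin> P" and
    **: "\<And>w b a n. w \<in> B \<Longrightarrow> b \<in> B \<Longrightarrow> a \<in> ?B' \<Longrightarrow> r' ^ n * b - w * a \<in> P \<Longrightarrow>
      (\<exists>k. \<exists>b'\<in>B. r ^ k * b - w * b' \<in> P)"
    using divides_descend_step[OF P insert.prems(1) r'] by blast
  show ?case
    using r * ** sub by (intro bexI[of _ r] conjI ballI allI impI) (auto, meson subsetD)
qed

text \<open>
  Take \<open>r\<close> in \<open>R[y]\<close> from \<open>divides_descend\<close> and \<open>w = 1 + y * r\<close>. If \<open>w\<close> divided an element \<open>b\<close> of
  \<open>R - P\<close> modulo \<open>P\<close>, it would divide \<open>r ^ n * b\<close> in \<open>R[y]\<close>, hence also \<open>(y * r) ^ n * b\<close>, and so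
  \<open>b\<close> up to sign, because \<open>y * r\<close> is congruent to \<open>- 1\<close> modulo \<open>w\<close>. This contradicts the positive
  degree of \<open>w\<close> in the transcendental element \<open>y\<close>. So \<open>P + w A\<close> misses \<open>R - P\<close> and is contained in
  a prime that does.
\<close>

lemma ex_larger_prime_over_subalgebra:
  assumes P: "prime_ideal P" and S: "finite S" "alg S = UNIV" and R: "subalgebra scale R"
    and y: "\<not> alg_over P R y"
  shows "\<exists>P'. prime_ideal P' \<and> P \<subset> P' \<and> P' \<inter> R \<subseteq> P"
proof -
  note idP = prime_ideal_ideal[OF P]
  note sR = subalgebra_subring[OF R]
  note sPR = subring_poly_over[OF sR]
  let ?B = "alg (insert y R)"
  note sB = subring_alg[of "insert y R"]
  have RB: "R \<subseteq> ?B" "y \<in> ?B" using alg_inc[of "insert y R"] by auto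
  have "alg (?B \<union> S) = UNIV" using S(2) alg_mono[of S "?B \<union> S"] by auto
  then obtain r where r: "r \<in> ?B" "r \<notin> P"
    and desc: "\<And>w b a. w \<in> ?B \<Longrightarrow> b \<in> ?B \<Longrightarrow> b - w * a \<in> P \<Longrightarrow> \<exists>n. \<exists>b'\<in>?B. r ^ n * b - w * b' \<in> P"
    using divides_descend[OF P S(1) subalgebra_alg] by metis
  obtain \<rho> where \<rho>: "\<rho> \<in> poly_over R" "r = poly \<rho> y" using r(1) adjoin_eq[OF R] by auto
  have trans: "coeff f i \<in> P" if "f \<in> poly_over R" "poly f y \<in> P" for f i
    using y that by (auto simp: alg_over_def)
  define \<omega> where "\<omega> = pCons 1 \<rho>"
  have \<omega>: "\<omega> \<in> poly_over R" using \<rho> subring_1[OF sR] by (simp add: \<omega>_def pCons_poly_over[OF sR])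
  define w where "w = 1 + y * r"
  have w: "w \<in> ?B" "w = poly \<omega> y" using RB r \<rho> by (auto simp: w_def \<omega>_def intro: subring_rules sB)
  have wP: "w \<notin> P"
    using trans[OF \<omega>, of 0] w(2) prime_ideal_one[OF P] by (auto simp: \<omega>_def)
  define I where "I = {p + w * a | p a. p \<in> P}"
  have I: "ring_ideal I" "P \<subseteq> I" "w \<in> I" unfolding I_def by (rule ideal_adjoin[OF idP])+
  have "I \<inter> (R - P) = {}"
  proof (rule ccontr)
    assume "\<not> ?thesis"
    then obtain p a where p: "p \<in> P" and bR: "p + w * a \<in> R" and bP: "p + w * a \<notin> P" by (auto simp: I_def)
    define b where "b = p + w * a"
    have b: "b \<in> R" "b \<notin> P" "b - w * a \<in> P" using p bR bP by (auto simp: b_def)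
    obtain n b' where b': "b' \<in> ?B" "r ^ n * b - w * b' \<in> P" using desc[OF w(1) _ b(3)] b RB by blast
    have "\<exists>e\<in>?B. (y * r) ^ n - (- 1) ^ n = w * e"
    proof (induction n)
      case 0
      then show ?case using subring_0[OF sB] by (intro bexI[of _ 0]) auto
    next
      case (Suc n)
      then obtain e where e: "e \<in> ?B" "(y * r) ^ n = (- 1) ^ n + w * e" by (auto simp: algebra_simps)
      have "(y * r) ^ Suc n - (- 1) ^ Suc n = w * ((- 1) ^ n + (y * r) * e)"
        unfolding power_Suc e(2) by (simp add: w_def algebra_simps)
      moreover have "(- 1) ^ n + (y * r) * e \<in> ?B" using e RB r by (intro subring_rules[OF sB])
      ultimately show ?case by blast
    qed
    then obtain e where e: "e \<in> ?B" "(y * r) ^ n = (- 1) ^ n + w * e" by (auto simp: algebra_simps)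
    define v where "v = (- 1) ^ n * (y ^ n * b' - e * b)"
    have "y ^ n * (r ^ n * b - w * b') = (- 1) ^ n * b - w * (y ^ n * b' - e * b)"
      using e(2) by (simp add: algebra_simps power_mult_distrib)
    moreover have "(- 1) ^ n * ((- 1) ^ n * b - w * (y ^ n * b' - e * b)) = b - w * v"
    proof -
      have 1: "(- 1) ^ n * (- 1) ^ n = (1::'a)" by (simp add: power_mult_distrib[symmetric])
      have "(- 1) ^ n * ((- 1) ^ n * b - w * (y ^ n * b' - e * b)) = ((- 1) ^ n * (- 1) ^ n) * b - w * v"
        unfolding v_def by (simp only: right_diff_distrib mult.assoc mult.left_commute)
      then show ?thesis unfolding 1 by simp
    qed
    ultimately have bv: "b - w * v \<in> P"
      using ideal_mult_left[OF idP ideal_mult_left[OF idP b'(2)]] by metis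
    have "v \<in> ?B" using b' e b RB by (auto simp: v_def intro!: subring_rules sB)
    then obtain \<nu> where \<nu>: "\<nu> \<in> poly_over R" "v = poly \<nu> y" using adjoin_eq[OF R] by auto
    have f: "[:b:] - \<omega> * \<nu> \<in> poly_over R"
      using \<nu> \<omega> b by (intro subring_diff[OF sPR] subring_mult[OF sPR] const_poly_over[OF sR])
    have fP: "coeff ([:b:] - \<omega> * \<nu>) i \<in> P" for i
      using bv \<nu>(2) w(2) by (intro trans[OF f]) auto
    have "\<exists>i. coeff \<nu> i \<notin> P"
    proof (rule ccontr)
      assume "\<not> ?thesis"
      then have "coeff (\<omega> * \<nu>) 0 \<in> P" by (auto simp: coeff_mult intro: ideal_mult_left[OF idP])
      then show False using fP[of 0] b(2) ideal_cong_iff[OF idP, of b] by auto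
    qed
    then obtain n1 where n1: "coeff \<nu> n1 \<notin> P" "\<And>j. n1 < j \<Longrightarrow> coeff \<nu> j \<in> P"
      using ex_top_coeff_mod ideal_0[OF idP] by metis
    have "\<exists>i. coeff \<rho> i \<notin> P" using r(2) \<rho> poly_in_ideal[OF idP] by metis
    then obtain n2 where n2: "coeff \<rho> n2 \<notin> P" "\<And>j. n2 < j \<Longrightarrow> coeff \<rho> j \<in> P"
      using ex_top_coeff_mod ideal_0[OF idP] by metis
    have "coeff (\<omega> * \<nu>) (Suc n2 + n1) - coeff \<omega> (Suc n2) * coeff \<nu> n1 \<in> P"
      using n1(2) n2(2) by (intro coeff_mult_top_mod[OF idP]) (auto simp: \<omega>_def coeff_pCons split: nat.splits)
    moreover have "coeff (\<omega> * \<nu>) (Suc n2 + n1) \<in> P"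
      using ideal_minus[OF idP fP[of "Suc n2 + n1"]] by simp
    ultimately have "coeff \<omega> (Suc n2) * coeff \<nu> n1 \<in> P" using ideal_cong_iff[OF idP] by blast
    then show False using n1(1) n2(1) prime_idealD[OF P] by (auto simp: \<omega>_def)
  qed
  then have "\<exists>P'. prime_ideal P' \<and> I \<subseteq> P' \<and> P' \<inter> (R - P) = {}"
    using subring_1[OF sR] prime_ideal_one[OF P]
    by (intro ex_prime_ideal_disjoint[OF I(1)]) (auto intro: subring_mult[OF sR] dest: prime_idealD[OF P])
  then obtain P' where P': "prime_ideal P'" "I \<subseteq> P'" "P' \<inter> (R - P) = {}" by blast
  then show ?thesis using I wP by blast
qed

text \<open>
  If \<open>x\<close> and \<open>y\<close> were algebraically independent modulo \<open>P\<close>, one could first enlarge \<open>P\<close> to a prime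
  modulo which \<open>x\<close> is still transcendental, and then enlarge that prime once more.
\<close>

lemma transcendence_degree_le_one:
  assumes dim: "krull_dim TYPE('a) = 1" and P: "prime_ideal P" and S: "finite S" "alg S = UNIV"
    and x: "\<not> alg_over P (alg {}) x"
  shows "alg_over P (alg {x}) y"
proof (rule ccontr)
  assume "\<not> ?thesis"
  then obtain P' where P': "prime_ideal P'" "P \<subset> P'" "P' \<inter> alg {x} \<subseteq> P"
    using ex_larger_prime_over_subalgebra[OF P S subalgebra_alg] by blast
  have "\<not> alg_over P' (alg {}) x"
  proof
    assume "alg_over P' (alg {}) x"
    then obtain f i where f: "f \<in> poly_over (alg {})" "poly f x \<in> P'" "coeff f i \<notin> P'"
      by (auto simp: alg_over_def)
    have "poly f x \<in> alg {x}"
      using f(1) poly_over_mono[OF alg_mono[of "{}" "{x}"]] alg_inc[of "{x}"]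
      by (intro poly_over_eval[OF subring_alg]) auto
    then have "poly f x \<in> P" using f P' by blast
    then have "alg_over P (alg {}) x" using f P' by (auto simp: alg_over_def)
    then show False using x by blast
  qed
  then obtain P'' where "prime_ideal P''" "P' \<subset> P''"
    using ex_larger_prime_over_subalgebra[OF P'(1) S subalgebra_alg] by blast
  then show False using no_prime_chain_of_length_two[OF dim P P'(1)] P' by blast
qed

end

section \<open>Perfect fields and separable towers\<close>

text \<open>
  The formal derivative over a ring that may have zero divisors; on an integral domain it is
  \<open>pderiv\<close>.
\<close>

definition fderiv :: "'r::comm_ring_1 poly \<Rightarrow> 'r poly" where
  "fderiv p = Abs_poly (\<lambda>i. of_nat (Suc i) * coeff p (Suc i))"

lemma coeff_fderiv: "coeff (fderiv p) i = of_nat (Suc i) * coeff p (Suc i)"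
  unfolding fderiv_def
  by (subst coeff_Abs_poly[of "degree p"]) (auto simp: coeff_eq_0)

lemma fderiv_0 [simp]: "fderiv 0 = 0"
  by (rule poly_eqI) (simp add: coeff_fderiv)

lemma fderiv_pCons: "fderiv (pCons a q) = q + pCons 0 (fderiv q)"
  by (rule poly_eqI) (auto simp: coeff_fderiv coeff_pCons algebra_simps split: nat.splits)

definition sep_over :: "'r::comm_ring_1 set \<Rightarrow> 'r set \<Rightarrow> 'r \<Rightarrow> bool" where
  "sep_over P B x \<longleftrightarrow> (\<exists>f\<in>poly_over B. poly f x \<in> P \<and> poly (fderiv f) x \<notin> P)"

lemma sep_over_mono: "B \<subseteq> C \<Longrightarrow> sep_over P B x \<Longrightarrow> sep_over P C x"
  unfolding sep_over_def using poly_over_mono by blast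

lemma sum_multiples:
  fixes f :: "nat \<Rightarrow> 'b::comm_monoid_add"
  assumes "0 < p" "\<And>i. \<not> p dvd i \<Longrightarrow> f i = 0"
  shows "(\<Sum>i\<le>d. f i) = (\<Sum>i\<le>d div p. f (p * i))"
proof -
  have "(\<Sum>i\<le>d. f i) = (\<Sum>i\<in>(*) p ` {..d div p}. f i)"
  proof (rule sum.mono_neutral_right)
    show "(*) p ` {..d div p} \<subseteq> {..d}"
      using assms(1) by (auto simp: less_eq_div_iff_mult_less_eq mult.commute)
    show "\<forall>i\<in>{..d} - (*) p ` {..d div p}. f i = 0"
    proof
      fix i assume i: "i \<in> {..d} - (*) p ` {..d div p}"
      have "\<not> p dvd i"
      proof
        assume "p dvd i"
        then have "i = p * (i div p)" "i div p \<le> d div p" using i by (auto intro: div_le_mono)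
        then show False using i by blast
      qed
      then show "f i = 0" by (rule assms(2))
    qed
  qed auto
  also have "\<dots> = (\<Sum>i\<le>d div p. f (p * i))"
    using assms(1) by (subst sum.reindex) (auto simp: inj_on_def)
  finally show ?thesis .
qed

context comm_algebra
begin

definition bipoly :: "nat \<Rightarrow> (nat \<Rightarrow> nat \<Rightarrow> 'k) \<Rightarrow> 'a \<Rightarrow> 'a \<Rightarrow> 'a" where
  "bipoly d c t z = (\<Sum>i\<le>d. \<Sum>j\<le>d. scale (c i j) (t ^ i * z ^ j))"

lemma bipoly_extend:
  assumes "\<And>i j. c i j \<noteq> 0 \<Longrightarrow> i \<le> d \<and> j \<le> d" "d \<le> d'"
  shows "bipoly d' c t z = bipoly d c t z"
proof -
  have "(\<Sum>j\<le>d'. scale (c i j) (t ^ i * z ^ j)) = (\<Sum>j\<le>d. scale (c i j) (t ^ i * z ^ j))" for i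
  proof (rule sum.mono_neutral_right)
    show "\<forall>j\<in>{..d'} - {..d}. scale (c i j) (t ^ i * z ^ j) = 0"
      using assms(1)[of i] by fastforce
  qed (use assms(2) in auto)
  moreover have "(\<Sum>i\<le>d'. \<Sum>j\<le>d. scale (c i j) (t ^ i * z ^ j)) = (\<Sum>i\<le>d. \<Sum>j\<le>d. scale (c i j) (t ^ i * z ^ j))"
  proof (rule sum.mono_neutral_right)
    show "\<forall>i\<in>{..d'} - {..d}. (\<Sum>j\<le>d. scale (c i j) (t ^ i * z ^ j)) = 0"
    proof
      fix i assume "i \<in> {..d'} - {..d}"
      then have "c i j = 0" for j using assms(1)[of i j] by auto
      then show "(\<Sum>j\<le>d. scale (c i j) (t ^ i * z ^ j)) = 0" by simp
    qed
  qed (use assms(2) in auto)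
  ultimately show ?thesis by (simp add: bipoly_def)
qed

lemma bipoly_swap: "bipoly d c t z = bipoly d (\<lambda>i j. c j i) z t"
  unfolding bipoly_def by (subst sum.swap) (simp add: mult.commute)

text \<open>
  Algebraic relations between \<open>t\<close> and \<open>z\<close> of total degree at most \<open>d\<close>. The flag \<open>uni\<close> restricts to
  polynomials in \<open>z\<close> alone; it lets relations of \<open>z\<close> over \<open>k\<close> and over \<open>k[t]\<close> share one proof.
\<close>

definition bipoly_relation :: "'a set \<Rightarrow> bool \<Rightarrow> nat \<Rightarrow> (nat \<Rightarrow> nat \<Rightarrow> 'k) \<Rightarrow> 'a \<Rightarrow> 'a \<Rightarrow> bool" where
  "bipoly_relation P uni d c t z \<longleftrightarrow> (\<forall>i j. d < i + j \<longrightarrow> c i j = 0) \<and> (\<exists>i j. c i j \<noteq> 0) \<and>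
     (uni \<longrightarrow> (\<forall>i j. 0 < i \<longrightarrow> c i j = 0)) \<and> bipoly d c t z \<in> P"

lemma CHAR_algebra: "CHAR('a) = CHAR('k)"
proof (rule CHAR_eqI)
  have *: "of_nat n = (0::'a) \<longleftrightarrow> of_nat n = (0::'k)" for n
    using scale_of_nat[of n 1] by (metis mult.right_neutral scale_eq_0_iff zero_neq_one)
  show "of_nat CHAR('k) = (0::'a)" by (simp add: *)
  show "CHAR('k) dvd n" if "of_nat n = (0::'a)" for n
    using that * by (simp add: of_nat_eq_0_iff_char_dvd)
qed

text \<open>
  Take a relation of least total degree. A partial derivative that vanishes at \<open>(t, z)\<close> is a
  shorter relation, hence zero as a polynomial. If both vanish, all exponents are divisible by the
  characteristic \<open>p\<close>; over a perfect field the polynomial is then a \<open>p\<close>-th power, and its root is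
  again a shorter relation.
\<close>

lemma ex_separable_relation:
  assumes perf: "perfect_field TYPE('k)" and P: "prime_ideal P" and ex: "bipoly_relation P uni d0 c0 t z"
  shows "\<exists>d c. bipoly_relation P uni d c t z \<and>
    (bipoly d (\<lambda>i j. of_nat (Suc j) * c i (Suc j)) t z \<notin> P \<or>
     bipoly d (\<lambda>i j. of_nat (Suc i) * c (Suc i) j) t z \<notin> P)"
proof -
  note idP = prime_ideal_ideal[OF P]
  define d where "d = (LEAST d. \<exists>c. bipoly_relation P uni d c t z)"
  have "\<exists>c. bipoly_relation P uni d c t z"
    unfolding d_def by (rule LeastI_ex) (use ex in blast)
  then obtain c where c: "bipoly_relation P uni d c t z" by blast
  have least: "\<not> bipoly_relation P uni e b t z" if "e < d" for e b
    using not_less_Least[OF that[unfolded d_def]] by blast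
  have supp: "\<And>i j. d < i + j \<Longrightarrow> c i j = 0" and inP: "bipoly d c t z \<in> P"
    and uni: "\<And>i j. uni \<Longrightarrow> 0 < i \<Longrightarrow> c i j = 0"
    using c by (auto simp: bipoly_relation_def)
  obtain i0 j0 where ij0: "c i0 j0 \<noteq> 0" using c by (auto simp: bipoly_relation_def)
  have const: False if "\<And>i j. c i j \<noteq> 0 \<Longrightarrow> i = 0 \<and> j = 0"
  proof -
    have "bipoly d c t z = bipoly 0 c t z" using that by (intro bipoly_extend) auto
    then have "scale (c 0 0) 1 \<in> P" using inP by (simp add: bipoly_def)
    then show False
      using ij0 that[OF ij0] scale_in_prime_iff[OF P] prime_ideal_one[OF P] by auto
  qed
  have d0: "0 < d"
  proof (rule ccontr)
    assume "\<not> 0 < d"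
    then show False using supp by (intro const) (metis add_gr_0 neq0_conv)
  qed
  show ?thesis
  proof (rule ccontr)
    assume "\<not> ?thesis"
    then have dZ: "bipoly d (\<lambda>i j. of_nat (Suc j) * c i (Suc j)) t z \<in> P"
      and dT: "bipoly d (\<lambda>i j. of_nat (Suc i) * c (Suc i) j) t z \<in> P" using c by blast+
    have zero: "b i j = 0"
      if b: "\<And>i j. d \<le> i + j \<Longrightarrow> b i j = 0" "\<And>i j. uni \<Longrightarrow> 0 < i \<Longrightarrow> b i j = 0" "bipoly d b t z \<in> P" for b i j
    proof (rule ccontr)
      assume nz: "b i j \<noteq> 0"
      have "i \<le> d - 1 \<and> j \<le> d - 1" if "b i j \<noteq> 0" for i j
      proof -
        have "i + j < d" using b(1)[of i j] that by (meson not_le)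
        then show ?thesis by auto
      qed
      then have "bipoly d b t z = bipoly (d - 1) b t z" by (intro bipoly_extend) auto
      then have "bipoly_relation P uni (d - 1) b t z"
        using b nz d0 by (auto simp: bipoly_relation_def)
      then show False using least[of "d - 1"] d0 by auto
    qed
    \<comment> \<open>minimality turns vanishing values of the derivatives into vanishing coefficients\<close>
    have z1: "of_nat (Suc j) * c i (Suc j) = 0" for i j
      by (rule zero[of "\<lambda>i j. of_nat (Suc j) * c i (Suc j)"]) (use dZ supp uni in auto)
    have z2: "of_nat (Suc i) * c (Suc i) j = 0" for i j
      by (rule zero[of "\<lambda>i j. of_nat (Suc i) * c (Suc i) j"]) (use dT supp uni in auto)
    define p where "p = CHAR('k)"
    have dvd: "p dvd i \<and> p dvd j" if "c i j \<noteq> 0" for i j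
    proof
      show "p dvd i"
        using z2[of "i - 1" j] that by (cases i) (auto simp: p_def of_nat_eq_0_iff_char_dvd[symmetric] simp del: of_nat_Suc)
      show "p dvd j"
        using z1[of "j - 1" i] that by (cases j) (auto simp: p_def of_nat_eq_0_iff_char_dvd[symmetric] simp del: of_nat_Suc)
    qed
    have p0: "0 < p"
    proof (rule ccontr)
      assume "\<not> 0 < p"
      then show False using dvd by (intro const) auto
    qed
    then have prp: "prime p" unfolding p_def by (rule prime_CHAR_semidom)
    have "\<exists>b. b ^ p = x" for x :: 'k
      using perf p0 by (auto simp: perfect_field_def p_def)
    then obtain rt where rt: "\<And>x::'k. rt x ^ p = x" by metis
    define b where "b i j = rt (c (p * i) (p * j))" for i j
    have bp: "b i j ^ p = c (p * i) (p * j)" for i j by (simp add: b_def rt)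
    have b0: "b i j = 0 \<longleftrightarrow> c (p * i) (p * j) = 0" for i j
      using bp[of i j] p0 by (metis power_eq_0_iff zero_power)
    define e where "e = d div p"
    \<comment> \<open>only exponents divisible by \<open>p\<close> occur, and \<open>b\<close> consists of the \<open>p\<close>-th roots of
        their coefficients\<close>
    have "bipoly d c t z = (\<Sum>i\<le>e. \<Sum>j\<le>e. scale (c (p * i) (p * j)) (t ^ (p * i) * z ^ (p * j)))"
    proof -
      have "(\<Sum>j\<le>d. scale (c i j) (t ^ i * z ^ j)) = (\<Sum>j\<le>e. scale (c i (p * j)) (t ^ i * z ^ (p * j)))" for i
        unfolding e_def using dvd[of i] by (intro sum_multiples p0) force
      moreover have "(\<Sum>i\<le>d. \<Sum>j\<le>e. scale (c i (p * j)) (t ^ i * z ^ (p * j)))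
        = (\<Sum>i\<le>e. \<Sum>j\<le>e. scale (c (p * i) (p * j)) (t ^ (p * i) * z ^ (p * j)))"
        unfolding e_def
      proof (rule sum_multiples[OF p0])
        fix i assume "\<not> p dvd i"
        then have "c i j = 0" for j using dvd[of i j] by blast
        then show "(\<Sum>j\<le>d div p. scale (c i (p * j)) (t ^ i * z ^ (p * j))) = 0" by simp
      qed
      ultimately show ?thesis by (simp add: bipoly_def)
    qed
    also have "\<dots> = (\<Sum>i\<le>e. \<Sum>j\<le>e. scale (b i j) (t ^ i * z ^ j) ^ p)"
      by (simp add: scale_power bp power_mult_distrib power_mult[symmetric] mult.commute[of p])
    also have "\<dots> = bipoly e b t z ^ p"
    proof -
      have pa: "p = CHAR('a)" by (simp add: p_def CHAR_algebra)
      have fd: "(sum f I) ^ p = (\<Sum>i\<in>I. f i ^ p)" for f :: "nat \<Rightarrow> 'a" and I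
        using freshmans_dream_sum[of p f I] prp pa by simp
      show ?thesis by (simp add: bipoly_def fd)
    qed
    finally have "bipoly e b t z ^ p \<in> P" using inP by simp
    then have "bipoly e b t z \<in> P" by (rule prime_ideal_power[OF P])
    moreover have "b i j = 0" if "e < i + j" for i j
    proof -
      have "d < (i + j) * p" using that p0 unfolding e_def by (simp add: div_less_iff_less_mult)
      then show ?thesis unfolding b0 by (intro supp) (simp add: algebra_simps)
    qed
    moreover have "\<exists>i j. b i j \<noteq> 0" using dvd[OF ij0] ij0 by (auto simp: b0 dvd_def)
    moreover have "b i j = 0" if "uni" "0 < i" for i j unfolding b0 using that p0 by (intro uni) auto
    ultimately have "bipoly_relation P uni e b t z" by (auto simp: bipoly_relation_def)
    moreover have "e < d" unfolding e_def using prime_gt_1_nat[OF prp] d0 by simp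
    ultimately show False using least by blast
  qed
qed

lemma sep_over_of_relation:
  assumes "bipoly_relation P uni d c t z" and dZ: "bipoly d (\<lambda>i j. of_nat (Suc j) * c i (Suc j)) t z \<notin> P"
  shows "sep_over P (alg (if uni then {} else {t})) z"
proof -
  have supp: "\<And>i j. d < i + j \<Longrightarrow> c i j = 0" and inP: "bipoly d c t z \<in> P"
    and uni: "\<And>i j. uni \<Longrightarrow> 0 < i \<Longrightarrow> c i j = 0"
    using assms(1) by (auto simp: bipoly_relation_def)
  let ?B = "alg (if uni then {} else {t})"
  define f where "f = (\<Sum>j\<le>d. monom (\<Sum>i\<le>d. scale (c i j) (t ^ i)) j)"
  have cf: "coeff f j = (\<Sum>i\<le>d. scale (c i j) (t ^ i))" for j
    using supp[of _ j] by (auto simp: f_def coeff_sum)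
  have deg: "degree f \<le> d" using supp by (intro degree_le) (auto simp: cf)
  have "coeff f j \<in> ?B" for j
    unfolding cf
  proof (rule subring_sum[OF subring_alg])
    fix i
    show "scale (c i j) (t ^ i) \<in> ?B"
    proof (cases "uni \<and> 0 < i")
      case True
      then show ?thesis using uni subring_0[OF subring_alg] by simp
    next
      case False
      then have "t ^ i \<in> ?B"
        using alg_inc[of "{t}"] by (cases uni) (auto intro: subring_rules subring_alg)
      then show ?thesis by (rule subalgebra_scale[OF subalgebra_alg])
    qed
  qed
  then have "f \<in> poly_over ?B" by (auto simp: poly_over_def)
  moreover have "poly f z = bipoly d c t z"
    unfolding poly_as_sum_upto[OF deg] bipoly_def cf sum_distrib_right
    by (subst sum.swap) (simp add: scale_mult_left)
  moreover have "poly (fderiv f) z = bipoly d (\<lambda>i j. of_nat (Suc j) * c i (Suc j)) t z"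
  proof -
    have "degree (fderiv f) \<le> d" using deg by (intro degree_le) (auto simp: coeff_fderiv coeff_eq_0)
    then have "poly (fderiv f) z = (\<Sum>j\<le>d. coeff (fderiv f) j * z ^ j)" by (rule poly_as_sum_upto)
    also have "\<dots> = (\<Sum>j\<le>d. \<Sum>i\<le>d. scale (of_nat (Suc j) * c i (Suc j)) (t ^ i * z ^ j))"
    proof (intro sum.cong refl)
      fix j
      show "coeff (fderiv f) j * z ^ j = (\<Sum>i\<le>d. scale (of_nat (Suc j) * c i (Suc j)) (t ^ i * z ^ j))"
        unfolding coeff_fderiv cf sum_distrib_left sum_distrib_right
        by (simp only: scale_mult_left scale_scale[symmetric] scale_of_nat mult.assoc)
    qed
    finally show ?thesis unfolding bipoly_def by (subst sum.swap)
  qed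
  ultimately show ?thesis using inP dZ unfolding sep_over_def by metis
qed

lemma algebraic_imp_separable:
  assumes perf: "perfect_field TYPE('k)" and P: "prime_ideal P" and "alg_over P (alg {}) z"
  shows "sep_over P (alg {}) z"
proof -
  note idP = prime_ideal_ideal[OF P]
  obtain f j where f: "f \<in> poly_over (alg {})" "poly f z \<in> P" "coeff f j \<notin> P"
    using assms(3) by (auto simp: alg_over_def)
  have "\<exists>\<gamma>. \<forall>j. coeff f j = scale (\<gamma> j) 1"
    by (rule choice) (use poly_overD[OF f(1)] in \<open>auto simp: alg_empty\<close>)
  then obtain \<gamma> where \<gamma>: "\<And>j. coeff f j = scale (\<gamma> j) 1" by blast
  have g0: "\<gamma> j = 0" if "degree f < j" for j
    using \<gamma>[of j] that by (simp add: coeff_eq_0)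
  define c where "c i j = (if i = 0 then \<gamma> j else 0)" for i j :: nat
  let ?d = "degree f"
  have "bipoly ?d c 0 z = (\<Sum>j\<le>?d. scale (\<gamma> j) (z ^ j))"
    unfolding bipoly_def by (subst sum.remove[of _ 0]) (auto simp: c_def)
  also have "\<dots> = poly f z" unfolding poly_altdef \<gamma> by (intro sum.cong refl scale_conv)
  finally have "bipoly_relation P True ?d c 0 z"
    using f(2,3) \<gamma>[of j] ideal_0[OF idP] g0
    by (auto simp: bipoly_relation_def c_def intro!: exI[of _ 0] exI[of _ j])
  from ex_separable_relation[OF perf P this]
  obtain d c where r: "bipoly_relation P True d c 0 z"
    "bipoly d (\<lambda>i j. of_nat (Suc j) * c i (Suc j)) 0 z \<notin> P \<or>
     bipoly d (\<lambda>i j. of_nat (Suc i) * c (Suc i) j) 0 z \<notin> P" by blast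
  have "bipoly d (\<lambda>i j. of_nat (Suc i) * c (Suc i) j) 0 z = 0"
    using r(1) by (simp add: bipoly_relation_def bipoly_def)
  then show ?thesis using sep_over_of_relation[OF r(1)] r(2) ideal_0[OF idP] by simp
qed

text \<open>
  The separable relation is symmetric in \<open>t\<close> and \<open>z\<close>; which of the two elements it shows to be
  separable over the other depends on which partial derivative does not vanish.
\<close>

lemma algebraic_imp_separable_either:
  assumes perf: "perfect_field TYPE('k)" and P: "prime_ideal P" and "alg_over P (alg {t}) z"
  shows "sep_over P (alg {t}) z \<or> sep_over P (alg {z}) t"
proof -
  note idP = prime_ideal_ideal[OF P]
  obtain f j where f: "f \<in> poly_over (alg {t})" "poly f z \<in> P" "coeff f j \<notin> P"
    using assms(3) by (auto simp: alg_over_def)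
  have "alg {t} \<subseteq> (\<lambda>p. poly p t) ` poly_over (alg {})"
    using adjoin_eq[OF subalgebra_alg, of t "{}"] alg_mono[of "{t}" "insert t (alg {})"] by blast
  then have "\<exists>h. \<forall>j. h j \<in> poly_over (alg {}) \<and> coeff f j = poly (h j) t"
    by (intro choice) (use poly_overD[OF f(1)] in blast)
  then obtain h where h: "\<And>j. h j \<in> poly_over (alg {})" "\<And>j. coeff f j = poly (h j) t" by blast
  have "\<exists>\<gamma>. \<forall>x. coeff (h (snd x)) (fst x) = scale (\<gamma> x) 1"
    by (rule choice) (use poly_overD[OF h(1)] in \<open>auto simp: alg_empty\<close>)
  then obtain \<gamma> where \<gamma>: "\<And>i j. coeff (h j) i = scale (\<gamma> (i, j)) 1" by auto
  define c where "c i j = (if j \<le> degree f then \<gamma> (i, j) else 0)" for i j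
  define D where "D = (\<Sum>j\<le>degree f. degree (h j))"
  define d where "d = degree f + D"
  have hD: "degree (h j) \<le> D" if "j \<le> degree f" for j
    unfolding D_def using that by (intro member_le_sum) auto
  have supp: "i \<le> D \<and> j \<le> degree f" if "c i j \<noteq> 0" for i j
  proof -
    have j: "j \<le> degree f" and "\<gamma> (i, j) \<noteq> 0" using that by (auto simp: c_def split: if_splits)
    then have "coeff (h j) i \<noteq> 0" by (simp add: \<gamma>)
    then have "i \<le> degree (h j)" by (rule le_degree)
    then show ?thesis using hD[OF j] j by simp
  qed
  have "bipoly d c t z = (\<Sum>j\<le>d. \<Sum>i\<le>d. scale (c i j) (t ^ i) * z ^ j)"
    unfolding bipoly_def by (subst sum.swap) (simp add: scale_mult_left)
  also have "\<dots> = (\<Sum>j\<le>d. coeff f j * z ^ j)"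
  proof (intro sum.cong refl)
    fix j
    have "(\<Sum>i\<le>d. scale (c i j) (t ^ i)) = coeff f j"
    proof (cases "j \<le> degree f")
      case True
      then have "coeff f j = (\<Sum>i\<le>d. coeff (h j) i * t ^ i)"
        unfolding h(2) using hD[of j] by (intro poly_as_sum_upto) (simp add: d_def)
      also have "\<dots> = (\<Sum>i\<le>d. scale (c i j) (t ^ i))"
        unfolding \<gamma> using True by (intro sum.cong refl) (simp add: c_def scale_mult_left)
      finally show ?thesis by simp
    qed (auto simp: c_def coeff_eq_0)
    then show "(\<Sum>i\<le>d. scale (c i j) (t ^ i) * z ^ j) = coeff f j * z ^ j"
      by (simp add: sum_distrib_right[symmetric])
  qed
  also have "\<dots> = poly f z" by (rule poly_as_sum_upto[symmetric]) (simp add: d_def)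
  finally have "bipoly d c t z \<in> P" using f(2) by simp
  moreover have "\<exists>i. c i j \<noteq> 0"
  proof (rule ccontr)
    assume n: "\<not> ?thesis"
    have "j \<le> degree f" using f(3) ideal_0[OF idP] by (intro le_degree) auto
    then have "coeff (h j) i = 0" for i using n by (simp add: \<gamma> c_def)
    then have "h j = 0" by (intro poly_eqI) simp
    then show False using f(3) h(2) ideal_0[OF idP] by simp
  qed
  moreover have "c i j = 0" if "d < i + j" for i j
    using supp[of i j] that unfolding d_def by (cases "c i j = 0") auto
  ultimately have "bipoly_relation P False d c t z" by (auto simp: bipoly_relation_def)
  from ex_separable_relation[OF perf P this]
  obtain d c where r: "bipoly_relation P False d c t z"
    "bipoly d (\<lambda>i j. of_nat (Suc j) * c i (Suc j)) t z \<notin> P \<or>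
     bipoly d (\<lambda>i j. of_nat (Suc i) * c (Suc i) j) t z \<notin> P" by blast
  have r': "bipoly_relation P False d (\<lambda>i j. c j i) z t"
    using r(1) bipoly_swap[of d c t z] by (auto simp: bipoly_relation_def add.commute)
  show ?thesis
    using r(2)
  proof
    assume "bipoly d (\<lambda>i j. of_nat (Suc j) * c i (Suc j)) t z \<notin> P"
    then show ?thesis using sep_over_of_relation[OF r(1)] by simp
  next
    assume "bipoly d (\<lambda>i j. of_nat (Suc i) * c (Suc i) j) t z \<notin> P"
    then show ?thesis
      using sep_over_of_relation[OF r'] bipoly_swap[of d "\<lambda>i j. of_nat (Suc i) * c (Suc i) j" t z] by simp
  qed
qed

text \<open>
  Starting from \<open>k[t]\<close>, adjoin elements each of which is separable modulo \<open>P\<close> over the algebra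
  reached so far.
\<close>

inductive sep_tower :: "'a set \<Rightarrow> 'a \<Rightarrow> 'a set \<Rightarrow> bool" for P t where
  base: "sep_tower P t (alg {t})"
| step: "sep_tower P t B \<Longrightarrow> sep_over P B x \<Longrightarrow> sep_tower P t (alg (insert x B))"

lemma sep_tower_subalgebra: "sep_tower P t B \<Longrightarrow> subalgebra scale B"
  by (erule sep_tower.cases) (auto intro: subalgebra_alg)

lemma sep_tower_base: "sep_tower P t B \<Longrightarrow> t \<in> B"
proof (induction rule: sep_tower.induct)
  case base
  show ?case using alg_inc[of "{t}"] by blast
next
  case (step B x)
  then show ?case using alg_inc[of "insert x B"] by blast
qed

text \<open>
  Place \<open>z\<close> below the whole tower: \<open>t\<close> becomes its first step, and the later steps stay separable
  over larger algebras.
\<close>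

lemma sep_tower_change_base:
  assumes "sep_tower P t B" and "sep_over P (alg {z}) t"
  shows "\<exists>B'. sep_tower P z B' \<and> insert z B \<subseteq> B'"
  using assms
proof (induction rule: sep_tower.induct)
  case base
  have "sep_tower P z (alg (insert t (alg {z})))" by (intro sep_tower.intros base)
  moreover have "insert z (alg {t}) \<subseteq> alg (insert t (alg {z}))"
    using alg_inc[of "insert t (alg {z})"] alg_inc[of "{z}"] alg_mono[of "{t}" "insert t (alg {z})"] by blast
  ultimately show ?case by blast
next
  case (step B x)
  then obtain B' where B': "sep_tower P z B'" "insert z B \<subseteq> B'" by blast
  then have "sep_tower P z (alg (insert x B'))"
    using step.hyps(2) sep_over_mono[of B B'] by (intro sep_tower.step) auto
  moreover have "insert z (alg (insert x B)) \<subseteq> alg (insert x B')"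
    using B' alg_mono[of "insert x B" "insert x B'"] alg_inc[of "insert x B'"] by blast
  ultimately show ?case by blast
qed

text \<open>
  The existence of a separating transcendence basis over a perfect field. The generators are added
  one at a time. A new generator \<open>z\<close> is separable over the tower, or else \<open>t\<close> is separable over
  \<open>k[z]\<close> and \<open>z\<close> replaces it as the base. The value \<open>t = 0\<close> encodes a tower over \<open>k[0] = k\<close>, which
  occurs when \<open>A/P\<close> is algebraic over \<open>k\<close>.
\<close>

lemma ex_sep_tower:
  assumes perf: "perfect_field TYPE('k)" and dim: "krull_dim TYPE('a) = 1" and P: "prime_ideal P"
    and S: "finite S" "alg S = UNIV"
  shows "\<exists>t. (t = 0 \<or> \<not> alg_over P (alg {}) t) \<and> sep_tower P t UNIV"
proof -
  have "\<exists>t B. (t = 0 \<or> \<not> alg_over P (alg {}) t) \<and> sep_tower P t B \<and> F \<subseteq> B" if "finite F" for F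
    using that
  proof (induction F rule: finite_induct)
    case empty
    then show ?case using sep_tower.base by blast
  next
    case (insert z F)
    then obtain t B where t: "t = 0 \<or> \<not> alg_over P (alg {}) t" and B: "sep_tower P t B" "F \<subseteq> B" by blast
    have sub: "alg {} \<subseteq> B" "alg {t} \<subseteq> B"
      using alg_subset[OF sep_tower_subalgebra[OF B(1)]] sep_tower_base[OF B(1)] by auto
    have adjoin: ?case if "sep_over P B z"
    proof -
      have "sep_tower P t (alg (insert z B))" using B that by (intro sep_tower.step)
      moreover have "insert z F \<subseteq> alg (insert z B)" using B alg_inc[of "insert z B"] by blast
      ultimately show ?case using t by blast
    qed
    show ?case
    proof (cases "alg_over P (alg {}) z")
      case True
      then show ?thesis
        using algebraic_imp_separable[OF perf P] sep_over_mono[OF sub(1)] adjoin by blast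
    next
      case z: False
      have change: ?thesis if "sep_over P (alg {z}) t"
        using sep_tower_change_base[OF B(1) that] B(2) z by blast
      show ?thesis
      proof (cases "t = 0")
        case True
        have "sep_over P (alg {z}) 0"
          unfolding sep_over_def
        proof (intro bexI[of _ "[:0, 1:]"] conjI)
          show "[:0, 1:] \<in> poly_over (alg {z})"
            using subring_rules(1,2)[OF subring_alg[of "{z}"]] by (auto simp: poly_over_def coeff_pCons split: nat.splits)
        qed (auto simp: fderiv_pCons prime_ideal_one[OF P] ideal_0[OF prime_ideal_ideal[OF P]])
        then show ?thesis using change True by simp
      next
        case False
        then have "alg_over P (alg {t}) z" using transcendence_degree_le_one[OF dim P S] t by blast
        then have "sep_over P (alg {t}) z \<or> sep_over P (alg {z}) t"
          by (rule algebraic_imp_separable_either[OF perf P])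
        then show ?thesis using change adjoin sep_over_mono[OF sub(2)] by blast
      qed
    qed
  qed
  from this[OF S(1)] obtain t B where t: "t = 0 \<or> \<not> alg_over P (alg {}) t" "sep_tower P t B" "S \<subseteq> B" by blast
  moreover have "B = UNIV" using alg_subset[OF sep_tower_subalgebra[OF t(2)] t(3)] S(2) by auto
  ultimately show ?thesis by blast
qed

text \<open>
  Applying \<open>\<delta>\<close> to a separable equation of \<open>x\<close> over \<open>B\<close> expresses \<open>\<delta> x\<close>, up to the invertible
  factor \<open>f'(x)\<close>, through the values of \<open>\<delta>\<close> on \<open>B\<close>.
\<close>

lemma sep_tower_derivation:
  assumes P: "prime_ideal P" and "sep_tower P t B" and \<delta>: "\<delta> \<in> Der scale"
    and \<delta>P: "\<And>x. x \<in> P \<Longrightarrow> \<delta> x \<in> P" and t: "\<delta> t \<in> P" and "x \<in> B"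
  shows "\<delta> x \<in> P"
proof -
  note idP = prime_ideal_ideal[OF P]
  interpret \<delta>: Vector_Spaces.linear scale scale \<delta> using \<delta> by (auto simp: Der_def)
  have mult: "\<delta> (x * y) = x * \<delta> y + \<delta> x * y" for x y using \<delta> by (auto simp: Der_def)
  have "\<delta> 1 = 0" using mult[of 1 1] by simp
  have sub: "subalgebra scale {x. \<delta> x \<in> P}"
  proof (rule subalgebraI)
    fix x y assume "x \<in> {x. \<delta> x \<in> P}" "y \<in> {x. \<delta> x \<in> P}"
    then show "x * y \<in> {x. \<delta> x \<in> P}"
      using ideal_add[OF idP ideal_mult_left[OF idP, of "\<delta> y" x] ideal_mult_right[OF idP, of "\<delta> x" y]]
      by (simp add: mult)
  qed (use \<open>\<delta> 1 = 0\<close> in \<open>auto simp: \<delta>.add \<delta>.scale ideal_0[OF idP] scale_in_ideal[OF idP] ideal_add[OF idP]\<close>)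
  have "B \<subseteq> {x. \<delta> x \<in> P}"
    using assms(2)
  proof (induction rule: sep_tower.induct)
    case base
    show ?case using t by (intro alg_subset[OF sub]) auto
  next
    case (step B x)
    note sB = subalgebra_subring[OF sep_tower_subalgebra[OF step.hyps(1)]]
    obtain f where f: "f \<in> poly_over B" "poly f x \<in> P" "poly (fderiv f) x \<notin> P"
      using step.hyps(2) by (auto simp: sep_over_def)
    have "\<delta> (poly f x) - poly (fderiv f) x * \<delta> x \<in> P"
      using f(1)
    proof (induction f)
      case (pCons a q)
      then have aq: "a \<in> B" "q \<in> poly_over B" by (auto simp: pCons_poly_over[OF sB])
      have "\<delta> (poly (pCons a q) x) - poly (fderiv (pCons a q)) x * \<delta> x
        = \<delta> a + x * (\<delta> (poly q x) - poly (fderiv q) x * \<delta> x)"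
        by (simp add: mult \<delta>.add fderiv_pCons algebra_simps)
      also have "\<dots> \<in> P"
        using step.IH aq pCons.IH[OF aq(2)] by (intro ideal_add[OF idP] ideal_mult_left[OF idP]) auto
      finally show ?case .
    qed (simp add: ideal_0[OF idP])
    then have "poly (fderiv f) x * \<delta> x \<in> P" using ideal_cong_iff[OF idP] \<delta>P[OF f(2)] by blast
    then have "\<delta> x \<in> P" using f(3) prime_idealD[OF P] by blast
    then show ?case using step.IH by (intro alg_subset[OF sub]) auto
  qed
  then show ?thesis using assms(6) by blast
qed

end

section \<open>Power series: a formal Newton iteration\<close>

text \<open>
  These are the maps that do not increase the \<open>X\<close>-adic distance; composed with multiplication by
  \<open>X\<close> they become contractions.
\<close>

definition causal :: "('r::comm_ring_1 fps \<Rightarrow> 'r fps) \<Rightarrow> bool" where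
  "causal \<Psi> \<longleftrightarrow> (\<forall>n a b. (\<forall>i<n. a $ i = b $ i) \<longrightarrow> (\<forall>i<n. \<Psi> a $ i = \<Psi> b $ i))"

lemma causal_const: "causal (\<lambda>_. c)"
  and causal_id: "causal (\<lambda>w. w)"
  and causal_add: "causal \<Phi> \<Longrightarrow> causal \<Psi> \<Longrightarrow> causal (\<lambda>w. \<Phi> w + \<Psi> w)"
  by (simp_all add: causal_def)

lemma causal_mult:
  fixes \<Phi> \<Psi> :: "'r::comm_ring_1 fps \<Rightarrow> 'r fps"
  assumes "causal \<Phi>" "causal \<Psi>"
  shows "causal (\<lambda>w. \<Phi> w * \<Psi> w)"
  unfolding causal_def
proof (intro allI impI)
  fix n i and a b :: "'r fps"
  assume ab: "\<forall>i<n. a $ i = b $ i" and i: "i < n"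
  then have "\<Phi> a $ j = \<Phi> b $ j" "\<Psi> a $ j = \<Psi> b $ j" if "j \<le> i" for j
    using assms that unfolding causal_def by (meson le_less_trans)+
  then show "(\<Phi> a * \<Psi> a) $ i = (\<Phi> b * \<Psi> b) $ i"
    unfolding fps_mult_nth by (intro sum.cong) auto
qed

lemma causal_poly: "causal \<Phi> \<Longrightarrow> causal (\<lambda>w. poly q (\<Phi> w))"
  by (induction q) (auto intro: causal_const causal_add causal_mult)

lemma causal_fixpoint:
  fixes \<alpha> :: "'r::comm_ring_1 fps"
  assumes \<Psi>: "causal \<Psi>"
  shows "\<exists>w. w = \<alpha> + fps_X * \<Psi> w"
proof -
  define T where "T w = \<alpha> + fps_X * \<Psi> w" for w
  have T: "T a $ i = T b $ i" if "\<And>j. j < i \<Longrightarrow> a $ j = b $ j" for a b i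
  proof (cases i)
    case (Suc k)
    have "\<forall>j<i. \<Psi> a $ j = \<Psi> b $ j" using \<Psi> that unfolding causal_def by blast
    then show ?thesis by (simp add: T_def Suc)
  qed (simp add: T_def)
  have iter: "(T ^^ n) a $ i = (T ^^ n) b $ i" if "i < n" for n a b i
    using that
  proof (induction n arbitrary: i)
    case (Suc n)
    then have "T ((T ^^ n) a) $ i = T ((T ^^ n) b) $ i" by (intro T) auto
    then show ?case by simp
  qed simp
  define w where "w = Abs_fps (\<lambda>i. (T ^^ Suc i) 0 $ i)"
  have w: "w $ i = (T ^^ n) 0 $ i" if "i < n" for i n
  proof -
    have "(T ^^ n) 0 = (T ^^ Suc i) ((T ^^ (n - Suc i)) 0)"
      using that by (metis Suc_leI comp_apply funpow_add le_add_diff_inverse)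
    then show ?thesis using iter[of i "Suc i"] by (simp add: w_def del: funpow.simps)
  qed
  have "T w = w"
  proof (rule fps_ext)
    fix i
    have "T w $ i = T ((T ^^ i) 0) $ i" by (intro T w)
    also have "\<dots> = w $ i" using w[of i "Suc i"] by simp
    finally show "T w $ i = w $ i" .
  qed
  then show ?thesis by (metis T_def)
qed

lemma poly_taylor:
  "\<exists>q. \<forall>z. poly f (x + z) = poly f x + poly (fderiv f) x * z + z * z * poly q z"
proof (induction f)
  case (pCons a f)
  then obtain q where q: "\<And>z. poly f (x + z) = poly f x + poly (fderiv f) x * z + z * z * poly q z"
    by blast
  have "poly (pCons a f) (x + z) = poly (pCons a f) x + poly (fderiv (pCons a f)) x * z
    + z * z * poly ([:poly (fderiv f) x:] + [:x, 1:] * q) z" for z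
    by (simp add: q fderiv_pCons algebra_simps)
  then show ?case by blast
qed (auto intro: exI[of _ 0])

text \<open>
  Newton's method for an approximate root at which the derivative \<open>g\<close> is not a unit. The error is
  divisible by \<open>g\<^sup>2\<close>: put \<open>z = g v X w\<close>; then every term of the Taylor expansion of \<open>f\<close> at \<open>x\<close>,
  apart from the constant \<open>c\<close>, is divisible by \<open>e = g\<^sup>2 v X\<close>, and division leaves the fixed-point
  equation \<open>w = - \<eta> - X \<Psi>(w)\<close>.
\<close>

lemma newton_lift:
  fixes f :: "'r::comm_ring_1 fps poly" and g v x c :: 'r
  defines "e \<equiv> fps_const (g * g * v) * fps_X"
  assumes f: "poly f (fps_const x) = fps_const c + e * \<eta>"
    and f': "poly (fderiv f) (fps_const x) = fps_const g + e * \<xi>"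
  shows "\<exists>w. poly f (fps_const x + fps_const (g * v) * fps_X * w) = fps_const c"
proof -
  let ?G = "fps_const g" and ?V = "fps_const v"
  obtain q where q: "\<And>z. poly f (fps_const x + z) =
      poly f (fps_const x) + poly (fderiv f) (fps_const x) * z + z * z * poly q z"
    using poly_taylor by blast
  define \<Psi> where "\<Psi> w = ?G * ?V * \<xi> * w + ?V * w * w * poly q (?G * ?V * fps_X * w)" for w
  have "causal (\<lambda>w. (- 1) * \<Psi> w)"
    unfolding \<Psi>_def by (intro causal_const causal_id causal_add causal_mult causal_poly)
  then obtain w where "w = - \<eta> + fps_X * ((- 1) * \<Psi> w)" using causal_fixpoint by blast
  then have w: "\<eta> + w + fps_X * \<Psi> w = 0" by (simp add: add_eq_0_iff algebra_simps)
  define z where "z = ?G * ?V * fps_X * w"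
  have "e = ?G * ?G * ?V * fps_X" by (simp only: e_def fps_const_mult[symmetric])
  then have "poly f (fps_const x + z) = fps_const c + e * (\<eta> + w + fps_X * \<Psi> w)"
    unfolding q f f'
    by (simp add: \<Psi>_def z_def algebra_simps del: fps_const_mult)
  then have "poly f (fps_const x + z) = fps_const c" unfolding w by simp
  then show ?thesis unfolding z_def by (intro exI[of _ w]) (simp add: mult.assoc)
qed

definition coeffs_in :: "'r::comm_ring_1 set \<Rightarrow> 'r fps set" where
  "coeffs_in P = {U. \<forall>n. U $ n \<in> P}"

lemma prime_ideal_coeffs_in:
  assumes P: "prime_ideal P"
  shows "prime_ideal (coeffs_in P)"
  unfolding prime_ideal_def
proof (intro conjI allI impI)
  note idP = prime_ideal_ideal[OF P]
  show "ring_ideal (coeffs_in P)"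
    unfolding ring_ideal_def
    by (auto simp: coeffs_in_def fps_mult_nth ideal_0[OF idP] ideal_add[OF idP]
        intro!: ideal_sum[OF idP] ideal_mult_left[OF idP])
  have "1 \<notin> coeffs_in P" using prime_ideal_one[OF P] by (auto simp: coeffs_in_def intro: exI[of _ 0])
  then show "coeffs_in P \<noteq> UNIV" by blast
  fix U V :: "'a fps"
  assume UV: "U * V \<in> coeffs_in P"
  show "U \<in> coeffs_in P \<or> V \<in> coeffs_in P"
  proof (rule ccontr)
    assume "\<not> ?thesis"
    then have ex: "\<exists>m. U $ m \<notin> P" "\<exists>n. V $ n \<notin> P" by (auto simp: coeffs_in_def)
    define m n where "m = (LEAST m. U $ m \<notin> P)" and "n = (LEAST n. V $ n \<notin> P)"
    have mn: "U $ m \<notin> P" "V $ n \<notin> P" unfolding m_def n_def by (rule LeastI_ex[OF ex(1)], rule LeastI_ex[OF ex(2)])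
    have lt: "U $ i \<in> P" if "i < m" for i using not_less_Least that unfolding m_def by blast
    have lt': "V $ i \<in> P" if "i < n" for i using not_less_Least that unfolding n_def by blast
    have "(U * V) $ (m + n) - U $ m * V $ n = (\<Sum>i\<in>{0..m + n} - {m}. U $ i * V $ (m + n - i))"
      by (simp add: fps_mult_nth sum_diff1)
    also have "\<dots> \<in> P"
    proof (rule ideal_sum[OF idP])
      fix i assume "i \<in> {0..m + n} - {m}"
      then have "i < m \<or> m + n - i < n" by auto
      then show "U $ i * V $ (m + n - i) \<in> P"
        using lt lt' ideal_mult_left[OF idP] ideal_mult_right[OF idP] by blast
    qed
    finally have "U $ m * V $ n \<in> P" using UV ideal_cong_iff[OF idP] by (auto simp: coeffs_in_def)
    then show False using mn prime_idealD[OF P] by blast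
  qed
qed

lemma fderiv_add: "fderiv (p + q) = fderiv p + fderiv q"
  by (rule poly_eqI) (simp add: coeff_fderiv algebra_simps)

lemma fderiv_smult: "fderiv (smult c p) = smult c (fderiv p)"
  by (rule poly_eqI) (simp add: coeff_fderiv algebra_simps)

lemma fderiv_map_fps_const: "fderiv (map_poly fps_const f) = map_poly fps_const (fderiv f)"
  by (rule poly_eqI) (simp add: coeff_fderiv coeff_map_poly fps_of_nat[symmetric] del: of_nat_Suc)

lemma poly_map_fps_const: "poly (map_poly fps_const f) (fps_const x) = fps_const (poly f x)"
  by (induction f) (auto simp: map_poly_pCons)

section \<open>Lifting a separable tower to power series\<close>

context comm_algebra
begin

definition fscale :: "'k \<Rightarrow> 'a fps \<Rightarrow> 'a fps" where
  "fscale c U = fps_const (scale c 1) * U"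

lemma fscale_nth: "fscale c U $ n = scale c (U $ n)"
  by (simp add: fscale_def scale_mult_left)

lemma comm_algebra_fscale: "comm_algebra fscale"
proof unfold_locales
  fix a :: 'k and x y :: "'a fps"
  show "fscale a x * y = fscale a (x * y)" by (simp add: fscale_def mult.assoc)
qed (auto simp: fps_eq_iff fscale_nth scale_right_distrib scale_left_distrib)

interpretation F: comm_algebra fscale
  by (rule comm_algebra_fscale)

lemma constants_subalgebra:
  assumes G: "subalgebra fscale G"
  shows "subalgebra scale ((\<lambda>U. U $ 0) ` G)"
proof (rule subalgebraI)
  note sG = F.subalgebra_subring[OF G]
  show "1 \<in> (\<lambda>U. U $ 0) ` G" using subring_1[OF sG] by (intro image_eqI[of _ _ 1]) auto
  fix x y assume "x \<in> (\<lambda>U. U $ 0) ` G" "y \<in> (\<lambda>U. U $ 0) ` G"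
  then obtain U V where UV: "U \<in> G" "V \<in> G" "x = U $ 0" "y = V $ 0" by auto
  show "x + y \<in> (\<lambda>U. U $ 0) ` G"
    using UV subring_add[OF sG] by (intro image_eqI[of _ _ "U + V"]) auto
  show "x * y \<in> (\<lambda>U. U $ 0) ` G"
    using UV subring_mult[OF sG] by (intro image_eqI[of _ _ "U * V"]) auto
next
  fix c x assume "x \<in> (\<lambda>U. U $ 0) ` G"
  then obtain U where "U \<in> G" "x = U $ 0" by auto
  then show "scale c x \<in> (\<lambda>U. U $ 0) ` G"
    using F.subalgebra_scale[OF G] by (intro image_eqI[of _ _ "fscale c U"]) (auto simp: fscale_nth)
qed

lemma dvd_scale: "v dvd x \<Longrightarrow> v dvd scale c x"
  by (subst scale_conv) simp

lemma higher_coeffs_dvd_subalgebra: "subalgebra fscale {U. \<forall>n>0. v dvd U $ n}"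
proof (rule F.subalgebraI)
  fix U V :: "'a fps"
  assume UV: "U \<in> {U. \<forall>n>0. v dvd U $ n}" "V \<in> {U. \<forall>n>0. v dvd U $ n}"
  have "v dvd (U * V) $ n" if "0 < n" for n
    unfolding fps_mult_nth
  proof (rule dvd_sum)
    fix i
    show "v dvd U $ i * V $ (n - i)"
      using UV that by (cases "i = 0") auto
  qed
  then show "U * V \<in> {U. \<forall>n>0. v dvd U $ n}" by blast
qed (auto simp: fscale_nth intro: dvd_scale)

text \<open>
  The elements of the tower are deformed along with \<open>t + h v X\<close> by solving their separable
  equations with \<open>newton_lift\<close>. This gives an algebra of power series whose constant terms exhaust
  \<open>B\<close>; that each constant term has only one lift is shown afterwards. One step of the tower costs
  a factor \<open>g\<^sup>2\<close> of the deformation parameter, where \<open>g\<close> is the derivative of the equation at its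
  root. This is why the statement is made for all \<open>v\<close>, so that the induction hypothesis can be
  used for \<open>g\<^sup>2 v\<close>, and where the denominator \<open>h\<close> comes from. Linear growth is inherited because
  each new series is algebraic over the preceding ones.
\<close>

lemma lift_sep_tower:
  assumes P: "prime_ideal P" and "sep_tower P t B"
  shows "\<exists>h. h \<notin> P \<and> (\<forall>v. \<exists>S. F.linear_growth (coeffs_in P) S \<and>
    fps_const t + fps_const (h * v) * fps_X \<in> F.alg S \<and>
    (\<forall>U\<in>F.alg S. \<forall>n>0. v dvd U $ n) \<and> B \<subseteq> (\<lambda>U. U $ 0) ` F.alg S)"
  using assms(2)
proof (induction rule: sep_tower.induct)
  case base
  note Q = prime_ideal_coeffs_in[OF P]
  show ?case
  proof (intro exI[of _ 1] conjI allI)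
    show "1 \<notin> P" by (rule prime_ideal_one[OF P])
    fix v
    define T where "T = fps_const t + fps_const (1 * v) * fps_X"
    have TS: "T \<in> F.alg {T}" using F.alg_inc[of "{T}"] by blast
    have "F.alg {T} \<subseteq> {U. \<forall>n>0. v dvd U $ n}"
      by (intro F.alg_subset[OF higher_coeffs_dvd_subalgebra]) (auto simp: T_def fps_X_def)
    moreover have "alg {t} \<subseteq> (\<lambda>U. U $ 0) ` F.alg {T}"
      using TS by (intro alg_subset[OF constants_subalgebra[OF F.subalgebra_alg]])
        (auto simp: T_def intro!: image_eqI[of _ _ T])
    ultimately show "\<exists>S. F.linear_growth (coeffs_in P) S \<and>
      fps_const t + fps_const (1 * v) * fps_X \<in> F.alg S \<and>
      (\<forall>U\<in>F.alg S. \<forall>n>0. v dvd U $ n) \<and> alg {t} \<subseteq> (\<lambda>U. U $ 0) ` F.alg S"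
      using F.linear_growth_singleton[OF Q] TS unfolding T_def by blast
  qed
next
  case (step B x)
  note Q = prime_ideal_coeffs_in[OF P]
  note idQ = prime_ideal_ideal[OF Q]
  note B = sep_tower_subalgebra[OF step.hyps(1)]
  obtain h where h: "h \<notin> P" and IH: "\<And>v. \<exists>S. F.linear_growth (coeffs_in P) S \<and>
    fps_const t + fps_const (h * v) * fps_X \<in> F.alg S \<and>
    (\<forall>U\<in>F.alg S. \<forall>n>0. v dvd U $ n) \<and> B \<subseteq> (\<lambda>U. U $ 0) ` F.alg S"
    using step.IH by blast
  obtain f where f: "f \<in> poly_over B" "poly f x \<in> P" "poly (fderiv f) x \<notin> P"
    using step.hyps(2) by (auto simp: sep_over_def)
  define g where "g = poly (fderiv f) x"
  show ?case
  proof (intro exI[of _ "h * (g * g)"] conjI allI)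
    show "h * (g * g) \<notin> P" using h f(3) prime_idealD[OF P] unfolding g_def by blast
    fix v
    let ?v = "g * g * v"
    obtain S where gr: "F.linear_growth (coeffs_in P) S"
      and T: "fps_const t + fps_const (h * ?v) * fps_X \<in> F.alg S"
      and dvd: "\<And>U n. U \<in> F.alg S \<Longrightarrow> 0 < n \<Longrightarrow> ?v dvd U $ n"
      and onto: "B \<subseteq> (\<lambda>U. U $ 0) ` F.alg S" using IH[of ?v] by blast
    let ?e = "fps_const ?v * fps_X"
    have ex: "\<exists>U M. U \<in> F.alg S \<and> U = fps_const a + ?e * M \<and> (a = 0 \<longrightarrow> U = 0 \<and> M = 0)" if aB: "a \<in> B" for a
    proof (cases "a = 0")
      case True
      then show ?thesis using subring_0[OF F.subring_alg[of S]] by (intro exI[of _ 0]) auto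
    next
      case False
      obtain U where U: "U \<in> F.alg S" "a = U $ 0" using aB onto by auto
      have "\<exists>m. \<forall>n. U $ (Suc n) = ?v * m n" using dvd[OF U(1)] by (intro choice) (auto simp: dvd_def)
      then obtain m where m: "\<And>n. U $ (Suc n) = ?v * m n" by blast
      have "U = fps_const a + ?e * Abs_fps m"
        by (rule fps_ext) (auto simp: U(2) m mult.assoc fps_X_mult_nth gr0_conv_Suc)
      then show ?thesis using U False by blast
    qed
    \<comment> \<open>\<open>L a\<close> lifts \<open>a\<close>; the lift of zero is zero, so that \<open>map_poly L\<close> acts on
        coefficients\<close>
    have "\<exists>L. \<forall>a\<in>B. \<exists>M. L a \<in> F.alg S \<and> L a = fps_const a + ?e * M \<and> (a = 0 \<longrightarrow> L a = 0 \<and> M = 0)"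
      by (rule bchoice) (use ex in blast)
    then obtain L where L: "\<forall>a\<in>B. \<exists>M. L a \<in> F.alg S \<and> L a = fps_const a + ?e * M \<and> (a = 0 \<longrightarrow> L a = 0 \<and> M = 0)"
      by (rule exE)
    from bchoice[OF L] obtain M where
      M: "\<forall>a\<in>B. L a \<in> F.alg S \<and> L a = fps_const a + ?e * M a \<and> (a = 0 \<longrightarrow> L a = 0 \<and> M a = 0)"
      by (rule exE)
    have LM: "\<And>a. a \<in> B \<Longrightarrow> L a \<in> F.alg S" "\<And>a. a \<in> B \<Longrightarrow> L a = fps_const a + ?e * M a"
      "L 0 = 0" "M 0 = 0"
      using M subring_0[OF subalgebra_subring[OF B]] by blast+
    define p where "p = map_poly L f"
    have cp: "coeff p i = L (coeff f i)" for i by (simp add: p_def coeff_map_poly LM(3))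
    have p: "p = map_poly fps_const f + smult ?e (map_poly M f)"
      by (rule poly_eqI) (simp add: cp coeff_map_poly LM(2,4) poly_overD[OF f(1)])
    have 1: "poly p (fps_const x) = fps_const (poly f x) + ?e * poly (map_poly M f) (fps_const x)"
      by (simp add: p poly_map_fps_const)
    have 2: "poly (fderiv p) (fps_const x) = fps_const g + ?e * poly (fderiv (map_poly M f)) (fps_const x)"
      by (simp add: p fderiv_add fderiv_smult fderiv_map_fps_const poly_map_fps_const g_def)
    obtain w where w: "poly p (fps_const x + fps_const (g * v) * fps_X * w) = fps_const (poly f x)"
      using newton_lift[OF 1 2] by blast
    define Y where "Y = fps_const x + fps_const (g * v) * fps_X * w"
    have pY: "poly p Y \<in> coeffs_in P"
      using w f(2) ideal_0[OF prime_ideal_ideal[OF P]] by (auto simp: Y_def coeffs_in_def)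
    have "\<exists>i. coeff (fderiv f) i \<notin> P"
      using f(3) poly_in_ideal[OF prime_ideal_ideal[OF P]] by metis
    then obtain i where i: "coeff f (Suc i) \<notin> P"
      using ideal_mult_left[OF prime_ideal_ideal[OF P]] by (auto simp: coeff_fderiv)
    have "L (coeff f (Suc i)) $ 0 = coeff f (Suc i)"
      using LM(2)[OF poly_overD[OF f(1)]] by (simp add: mult.assoc)
    then have "coeff p (Suc i) $ 0 \<notin> P" using i by (simp add: cp)
    then have iQ: "coeff p (Suc i) \<notin> coeffs_in P" by (auto simp: coeffs_in_def)
    obtain m where im: "Suc i \<le> m" and m: "coeff p m \<notin> coeffs_in P"
      and root: "(\<Sum>i\<le>m. coeff p i * Y ^ i) \<in> coeffs_in P"
      using ex_truncated_relation_mod[OF idQ pY iQ] by blast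
    have m0: "0 < m" using im by simp
    have gr': "F.linear_growth (coeffs_in P) (insert Y S)"
      by (rule F.linear_growth_insert[OF Q gr m0 _ m root])
        (use LM(1) poly_overD[OF f(1)] cp in auto)
    have sub: "F.alg S \<subseteq> F.alg (insert Y S)" by (intro F.alg_mono) auto
    have Yin: "Y \<in> F.alg (insert Y S)" using F.alg_inc[of "insert Y S"] by blast
    have "v dvd Y $ n" if "0 < n" for n
      using that by (auto simp: Y_def mult.assoc)
    moreover have "v dvd U $ n" if "U \<in> F.alg S" "0 < n" for U n
      using dvd[OF that] by (metis dvd_mult_right)
    ultimately have "F.alg (insert Y S) \<subseteq> {U. \<forall>n>0. v dvd U $ n}"
      using F.alg_inc[of S] by (intro F.alg_subset[OF higher_coeffs_dvd_subalgebra]) blast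
    moreover have "alg (insert x B) \<subseteq> (\<lambda>U. U $ 0) ` F.alg (insert Y S)"
    proof (rule alg_subset[OF constants_subalgebra[OF F.subalgebra_alg]])
      have "x = Y $ 0" by (simp add: Y_def mult.assoc)
      then show "insert x B \<subseteq> (\<lambda>U. U $ 0) ` F.alg (insert Y S)" using onto sub Yin by blast
    qed
    moreover have "fps_const t + fps_const (h * (g * g) * v) * fps_X \<in> F.alg (insert Y S)"
      using T sub by (auto simp: mult.assoc)
    ultimately show "\<exists>S. F.linear_growth (coeffs_in P) S \<and>
      fps_const t + fps_const (h * (g * g) * v) * fps_X \<in> F.alg S \<and>
      (\<forall>U\<in>F.alg S. \<forall>n>0. v dvd U $ n) \<and> alg (insert x B) \<subseteq> (\<lambda>U. U $ 0) ` F.alg S"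
      using gr' by blast
  qed
qed

text \<open>
  There are \<open>(N + 1)\<^sup>2\<close> products \<open>T ^ i * z ^ j\<close> with \<open>i, j \<le> N\<close>, but by linear growth they span a
  space of dimension \<open>O(N)\<close>; so \<open>z\<close> is algebraic over \<open>k[T]\<close> modulo \<open>P\<close>. If \<open>z\<close> were nonzero
  modulo \<open>P\<close>, one could divide the relation by a power of \<open>z\<close>, and its constant coefficient would
  be an algebraic relation for \<open>t = T(0)\<close>.
\<close>

lemma lift_zero_if_constant_zero:
  assumes P: "prime_ideal P" and gr: "F.linear_growth (coeffs_in P) S"
    and TS: "T \<in> F.alg S" and trans: "\<not> alg_over P (alg {}) (T $ 0)"
    and z: "z \<in> F.alg S" "z $ 0 \<in> P"
  shows "z \<in> coeffs_in P"
proof (rule ccontr)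
  assume zQ: "z \<notin> coeffs_in P"
  note Q = prime_ideal_coeffs_in[OF P]
  note idP = prime_ideal_ideal[OF P]
  obtain C where C: "\<forall>n I (v :: nat \<times> nat \<Rightarrow> _). finite I \<longrightarrow> C * (n + 1) < card I \<longrightarrow>
    (\<forall>i\<in>I. v i \<in> F.filtration S n) \<longrightarrow>
    (\<exists>\<kappa>. (\<exists>i\<in>I. \<kappa> i \<noteq> 0) \<and> (\<Sum>i\<in>I. fscale (\<kappa> i) (v i)) \<in> coeffs_in P)"
    using F.linear_growth_dependent[where 'i = "nat \<times> nat", OF Q gr] by (rule exE)
  obtain d where d: "T \<in> F.filtration S d" "z \<in> F.filtration S d"
    using F.finite_subset_filtration[of "{T, z}" S] TS z by auto
  \<comment> \<open>large enough for \<open>(N + 1)\<^sup>2\<close> to exceed the bound \<open>C * (2 * d * N + 1)\<close>\<close>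
  define N where "N = C * (2 * d + 1)"
  let ?I = "{..N} \<times> {..N}"
  have "\<exists>\<kappa>. (\<exists>i\<in>?I. \<kappa> i \<noteq> 0) \<and> (\<Sum>i\<in>?I. fscale (\<kappa> i) (case i of (i, j) \<Rightarrow> T ^ i * z ^ j)) \<in> coeffs_in P"
  proof (rule C[rule_format])
    show "C * (2 * d * N + 1) < card ?I"
    proof (cases "N = 0")
      case True
      then show ?thesis by (simp add: N_def)
    next
      case False
      then have "C * (2 * d * N + 1) \<le> C * ((2 * d + 1) * N)" by (intro mult_le_mono) auto
      also have "C * ((2 * d + 1) * N) = N * N" unfolding mult.assoc[symmetric] N_def[symmetric] ..
      also have "\<dots> < card ?I" by simp
      finally show ?thesis .
    qed
    fix x assume "x \<in> ?I"
    then obtain i j where ij: "x = (i, j)" "i \<le> N" "j \<le> N" by auto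
    have "T ^ i * z ^ j \<in> F.filtration S (d * i + d * j)" by (intro F.filtration_mult F.filtration_power d)
    moreover have "d * i + d * j \<le> 2 * d * N"
    proof -
      have "d * i \<le> d * N" "d * j \<le> d * N" using ij by simp_all
      moreover have "2 * d * N = d * N + d * N" by simp
      ultimately show ?thesis by linarith
    qed
    ultimately have "T ^ i * z ^ j \<in> F.filtration S (2 * d * N)" using F.filtration_mono by blast
    then show "(case x of (i, j) \<Rightarrow> T ^ i * z ^ j) \<in> F.filtration S (2 * d * N)" using ij by simp
  qed auto
  then obtain \<kappa> where nz: "\<exists>i\<le>N. \<exists>j\<le>N. \<kappa> (i, j) \<noteq> 0"
    and rel: "(\<Sum>(i, j)\<in>?I. fscale (\<kappa> (i, j)) (T ^ i * z ^ j)) \<in> coeffs_in P"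
    by (auto simp: case_prod_unfold)
  define j0 where "j0 = (LEAST j. \<exists>i\<le>N. \<kappa> (i, j) \<noteq> 0)"
  have "\<exists>i\<le>N. \<kappa> (i, j0) \<noteq> 0" unfolding j0_def by (rule LeastI_ex) (use nz in blast)
  then obtain i0 where i0: "i0 \<le> N" "\<kappa> (i0, j0) \<noteq> 0" by blast
  have low: "\<kappa> (i, j) = 0" if "j < j0" "i \<le> N" for i j
    using not_less_Least that unfolding j0_def by blast
  have j0N: "j0 \<le> N"
  proof -
    obtain j where j: "j \<le> N" "\<exists>i\<le>N. \<kappa> (i, j) \<noteq> 0" using nz by blast
    have "j0 \<le> j" unfolding j0_def by (rule Least_le) (rule j(2))
    then show ?thesis using j(1) by simp
  qed
  define W where "W = (\<Sum>(i, j)\<in>?I. fscale (if j < j0 then 0 else \<kappa> (i, j)) (T ^ i * z ^ (j - j0)))"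
  have "(\<Sum>(i, j)\<in>?I. fscale (\<kappa> (i, j)) (T ^ i * z ^ j)) = z ^ j0 * W"
    unfolding W_def sum_distrib_left
  proof (intro sum.cong refl, clarify)
    fix i j assume "i \<le> N" "j \<le> N"
    have "z ^ j = z ^ j0 * z ^ (j - j0)" if "\<not> j < j0" using that by (simp add: power_add[symmetric])
    then show "fscale (\<kappa> (i, j)) (T ^ i * z ^ j)
      = z ^ j0 * fscale (if j < j0 then 0 else \<kappa> (i, j)) (T ^ i * z ^ (j - j0))"
      using low[of j i] \<open>i \<le> N\<close> by (auto simp: F.scale_mult_right mult.left_commute)
  qed
  then have "W \<in> coeffs_in P"
    using rel zQ prime_ideal_power[OF Q, of z j0] prime_idealD[OF Q, of "z ^ j0" W] by auto
  then have "W $ 0 \<in> P" by (auto simp: coeffs_in_def)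
  have "W $ 0 = (\<Sum>i\<le>N. \<Sum>j\<le>N. scale (if j < j0 then 0 else \<kappa> (i, j)) ((T $ 0) ^ i * (z $ 0) ^ (j - j0)))"
    by (simp add: W_def sum.cartesian_product fps_sum_nth fscale_nth case_prod_unfold fps_power_zeroth)
  have "(\<Sum>i\<le>N. scale (\<kappa> (i, j0)) ((T $ 0) ^ i)) \<in> P"
  proof -
    let ?w = "\<lambda>i j. scale (if j < j0 then 0 else \<kappa> (i, j)) ((T $ 0) ^ i * (z $ 0) ^ (j - j0))"
    have "(\<Sum>j\<le>N. ?w i j) = scale (\<kappa> (i, j0)) ((T $ 0) ^ i) + (\<Sum>j\<in>{..N} - {j0}. ?w i j)" for i
      using j0N sum.remove[of "{..N}" j0 "?w i"] by simp
    then have "W $ 0 = (\<Sum>i\<le>N. scale (\<kappa> (i, j0)) ((T $ 0) ^ i)) + (\<Sum>i\<le>N. \<Sum>j\<in>{..N} - {j0}. ?w i j)"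
      unfolding \<open>W $ 0 = _\<close> by (simp only: sum.distrib)
    then have "W $ 0 - (\<Sum>i\<le>N. scale (\<kappa> (i, j0)) ((T $ 0) ^ i)) = (\<Sum>i\<le>N. \<Sum>j\<in>{..N} - {j0}. ?w i j)"
      by (simp only: add_diff_cancel_left')
    also have "\<dots> \<in> P"
    proof (intro ideal_sum[OF idP])
      fix i j assume j: "j \<in> {..N} - {j0}"
      show "scale (if j < j0 then 0 else \<kappa> (i, j)) ((T $ 0) ^ i * (z $ 0) ^ (j - j0)) \<in> P"
      proof (cases "j < j0")
        case True
        then show ?thesis by (simp add: ideal_0[OF idP])
      next
        case False
        then obtain k where "j - j0 = Suc k" using j by (cases "j - j0") auto
        then have "(z $ 0) ^ (j - j0) \<in> P" using ideal_mult_right[OF idP z(2)] by simp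
        then show ?thesis by (intro scale_in_ideal[OF idP] ideal_mult_left[OF idP])
      qed
    qed
    finally show ?thesis using \<open>W $ 0 \<in> P\<close> ideal_cong_iff[OF idP] by blast
  qed
  define f where "f = (\<Sum>i\<le>N. monom (scale (\<kappa> (i, j0)) 1) i)"
  have cf: "coeff f i = (if i \<le> N then scale (\<kappa> (i, j0)) 1 else 0)" for i
    by (auto simp: f_def coeff_sum)
  have "f \<in> poly_over (alg {})"
    using subring_0[OF subring_alg] by (auto simp: poly_over_def cf alg_empty)
  moreover have "poly f (T $ 0) \<in> P"
    using \<open>(\<Sum>i\<le>N. scale (\<kappa> (i, j0)) ((T $ 0) ^ i)) \<in> P\<close>
    by (simp add: f_def poly_sum poly_monom scale_mult_left)
  moreover have "coeff f i0 \<notin> P"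
    using i0 scale_in_prime_iff[OF P] prime_ideal_one[OF P] by (simp add: cf)
  ultimately show False using trans by (auto simp: alg_over_def)
qed

text \<open>
  Let \<open>e 0, \<dots>, e (n - 1)\<close> be independent modulo \<open>c A + P\<close>. Then the products \<open>c ^ i * e j\<close> with
  \<open>i \<le> M\<close>, of degree at most \<open>d * M + N\<close>, are independent modulo \<open>P\<close>, since \<open>c\<close> can be cancelled.
  There are \<open>n * (M + 1)\<close> of them, so that for large \<open>M\<close> linear growth bounds \<open>n\<close> by \<open>C * d\<close>.
\<close>

lemma finite_codim_of_growth:
  assumes P: "prime_ideal P" and gr: "F.linear_growth (coeffs_in P) S"
    and onto: "\<And>a. \<exists>U\<in>F.alg S. U $ 0 = a" and c: "c \<notin> P"
  shows "\<exists>n. \<forall>e::nat \<Rightarrow> 'a. \<exists>\<kappa>. (\<exists>j<n. \<kappa> j \<noteq> 0) \<and> (\<exists>a. (\<Sum>j<n. scale (\<kappa> j) (e j)) - c * a \<in> P)"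
proof -
  note Q = prime_ideal_coeffs_in[OF P]
  note idP = prime_ideal_ideal[OF P]
  obtain C where C: "\<forall>n I (v :: nat \<times> nat \<Rightarrow> _). finite I \<longrightarrow> C * (n + 1) < card I \<longrightarrow>
    (\<forall>i\<in>I. v i \<in> F.filtration S n) \<longrightarrow>
    (\<exists>\<kappa>. (\<exists>i\<in>I. \<kappa> i \<noteq> 0) \<and> (\<Sum>i\<in>I. fscale (\<kappa> i) (v i)) \<in> coeffs_in P)"
    using F.linear_growth_dependent[where 'i = "nat \<times> nat", OF Q gr] by (rule exE)
  obtain L where L: "\<And>a. L a \<in> F.alg S" "\<And>a. L a $ 0 = a" using onto by metis
  obtain d where d: "L c \<in> F.filtration S d" using F.alg_eq_Union_filtration L(1)[of c] by blast
  define n where "n = C * d + 1"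
  have "\<exists>\<kappa>. (\<exists>j<n. \<kappa> j \<noteq> 0) \<and> (\<exists>a. (\<Sum>j<n. scale (\<kappa> j) (e j)) - c * a \<in> P)" for e :: "nat \<Rightarrow> 'a"
  proof -
    have "\<exists>N. (\<lambda>j. L (e j)) ` {..<n} \<subseteq> F.filtration S N" using L(1) by (intro F.finite_subset_filtration) auto
    then obtain N where N: "\<And>j. j < n \<Longrightarrow> L (e j) \<in> F.filtration S N" by blast
    \<comment> \<open>with this \<open>M\<close> and \<open>n = C * d + 1\<close> the number of products exceeds
        \<open>C * (d * M + N + 1)\<close>\<close>
    define M where "M = C * (N + 1)"
    let ?I = "{..M} \<times> {..<n}"
    have "\<exists>\<kappa>. (\<exists>i\<in>?I. \<kappa> i \<noteq> 0) \<and> (\<Sum>i\<in>?I. fscale (\<kappa> i) (case i of (i, j) \<Rightarrow> L c ^ i * L (e j))) \<in> coeffs_in P"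
    proof (rule C[rule_format])
      show "C * (d * M + N + 1) < card ?I" by (simp add: n_def M_def algebra_simps)
      fix x assume "x \<in> ?I"
      then obtain i j where ij: "x = (i, j)" "i \<le> M" "j < n" by auto
      have "L c ^ i * L (e j) \<in> F.filtration S (d * i + N)" using ij by (intro F.filtration_mult F.filtration_power d N)
      moreover have "d * i + N \<le> d * M + N" using ij by simp
      ultimately have "L c ^ i * L (e j) \<in> F.filtration S (d * M + N)" using F.filtration_mono by blast
      then show "(case x of (i, j) \<Rightarrow> L c ^ i * L (e j)) \<in> F.filtration S (d * M + N)" using ij by simp
    qed auto
    then obtain \<kappa> where nz: "\<exists>i\<le>M. \<exists>j<n. \<kappa> (i, j) \<noteq> 0"
      and rel: "(\<Sum>(i, j)\<in>?I. fscale (\<kappa> (i, j)) (L c ^ i * L (e j))) \<in> coeffs_in P"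
      by (auto simp: case_prod_unfold)
    have "(\<Sum>(i, j)\<in>?I. fscale (\<kappa> (i, j)) (L c ^ i * L (e j))) $ 0 \<in> P"
      using rel by (auto simp: coeffs_in_def)
    then have rel': "(\<Sum>i\<le>M. \<Sum>j<n. scale (\<kappa> (i, j)) (c ^ i * e j)) \<in> P"
      by (simp add: sum.cartesian_product fps_sum_nth fscale_nth case_prod_unfold fps_power_zeroth L(2))
    define i0 where "i0 = (LEAST i. \<exists>j<n. \<kappa> (i, j) \<noteq> 0)"
    have i0: "\<exists>j<n. \<kappa> (i0, j) \<noteq> 0" unfolding i0_def by (rule LeastI_ex) (use nz in blast)
    have low: "\<kappa> (i, j) = 0" if "i < i0" "j < n" for i j
      using not_less_Least that unfolding i0_def by blast
    have i0M: "i0 \<le> M"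
    proof -
      obtain i where i: "i \<le> M" "\<exists>j<n. \<kappa> (i, j) \<noteq> 0" using nz by blast
      have "i0 \<le> i" unfolding i0_def by (rule Least_le) (rule i(2))
      then show ?thesis using i(1) by simp
    qed
    define r where "r i = (\<Sum>j<n. scale (\<kappa> (i, j)) (e j))" for i
    let ?a = "\<Sum>i\<in>{i0<..M}. c ^ (i - Suc i0) * r i"
    have "(\<Sum>i\<le>M. \<Sum>j<n. scale (\<kappa> (i, j)) (c ^ i * e j)) = (\<Sum>i\<le>M. c ^ i * r i)"
      by (simp add: r_def sum_distrib_left scale_mult_right)
    also have "\<dots> = (\<Sum>i\<in>{i0..M}. c ^ i * r i)"
      using low by (intro sum.mono_neutral_right) (auto simp: r_def)
    also have "\<dots> = c ^ i0 * r i0 + (\<Sum>i\<in>{i0<..M}. c ^ i * r i)"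
      using i0M by (rule sum.head)
    also have "(\<Sum>i\<in>{i0<..M}. c ^ i * r i) = c ^ i0 * (c * ?a)"
      unfolding sum_distrib_left
    proof (intro sum.cong refl)
      fix i assume i: "i \<in> {i0<..M}"
      then have "c ^ i = c ^ (i0 + Suc (i - Suc i0))" by simp
      then have "c ^ i = c ^ i0 * (c * c ^ (i - Suc i0))" by (simp only: power_add power_Suc)
      then show "c ^ i * r i = c ^ i0 * (c * (c ^ (i - Suc i0) * r i))" by (simp add: mult.assoc)
    qed
    finally have "c ^ i0 * (r i0 - c * (- ?a)) \<in> P" using rel' by (simp add: algebra_simps)
    then have "r i0 - c * (- ?a) \<in> P" using c prime_ideal_power[OF P] prime_idealD[OF P] by blast
    then show ?thesis using i0 unfolding r_def by (intro exI[of _ "\<lambda>j. \<kappa> (i0, j)"]) blast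
  qed
  then show ?thesis by blast
qed

end

section \<open>Noetherian rings and prime annihilators\<close>

text \<open>
  The ascending chain condition, stated for the ideals generated by initial segments of a
  sequence.
\<close>

definition noetherian_subring :: "'r::comm_ring_1 set \<Rightarrow> bool" where
  "noetherian_subring B \<longleftrightarrow> (\<forall>f :: nat \<Rightarrow> 'r. (\<forall>i. f i \<in> B) \<longrightarrow>
     (\<exists>n b. (\<forall>i. b i \<in> B) \<and> f n = (\<Sum>i<n. b i * f i)))"

text \<open>
  Hilbert's argument. A sequence \<open>p\<close> without the required relation generates an ideal \<open>I\<close> that is
  not finitely generated; choose \<open>g n\<close> of least degree in \<open>I\<close> outside the ideal of
  \<open>g 0, \<dots>, g (n - 1)\<close>. A relation between the leading coefficients allows one to lower the degree
  of some \<open>g n\<close>.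
\<close>

lemma hilbert_basis:
  assumes B: "subring B" and noeth: "noetherian_subring B"
  shows "noetherian_subring (poly_over B)"
  unfolding noetherian_subring_def
proof (intro allI impI)
  fix p :: "nat \<Rightarrow> 'a poly"
  assume p: "\<forall>i. p i \<in> poly_over B"
  note R = subring_poly_over[OF B]
  let ?R = "poly_over B"
  define Sp where "Sp g n = {\<Sum>i<n. b i * g i | b. \<forall>i. b i \<in> ?R}" for g :: "nat \<Rightarrow> 'a poly" and n :: nat
  have SpI: "(\<Sum>i<n. b i * g i) \<in> Sp g n" if "\<And>i. i < n \<Longrightarrow> b i \<in> ?R" for b g n
  proof -
    have "(\<Sum>i<n. b i * g i) = (\<Sum>i<n. (if i < n then b i else 0) * g i)" by (intro sum.cong) auto
    then show ?thesis
      unfolding Sp_def using that subring_0[OF R]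
      by (intro CollectI exI[of _ "\<lambda>i. if i < n then b i else 0"]) auto
  qed
  have Sp_add: "x + y \<in> Sp g n" if xy: "x \<in> Sp g n" "y \<in> Sp g n" for x y g n
  proof -
    obtain b c where bc: "\<forall>i. b i \<in> ?R" "\<forall>i. c i \<in> ?R" "x = (\<Sum>i<n. b i * g i)" "y = (\<Sum>i<n. c i * g i)"
      using xy by (auto simp: Sp_def)
    then have "x + y = (\<Sum>i<n. (b i + c i) * g i)" by (simp add: distrib_right sum.distrib)
    then show ?thesis using bc SpI[of n "\<lambda>i. b i + c i" g] subring_add[OF R] by auto
  qed
  have Sp_mult: "r * x \<in> Sp g n" if rx: "r \<in> ?R" "x \<in> Sp g n" for r x g n
  proof -
    obtain b where b: "\<forall>i. b i \<in> ?R" "x = (\<Sum>i<n. b i * g i)" using rx by (auto simp: Sp_def)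
    then have "r * x = (\<Sum>i<n. (r * b i) * g i)" by (simp add: sum_distrib_left mult.assoc)
    then show ?thesis using b rx SpI[of n "\<lambda>i. r * b i" g] subring_mult[OF R] by auto
  qed
  have Sp_0: "0 \<in> Sp g n" for g n
    using SpI[of n "\<lambda>_. 0" g] subring_0[OF R] by simp
  have Sp_sum: "(\<Sum>i\<in>A. x i) \<in> Sp g n" if "\<And>i. i \<in> A \<Longrightarrow> x i \<in> Sp g n" for A :: "nat set" and x g n
    using that by (induction A rule: infinite_finite_induct) (auto intro: Sp_0 Sp_add)
  have Sp_mono: "Sp g m \<subseteq> Sp g n" if "m \<le> n" for g m n
  proof
    fix x assume "x \<in> Sp g m"
    then obtain b where b: "\<forall>i. b i \<in> ?R" "x = (\<Sum>i<m. b i * g i)" by (auto simp: Sp_def)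
    have "x = (\<Sum>i<n. (if i < m then b i else 0) * g i)"
      unfolding b(2) using that by (intro sum.mono_neutral_cong_left) auto
    then show "x \<in> Sp g n" using b SpI[of n "\<lambda>i. if i < m then b i else 0" g] subring_0[OF R] by auto
  qed
  have Sp_base: "g i \<in> Sp g n" if "i < n" for g i n
  proof -
    have "g i = (\<Sum>j<n. (if j = i then 1 else 0) * g j)"
      using that by (subst sum.remove[of _ i]) auto
    then show ?thesis
      using SpI[of n "\<lambda>j. if j = i then 1 else 0" g] subring_0[OF R] subring_1[OF R] by auto
  qed
  show "\<exists>n b. (\<forall>i. b i \<in> ?R) \<and> p n = (\<Sum>i<n. b i * p i)"
  proof (rule ccontr)
    assume "\<not> ?thesis"
    then have bad: "p n \<notin> Sp p n" for n by (auto simp: Sp_def)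
    define I where "I = (\<Union>n. Sp p n)"
    define new where "new g n q \<longleftrightarrow> q \<in> I \<and> q \<notin> Sp g n \<and> (\<forall>q'\<in>I. q' \<notin> Sp g n \<longrightarrow> degree q \<le> degree q')"
      for g n q
    have "\<exists>g. \<forall>n. new g n (g n)"
    proof (rule dependent_wellorder_choice)
      fix r f g n
      assume eq: "\<And>y. y < (n::nat) \<Longrightarrow> f y = (g y :: 'a poly)"
      have "(\<Sum>i<n. b i * f i) = (\<Sum>i<n. b i * g i)" for b using eq by (intro sum.cong) auto
      then have "Sp f n = Sp g n" by (simp add: Sp_def)
      then show "new f n r = new g n r" by (simp add: new_def)
    next
      fix n f assume prev: "\<And>y. y < (n::nat) \<Longrightarrow> new f y (f y)"
      have "\<forall>i\<in>{..<n}. \<exists>k. f i \<in> Sp p k" using prev by (auto simp: new_def I_def)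
      from bchoice[OF this] obtain k where k: "\<And>i. i < n \<Longrightarrow> f i \<in> Sp p (k i)" by auto
      define K where "K = (\<Sum>i<n. k i)"
      have fK: "f i \<in> Sp p K" if "i < n" for i
      proof -
        have "k i \<le> K" unfolding K_def using that by (intro member_le_sum) auto
        then show ?thesis using k[OF that] Sp_mono by blast
      qed
      have "Sp f n \<subseteq> Sp p K"
        unfolding Sp_def[of f n] using fK by (auto intro!: Sp_sum Sp_mult)
      then have "p K \<notin> Sp f n" using bad by blast
      moreover have "p K \<in> I" unfolding I_def using Sp_base[of K "Suc K" p] by blast
      ultimately have ex: "p K \<in> I \<and> p K \<notin> Sp f n" by blast
      define q where "q = arg_min degree (\<lambda>q. q \<in> I \<and> q \<notin> Sp f n)"
      have "q \<in> I \<and> q \<notin> Sp f n" unfolding q_def by (rule arg_min_natI) (rule ex)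
      moreover have "degree q \<le> degree q'" if "q' \<in> I" "q' \<notin> Sp f n" for q'
        unfolding q_def by (rule arg_min_nat_le) (use that in blast)
      ultimately show "\<exists>r. new f n r" unfolding new_def by blast
    qed
    then obtain g where "\<forall>n. new g n (g n)" by blast
    then have gI: "\<And>n. g n \<in> I" and gSp: "\<And>n. g n \<notin> Sp g n"
      and gmin: "\<And>n q. q \<in> I \<Longrightarrow> q \<notin> Sp g n \<Longrightarrow> degree (g n) \<le> degree q"
      by (auto simp: new_def)
    have I_diff: "x - y \<in> I" if xy: "x \<in> I" "y \<in> I" for x y
    proof -
      obtain m n where "x \<in> Sp p m" "y \<in> Sp p n" using xy by (auto simp: I_def)
      then have "x \<in> Sp p (max m n)" "y \<in> Sp p (max m n)"
        using Sp_mono[of m "max m n" p] Sp_mono[of n "max m n" p] by auto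
      then have "x + (- 1) * y \<in> Sp p (max m n)"
        using subring_minus[OF R subring_1[OF R]] by (intro Sp_add Sp_mult)
      then show ?thesis by (auto simp: I_def)
    qed
    have I_mult: "r * x \<in> I" if rx: "r \<in> ?R" "x \<in> I" for r x
    proof -
      obtain n where "x \<in> Sp p n" using rx(2) by (auto simp: I_def)
      then have "r * x \<in> Sp p n" using rx(1) by (intro Sp_mult)
      then show ?thesis by (auto simp: I_def)
    qed
    have I_0: "0 \<in> I" using Sp_0 by (auto simp: I_def)
    have I_sum: "(\<Sum>i\<in>A. x i) \<in> I" if "\<And>i. i \<in> A \<Longrightarrow> x i \<in> I" for A :: "nat set" and x
      using that
    proof (induction A rule: infinite_finite_induct)
      case (insert i A)
      then have "x i - (0 - sum x A) \<in> I" by (intro I_diff I_0) auto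
      then show ?case using insert by simp
    qed (auto intro: I_0)
    have "Sp p n \<subseteq> ?R" for n
      unfolding Sp_def using p by (auto intro!: subring_sum[OF R] subring_mult[OF R])
    then have gR: "g n \<in> ?R" for n using gI[of n] by (auto simp: I_def)
    have deg: "degree (g i) \<le> degree (g n)" if "i < n" for i n
      using gmin[OF gI[of n], of i] gSp[of n] Sp_mono[of i n g] that by auto
    have "\<exists>n b. (\<forall>i. b i \<in> B) \<and> lead_coeff (g n) = (\<Sum>i<n. b i * lead_coeff (g i))"
      by (rule noeth[unfolded noetherian_subring_def, rule_format]) (rule poly_overD[OF gR])
    then obtain n b where b: "\<forall>i. b i \<in> B" and lead: "lead_coeff (g n) = (\<Sum>i<n. b i * lead_coeff (g i))"
      by blast
    let ?d = "\<lambda>i. degree (g i)"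
    define s where "s = (\<Sum>i<n. monom (b i) (?d n - ?d i) * g i)"
    define q where "q = g n - s"
    have mR: "monom (b i) k \<in> ?R" for i k using b by (intro monom_poly_over[OF B]) auto
    have sSp: "s \<in> Sp g n" unfolding s_def by (intro SpI mR)
    have qI: "q \<in> I" unfolding q_def s_def by (intro I_diff gI I_sum I_mult mR)
    have qSp: "q \<notin> Sp g n" using Sp_add[OF _ sSp, of q] gSp[of n] by (auto simp: q_def)
    have cs: "coeff s k = (\<Sum>i<n. if k < ?d n - ?d i then 0 else b i * coeff (g i) (k - (?d n - ?d i)))" for k
      by (simp add: s_def coeff_sum coeff_monom_mult)
    have "coeff s (?d n) = (\<Sum>i<n. b i * lead_coeff (g i))"
      unfolding cs using deg by (intro sum.cong) auto
    then have q0: "coeff q (?d n) = 0" using lead by (simp add: q_def)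
    have qbig: "coeff q k = 0" if "?d n < k" for k
    proof -
      have "coeff s k = 0"
        unfolding cs
      proof (intro sum.neutral ballI)
        fix i assume "i \<in> {..<n}"
        then have "?d i < k - (?d n - ?d i)" using deg[of i n] that by auto
        then show "(if k < ?d n - ?d i then 0 else b i * coeff (g i) (k - (?d n - ?d i))) = 0"
          by (simp add: coeff_eq_0)
      qed
      then show ?thesis using that by (simp add: q_def coeff_eq_0)
    qed
    have "q = 0 \<or> degree q < ?d n"
    proof (rule ccontr)
      assume "\<not> ?thesis"
      then have "q \<noteq> 0" "?d n \<le> degree q" by auto
      then have "coeff q (degree q) = 0" using q0 qbig by (cases "degree q = ?d n") auto
      then show False using \<open>q \<noteq> 0\<close> by simp
    qed
    moreover have "q \<noteq> 0" using qSp Sp_0 by auto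
    ultimately show False using gmin[OF qI qSp] by simp
  qed
qed

lemma (in comm_algebra) noetherian_alg:
  "finite S \<Longrightarrow> noetherian_subring (alg S)"
proof (induction S rule: finite_induct)
  case empty
  show ?case
    unfolding noetherian_subring_def
  proof (intro allI impI)
    fix f :: "nat \<Rightarrow> 'a"
    assume "\<forall>i. f i \<in> alg {}"
    then obtain c d where cd: "f 0 = scale c 1" "f 1 = scale d 1" unfolding alg_empty by (metis imageE)
    show "\<exists>n b. (\<forall>i. b i \<in> alg {}) \<and> f n = (\<Sum>i<n. b i * f i)"
    proof (cases "c = 0")
      case True
      then show ?thesis using cd subring_0[OF subring_alg] by (intro exI[of _ 0] exI[of _ "\<lambda>_. 0"]) auto
    next
      case False
      then show ?thesis using cd
        by (intro exI[of _ 1] exI[of _ "\<lambda>_. scale (d / c) 1"]) (auto simp: alg_empty scale_mult_left)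
    qed
  qed
next
  case (insert x S)
  have eq: "alg (insert x S) = (\<lambda>p. poly p x) ` poly_over (alg S)"
    using adjoin_eq[OF subalgebra_alg, of x S] hull_insert[of "subalgebra scale" x S] by simp
  have noeth: "noetherian_subring (poly_over (alg S))"
    by (rule hilbert_basis[OF subring_alg insert.IH])
  show ?case
    unfolding noetherian_subring_def eq
  proof (intro allI impI)
    fix f :: "nat \<Rightarrow> 'a"
    assume "\<forall>i. f i \<in> (\<lambda>p. poly p x) ` poly_over (alg S)"
    then have "\<exists>p. \<forall>i. p i \<in> poly_over (alg S) \<and> f i = poly (p i) x" by (intro choice) blast
    then obtain p where p: "\<And>i. p i \<in> poly_over (alg S)" "\<And>i. f i = poly (p i) x" by blast
    obtain n b where b: "\<And>i. b i \<in> poly_over (alg S)" "p n = (\<Sum>i<n. b i * p i)"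
      using noeth[unfolded noetherian_subring_def, rule_format, of p] p(1) by blast
    have "f n = (\<Sum>i<n. poly (b i) x * f i)" by (simp add: p(2) b(2) poly_sum)
    then show "\<exists>n b. (\<forall>i. b i \<in> (\<lambda>p. poly p x) ` poly_over (alg S)) \<and> f n = (\<Sum>i<n. b i * f i)"
      using b(1) by (intro exI[of _ n] exI[of _ "\<lambda>i. poly (b i) x"]) auto
  qed
qed

definition annihilator :: "'r::comm_ring_1 \<Rightarrow> 'r set" where
  "annihilator u = {x. u * x = 0}"

lemma ideal_annihilator: "ring_ideal (annihilator u)"
  by (auto simp: ring_ideal_def annihilator_def distrib_left mult.left_commute)

text \<open>
  A maximal member among the annihilators of the nonzero multiples of \<open>a\<close> is prime. If none is
  prime, each can be enlarged strictly, and elements witnessing the strict inclusions violate the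
  chain condition.
\<close>

lemma ex_multiple_with_prime_annihilator:
  assumes noeth: "noetherian_subring (UNIV :: 'a::comm_ring_1 set)" and a: "(a::'a) \<noteq> 0"
  shows "\<exists>b. prime_ideal (annihilator (a * b))"
proof (rule ccontr)
  assume no: "\<not> ?thesis"
  have step: "\<exists>x y. a * (b * x) \<noteq> 0 \<and> a * b * y \<noteq> 0 \<and> a * (b * x) * y = 0" if "a * b \<noteq> 0" for b
  proof -
    have "1 \<notin> annihilator (a * b)" using that by (simp add: annihilator_def)
    then have "annihilator (a * b) \<noteq> UNIV" by blast
    then obtain x y where "x * y \<in> annihilator (a * b)" "x \<notin> annihilator (a * b)" "y \<notin> annihilator (a * b)"
      using no ideal_annihilator unfolding prime_ideal_def by blast
    then show ?thesis by (intro exI[of _ x] exI[of _ y]) (auto simp: annihilator_def mult.assoc)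
  qed
  define Q where "Q b b' \<longleftrightarrow> (\<exists>x y. b' = b * x \<and> a * b * y \<noteq> 0 \<and> a * b' * y = 0)" for b b'
  have "\<exists>b. \<forall>n::nat. a * b n \<noteq> 0 \<and> Q (b n) (b (Suc n))"
  proof (rule dependent_nat_choice)
    show "\<exists>b. a * b \<noteq> 0" using a by (intro exI[of _ 1]) simp
    fix b assume "a * b \<noteq> 0"
    then show "\<exists>b'. a * b' \<noteq> 0 \<and> Q b b'" unfolding Q_def using step by blast
  qed
  then obtain b where b: "\<And>n. Q (b n) (b (Suc n))" by blast
  have "\<exists>xy. \<forall>n. b (Suc n) = b n * fst (xy n) \<and> a * b n * snd (xy n) \<noteq> 0 \<and> a * b (Suc n) * snd (xy n) = 0"
    by (rule choice) (use b in \<open>simp add: Q_def\<close>)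
  then obtain xy where xy: "\<And>n. b (Suc n) = b n * fst (xy n) \<and> a * b n * snd (xy n) \<noteq> 0 \<and> a * b (Suc n) * snd (xy n) = 0"
    by blast
  define x y where "x n = fst (xy n)" and "y n = snd (xy n)" for n
  have bx: "\<And>n. b (Suc n) = b n * x n" and y: "\<And>n. a * b n * y n \<noteq> 0" "\<And>n. a * b (Suc n) * y n = 0"
    unfolding x_def y_def using xy by blast+
  have kill: "a * b n * y i = 0" if "i < n" for i n
    using that
  proof (induction n)
    case (Suc n)
    show ?case
    proof (cases "i = n")
      case False
      then have "a * b n * y i = 0" using Suc by simp
      then have "(a * b n * y i) * x n = 0" by simp
      then show ?thesis by (simp add: bx algebra_simps)
    qed (use y in simp)
  qed simp
  obtain n c where "y n = (\<Sum>i<n. c i * y i)"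
    using noeth unfolding noetherian_subring_def by blast
  then have "a * b n * y n = (\<Sum>i<n. c i * (a * b n * y i))"
    by (simp add: sum_distrib_left mult.left_commute)
  then show False using kill y(1)[of n] by simp
qed

lemma reduced_square_zero: "reduced_ring TYPE('a::comm_ring_1) \<Longrightarrow> (x::'a) * x = 0 \<Longrightarrow> x = 0"
  unfolding reduced_ring_def by (metis power2_eq_square)

text \<open>
  The primes found here are the minimal primes of the ring, and \<open>u i\<close> is a function that vanishes
  on all components but the \<open>i\<close>-th. Choose the \<open>u i\<close> successively, each annihilated by the
  previous ones. The process stops, since otherwise some \<open>u n\<close> would be a combination of its
  predecessors and therefore have square zero.
\<close>

lemma ex_orthogonal_prime_annihilators:
  assumes noeth: "noetherian_subring (UNIV :: 'a::comm_ring_1 set)" and red: "reduced_ring TYPE('a)"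
  shows "\<exists>l (u :: nat \<Rightarrow> 'a). (\<forall>i<l. prime_ideal (annihilator (u i))) \<and>
    (\<forall>i<l. \<forall>j<l. i \<noteq> j \<longrightarrow> u i * u j = 0) \<and> (\<forall>a. (\<forall>i<l. u i * a = 0) \<longrightarrow> a = 0)"
proof (rule ccontr)
  assume no: "\<not> ?thesis"
  define Q where "Q f n r \<longleftrightarrow> ((\<forall>i<n. \<forall>j<n. i \<noteq> j \<longrightarrow> f i * f j = 0) \<longrightarrow> (\<forall>i<n. prime_ideal (annihilator (f i))) \<longrightarrow>
    prime_ideal (annihilator r) \<and> (\<forall>i<n. f i * r = 0))" for f :: "nat \<Rightarrow> 'a" and n and r
  have "\<exists>u. \<forall>n. Q u n (u n)"
  proof (rule dependent_wellorder_choice)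
    fix r n and f g :: "nat \<Rightarrow> 'a" assume "\<And>y. y < n \<Longrightarrow> f y = g y"
    then show "Q f n r = Q g n r" by (simp add: Q_def)
  next
    fix n and f :: "nat \<Rightarrow> 'a"
    show "\<exists>r. Q f n r"
    proof (cases "(\<forall>i<n. \<forall>j<n. i \<noteq> j \<longrightarrow> f i * f j = 0) \<and> (\<forall>i<n. prime_ideal (annihilator (f i)))")
      case True
      then obtain a where a: "\<forall>i<n. f i * a = 0" "a \<noteq> 0" using no by blast
      obtain b where "prime_ideal (annihilator (a * b))"
        using ex_multiple_with_prime_annihilator[OF noeth a(2)] by blast
      moreover have "\<forall>i<n. f i * (a * b) = 0" using a(1) by (simp add: mult.assoc[symmetric])
      ultimately show ?thesis unfolding Q_def by blast
    qed (auto simp: Q_def)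
  qed
  then obtain u where u: "\<And>n. Q u n (u n)" by blast
  have "prime_ideal (annihilator (u n)) \<and> (\<forall>i<n. u i * u n = 0)" for n
  proof (induction n rule: less_induct)
    case (less n)
    have "u i * u j = 0" if "i < n" "j < n" "i \<noteq> j" for i j
    proof (cases "i < j")
      case True
      then show ?thesis using less[OF that(2)] by blast
    next
      case False
      then have "u j * u i = 0" using less[OF that(1)] that(3) by simp
      then show ?thesis by (simp add: mult.commute)
    qed
    then show ?case using u[of n] less unfolding Q_def by blast
  qed
  then have P: "\<And>n. prime_ideal (annihilator (u n))" and orth: "\<And>i n. i < n \<Longrightarrow> u i * u n = 0" by blast+
  obtain n c where "u n = (\<Sum>i<n. c i * u i)"
    using noeth unfolding noetherian_subring_def by blast
  then have "u n * u n = (\<Sum>i<n. c i * u i) * u n" by simp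
  also have "\<dots> = (\<Sum>i<n. c i * (u i * u n))" by (simp add: sum_distrib_right mult.assoc)
  finally have "u n * u n = (\<Sum>i<n. c i * (u i * u n))" .
  then have "u n * u n = 0" using orth by simp
  then have "u n = 0" by (rule reduced_square_zero[OF red])
  then show False using prime_ideal_one[OF P[of n]] by (simp add: annihilator_def)
qed

section \<open>Hasse-Schmidt derivations\<close>

context comm_algebra
begin

lemma linear_scale_iff:
  "Vector_Spaces.linear scale scale f \<longleftrightarrow>
    (\<forall>x y. f (x + y) = f x + f y) \<and> (\<forall>c x. f (scale c x) = scale c (f x))"
  by (simp add: linear_iff_module_hom module_hom_iff module_axioms)

lemma hasse_schmidtD:
  assumes "hasse_schmidt scale m D"
  shows "D 0 x = x"
    and "n \<le> m \<Longrightarrow> D n (x + y) = D n x + D n y"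
    and "n \<le> m \<Longrightarrow> D n (scale c x) = scale c (D n x)"
    and "n \<le> m \<Longrightarrow> D n (x * y) = (\<Sum>i\<le>n. D i x * D (n - i) y)"
  using assms by (auto simp: hasse_schmidt_def linear_scale_iff)

lemma hasse_schmidtI:
  assumes "\<And>x. D 0 x = x"
    and "\<And>n x y. n \<le> m \<Longrightarrow> D n (x + y) = D n x + D n y"
    and "\<And>n c x. n \<le> m \<Longrightarrow> D n (scale c x) = scale c (D n x)"
    and "\<And>n x y. n \<le> m \<Longrightarrow> D n (x * y) = (\<Sum>i\<le>n. D i x * D (n - i) y)"
  shows "hasse_schmidt scale m D"
  using assms by (auto simp: hasse_schmidt_def linear_scale_iff)

lemma DerD:
  assumes "\<delta> \<in> Der scale"
  shows "\<delta> (x + y) = \<delta> x + \<delta> y" "\<delta> (scale c x) = scale c (\<delta> x)" "\<delta> (x * y) = x * \<delta> y + \<delta> x * y"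
    "\<delta> 0 = 0"
proof -
  show "\<delta> (x + y) = \<delta> x + \<delta> y" "\<delta> (scale c x) = scale c (\<delta> x)" "\<delta> (x * y) = x * \<delta> y + \<delta> x * y"
    using assms by (auto simp: Der_def linear_scale_iff)
  have "\<delta> (0 + 0) = \<delta> 0 + \<delta> 0" using assms unfolding Der_def linear_scale_iff by blast
  then show "\<delta> 0 = 0" by simp
qed

lemma DerI:
  assumes "\<And>x y. \<delta> (x + y) = \<delta> x + \<delta> y" "\<And>c x. \<delta> (scale c x) = scale c (\<delta> x)"
    "\<And>x y. \<delta> (x * y) = x * \<delta> y + \<delta> x * y"
  shows "\<delta> \<in> Der scale"
  using assms by (auto simp: Der_def linear_scale_iff)

lemma IDer_of_hasse_schmidt:
  assumes D: "hasse_schmidt scale m D" and m: "1 \<le> m"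
  shows "D 1 \<in> IDer scale m"
proof -
  have "D 1 \<in> Der scale"
    using hasse_schmidtD[OF D] m by (intro DerI) auto
  then show ?thesis using D by (auto simp: IDer_def)
qed

text \<open>
  Composition of the ring homomorphisms into power series that correspond to \<open>D\<close> and \<open>E\<close>; its
  first component is the sum of those of \<open>D\<close> and \<open>E\<close>.
\<close>

lemma hasse_schmidt_compose:
  assumes D: "hasse_schmidt scale m D" and E: "hasse_schmidt scale m E"
  shows "hasse_schmidt scale m (\<lambda>n x. \<Sum>i\<le>n. D i (E (n - i) x))"
proof (rule hasse_schmidtI)
  note D' = hasse_schmidtD[OF D] and E' = hasse_schmidtD[OF E]
  fix n x y assume n: "n \<le> m"
  show "(\<Sum>i\<le>n. D i (E (n - i) (x + y))) = (\<Sum>i\<le>n. D i (E (n - i) x)) + (\<Sum>i\<le>n. D i (E (n - i) y))"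
    using n by (simp add: D' E' sum.distrib)
  show "(\<Sum>i\<le>n. D i (E (n - i) (scale c x))) = scale c (\<Sum>i\<le>n. D i (E (n - i) x))" for c
    using n by (simp add: D' E' scale_sum_right)
  have D_sum: "D i (sum f A) = (\<Sum>a\<in>A. D i (f a))" if "i \<le> m" "finite A" for i and f :: "nat \<Rightarrow> 'a" and A
  proof -
    have "D i (0 + 0) = D i 0 + D i 0" using that(1) by (rule D'(2))
    then have "D i 0 = 0" by simp
    with that(2) show ?thesis by (induction A rule: finite_induct) (simp_all add: D'(2)[OF that(1)])
  qed
  let ?g = "\<lambda>a b j k. D a (E j x) * D b (E k y)"
  have "(\<Sum>i\<le>n. D i (E (n - i) (x * y))) = (\<Sum>i\<le>n. \<Sum>j\<le>n - i. \<Sum>a\<le>i. ?g a (i - a) j (n - i - j))"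
    using n by (intro sum.cong refl) (simp add: E'(4) D_sum D'(4))
  also have "\<dots> = (\<Sum>(i, j, a)\<in>(SIGMA i:{..n}. {..n - i} \<times> {..i}). ?g a (i - a) j (n - i - j))"
    by (simp add: sum.Sigma sum.cartesian_product)
  \<comment> \<open>\<open>k = a + j\<close> is the total order that falls on \<open>x\<close>, and \<open>b = i - a\<close>\<close>
  also have "\<dots> = (\<Sum>(k, a, b)\<in>(SIGMA k:{..n}. {..k} \<times> {..n - k}). ?g a b (k - a) (n - k - b))"
    by (rule sum.reindex_bij_witness[where i = "\<lambda>(k, a, b). (a + b, k - a, a)" and j = "\<lambda>(i, j, a). (a + j, a, i - a)"])
      (auto simp: algebra_simps)
  also have "\<dots> = (\<Sum>k\<le>n. (\<Sum>a\<le>k. D a (E (k - a) x)) * (\<Sum>b\<le>n - k. D b (E (n - k - b) y)))"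
    by (simp add: sum.Sigma[symmetric] sum.cartesian_product[symmetric] sum_product)
  finally show "(\<Sum>i\<le>n. D i (E (n - i) (x * y)))
    = (\<Sum>k\<le>n. (\<Sum>a\<le>k. D a (E (k - a) x)) * (\<Sum>b\<le>n - k. D b (E (n - k - b) y)))" .
qed (use hasse_schmidtD[OF D] hasse_schmidtD[OF E] in auto)

text \<open>The substitution of \<open>a\<close> times the parameter of the power series for that parameter.\<close>

lemma hasse_schmidt_rescale:
  assumes D: "hasse_schmidt scale m D"
  shows "hasse_schmidt scale m (\<lambda>n x. a ^ n * D n x)"
proof (rule hasse_schmidtI)
  note D' = hasse_schmidtD[OF D]
  fix n x y assume n: "n \<le> m"
  show "a ^ n * D n (x * y) = (\<Sum>i\<le>n. (a ^ i * D i x) * (a ^ (n - i) * D (n - i) y))"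
    unfolding D'(4)[OF n] sum_distrib_left
  proof (intro sum.cong refl)
    fix i assume "i \<in> {..n}"
    then have "a ^ n = a ^ i * a ^ (n - i)" by (simp add: power_add[symmetric])
    then show "a ^ n * (D i x * D (n - i) y) = (a ^ i * D i x) * (a ^ (n - i) * D (n - i) y)"
      by (simp add: algebra_simps)
  qed
qed (use hasse_schmidtD[OF D] in \<open>auto simp: distrib_left scale_mult_right\<close>)

lemma hasse_schmidt_trivial: "hasse_schmidt scale m (\<lambda>n x. if n = 0 then x else 0)"
proof (rule hasse_schmidtI)
  fix n :: nat and x y :: 'a
  have "(\<Sum>i\<le>n. (if i = 0 then x else 0) * (if n - i = 0 then y else 0))
    = (\<Sum>i\<in>{0}. (if i = 0 then x else 0) * (if n - i = 0 then y else 0))"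
    by (intro sum.mono_neutral_right) auto
  then show "(if n = 0 then x * y else 0) = (\<Sum>i\<le>n. (if i = 0 then x else 0) * (if n - i = 0 then y else 0))"
    by simp
qed auto

lemma IDer_add:
  assumes "\<delta> \<in> IDer scale m" "\<epsilon> \<in> IDer scale m" "1 \<le> m"
  shows "(\<lambda>x. \<delta> x + \<epsilon> x) \<in> IDer scale m"
proof -
  obtain D E where DE: "hasse_schmidt scale m D" "D 1 = \<delta>" "hasse_schmidt scale m E" "E 1 = \<epsilon>"
    using assms by (auto simp: IDer_def)
  note H = hasse_schmidt_compose[OF DE(1,3)]
  have "(\<Sum>i\<le>1. D i (E (1 - i) x)) = \<delta> x + \<epsilon> x" for x
    using DE(2,4) hasse_schmidtD(1)[OF DE(1)] hasse_schmidtD(1)[OF DE(3)] by (simp add: add.commute)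
  then show ?thesis using IDer_of_hasse_schmidt[OF H assms(3)] by simp
qed

lemma IDer_mult:
  assumes "\<delta> \<in> IDer scale m" "1 \<le> m"
  shows "(\<lambda>x. a * \<delta> x) \<in> IDer scale m"
proof -
  obtain D where D: "hasse_schmidt scale m D" "D 1 = \<delta>" using assms by (auto simp: IDer_def)
  show ?thesis using IDer_of_hasse_schmidt[OF hasse_schmidt_rescale[OF D(1), of a] assms(2)] D(2) by simp
qed

lemma IDer_scale:
  assumes "\<delta> \<in> IDer scale m" "1 \<le> m"
  shows "(\<lambda>x. scale c (\<delta> x)) \<in> IDer scale m"
  using IDer_mult[OF assms, of "scale c 1"] by (simp add: scale_mult_left)

lemma IDer_zero: "1 \<le> m \<Longrightarrow> (\<lambda>x. 0) \<in> IDer scale m"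
  using IDer_of_hasse_schmidt[OF hasse_schmidt_trivial, of m] by simp

lemma IDer_sum:
  assumes "\<And>i. i \<in> A \<Longrightarrow> \<delta> i \<in> IDer scale m" "1 \<le> m"
  shows "(\<lambda>x. \<Sum>i\<in>A. \<delta> i x) \<in> IDer scale m"
  using assms(1)
proof (induction A rule: infinite_finite_induct)
  case (insert i A)
  then show ?case using IDer_add[of "\<delta> i" m "\<lambda>x. \<Sum>i\<in>A. \<delta> i x"] assms(2) by simp
qed (use IDer_zero assms(2) in auto)

section \<open>Subspaces of finite codimension, and leaps\<close>

definition lincomb :: "nat \<Rightarrow> (nat \<Rightarrow> 'k) \<Rightarrow> (nat \<Rightarrow> 'a \<Rightarrow> 'a) \<Rightarrow> 'a \<Rightarrow> 'a" where
  "lincomb n \<kappa> v = (\<lambda>x. \<Sum>i<n. scale (\<kappa> i) (v i x))"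

text \<open>
  For a subspace \<open>V\<close> this says that the codimension of \<open>V \<inter> Der\<close> in \<open>Der\<close> is less than \<open>n\<close>. The
  formulation by combinations makes it easy to intersect such subspaces.
\<close>

definition fin_codim :: "('a \<Rightarrow> 'a) set \<Rightarrow> bool" where
  "fin_codim V \<longleftrightarrow> (\<exists>n. \<forall>v. (\<forall>i. v i \<in> Der scale) \<longrightarrow> (\<exists>\<kappa>. (\<exists>i<n. \<kappa> i \<noteq> 0) \<and> lincomb n \<kappa> v \<in> V))"

lemma Der_lincomb:
  assumes v: "\<And>i. v i \<in> Der scale"
  shows "lincomb n \<kappa> v \<in> Der scale"
  by (rule DerI)
    (simp_all add: lincomb_def DerD(1-3)[OF v] scale_right_distrib sum.distrib scale_sum_right scale_left_commute
      sum_distrib_left sum_distrib_right scale_mult_left scale_mult_right mult.commute)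

text \<open>
  Form combinations that lie in \<open>V\<close> from disjoint blocks of \<open>n1\<close> derivations, and a combination of
  \<open>n2\<close> of these that lies in \<open>W\<close>. It is nontrivial because the blocks are disjoint.
\<close>

lemma fin_codim_Int:
  assumes V: "fin_codim V" and W: "fin_codim W"
    and closed: "\<And>n \<kappa> v. (\<And>i. i < n \<Longrightarrow> v i \<in> V) \<Longrightarrow> lincomb n \<kappa> v \<in> V"
  shows "fin_codim (V \<inter> W)"
proof -
  obtain n1 where n1: "\<And>v. (\<And>i. v i \<in> Der scale) \<Longrightarrow> \<exists>\<kappa>. (\<exists>i<n1. \<kappa> i \<noteq> 0) \<and> lincomb n1 \<kappa> v \<in> V"
    using V unfolding fin_codim_def by blast
  obtain n2 where n2: "\<And>v. (\<And>i. v i \<in> Der scale) \<Longrightarrow> \<exists>\<kappa>. (\<exists>i<n2. \<kappa> i \<noteq> 0) \<and> lincomb n2 \<kappa> v \<in> W"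
    using W unfolding fin_codim_def by blast
  have "\<exists>\<kappa>. (\<exists>i<n2 * n1. \<kappa> i \<noteq> 0) \<and> lincomb (n2 * n1) \<kappa> v \<in> V \<inter> W" if v: "\<And>i. v i \<in> Der scale" for v
  proof -
    have "\<exists>\<kappa>. \<forall>b. (\<exists>i<n1. \<kappa> b i \<noteq> 0) \<and> lincomb n1 (\<kappa> b) (\<lambda>i. v (b * n1 + i)) \<in> V"
      by (intro choice allI n1 v)
    then obtain \<kappa> where \<kappa>: "\<And>b. \<exists>i<n1. \<kappa> b i \<noteq> 0" "\<And>b. lincomb n1 (\<kappa> b) (\<lambda>i. v (b * n1 + i)) \<in> V" by blast
    define w where "w b = lincomb n1 (\<kappa> b) (\<lambda>i. v (b * n1 + i))" for b
    have "w b \<in> Der scale" for b unfolding w_def by (intro Der_lincomb v)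
    then obtain \<mu> where \<mu>: "\<exists>b<n2. \<mu> b \<noteq> 0" "lincomb n2 \<mu> w \<in> W" using n2 by blast
    have wV: "lincomb n2 \<mu> w \<in> V" by (rule closed) (simp add: w_def \<kappa>)
    define \<nu> where "\<nu> k = \<mu> (k div n1) * \<kappa> (k div n1) (k mod n1)" for k
    have \<nu>: "\<nu> (b * n1 + i) = \<mu> b * \<kappa> b i" if "i < n1" for b i
      using that by (simp add: \<nu>_def)
    have "lincomb (n2 * n1) \<nu> v = lincomb n2 \<mu> w"
    proof
      fix x
      have "lincomb n2 \<mu> w x = (\<Sum>b<n2. \<Sum>i<n1. scale (\<nu> (b * n1 + i)) (v (b * n1 + i) x))"
        by (simp add: lincomb_def w_def scale_sum_right \<nu>)
      also have "\<dots> = (\<Sum>b<n2. \<Sum>k\<in>{b * n1..<b * n1 + n1}. scale (\<nu> k) (v k x))"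
      proof (rule sum.cong[OF refl])
        fix b
        show "(\<Sum>i<n1. scale (\<nu> (b * n1 + i)) (v (b * n1 + i) x))
          = (\<Sum>k\<in>{b * n1..<b * n1 + n1}. scale (\<nu> k) (v k x))"
          using sum.shift_bounds_nat_ivl[of "\<lambda>k. scale (\<nu> k) (v k x)" 0 "b * n1" n1]
          by (simp add: atLeast0LessThan add.commute)
      qed
      also have "\<dots> = lincomb (n2 * n1) \<nu> v x"
        unfolding lincomb_def by (rule sum.nat_group)
      finally show "lincomb (n2 * n1) \<nu> v x = lincomb n2 \<mu> w x" ..
    qed
    moreover have "\<exists>k<n2 * n1. \<nu> k \<noteq> 0"
    proof -
      obtain b where b: "b < n2" "\<mu> b \<noteq> 0" using \<mu>(1) by blast
      obtain i where i: "i < n1" "\<kappa> b i \<noteq> 0" using \<kappa>(1) by blast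
      have "b * n1 + i < Suc b * n1" using i by simp
      also have "\<dots> \<le> n2 * n1" using b by (intro mult_le_mono1) simp
      finally show ?thesis using b i \<nu>[of i b] by (intro exI[of _ "b * n1 + i"]) auto
    qed
    ultimately show ?thesis using \<mu>(2) wV by (intro exI[of _ \<nu>]) auto
  qed
  then show ?thesis unfolding fin_codim_def by blast
qed

lemma fin_codim_INT:
  assumes "\<And>i. i < (l::nat) \<Longrightarrow> fin_codim (V i)"
    and "\<And>i n \<kappa> v. i < l \<Longrightarrow> (\<And>j. j < n \<Longrightarrow> v j \<in> V i) \<Longrightarrow> lincomb n \<kappa> v \<in> V i"
  shows "fin_codim (\<Inter>i<l. V i)"
  using assms
proof (induction l)
  case 0
  show ?case unfolding fin_codim_def
    by (intro exI[of _ 1] allI impI exI[of _ "\<lambda>_. 1"]) auto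
next
  case (Suc l)
  have "fin_codim (V l \<inter> (\<Inter>i<l. V i))"
    using Suc by (intro fin_codim_Int Suc.IH) auto
  then show ?case by (simp add: lessThan_Suc)
qed

text \<open>
  Choose at each of infinitely many leaps \<open>s i\<close> a derivation \<open>v i\<close> that is integrable up to
  \<open>s i - 1\<close> and not up to \<open>s i\<close>. A nontrivial combination of them that lies in \<open>V\<close> is integrable
  to every order; solving for its first term shows that this \<open>v i\<close> is integrable up to \<open>s i\<close>.
\<close>

lemma finite_Leaps_of_fin_codim:
  assumes V: "fin_codim V" and sub: "\<And>\<delta> m. \<delta> \<in> Der scale \<Longrightarrow> \<delta> \<in> V \<Longrightarrow> 1 \<le> m \<Longrightarrow> \<delta> \<in> IDer scale m"
  shows "finite (Leaps scale)"
proof (rule ccontr)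
  assume inf: "\<not> finite (Leaps scale)"
  obtain n where n: "\<And>v. (\<And>i. v i \<in> Der scale) \<Longrightarrow> \<exists>\<kappa>. (\<exists>i<n. \<kappa> i \<noteq> 0) \<and> lincomb n \<kappa> v \<in> V"
    using V unfolding fin_codim_def by blast
  obtain s :: "nat \<Rightarrow> nat" where s: "strict_mono s" "\<And>i. s i \<in> Leaps scale"
    using infinite_enumerate[OF inf] by blast
  have "\<exists>v. \<forall>i. v i \<in> IDer scale (s i - 1) \<and> v i \<notin> IDer scale (s i)"
    by (rule choice) (use s(2) in \<open>auto simp: Leaps_def\<close>)
  then obtain v where v: "\<And>i. v i \<in> IDer scale (s i - 1)" "\<And>i. v i \<notin> IDer scale (s i)" by blast
  have "v i \<in> Der scale" for i using v(1)[of i] by (simp add: IDer_def)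
  then obtain \<kappa> where \<kappa>: "\<exists>i<n. \<kappa> i \<noteq> 0" "lincomb n \<kappa> v \<in> V" "lincomb n \<kappa> v \<in> Der scale"
    using n[of v] Der_lincomb[of v] by blast
  define i0 where "i0 = (LEAST i. \<kappa> i \<noteq> 0)"
  have i0: "\<kappa> i0 \<noteq> 0" unfolding i0_def using LeastI_ex[of "\<lambda>i. \<kappa> i \<noteq> 0"] \<kappa>(1) by blast
  have low: "\<kappa> i = 0" if "i < i0" for i using not_less_Least that unfolding i0_def by blast
  have i0n: "i0 < n" using \<kappa>(1) low by (meson not_less order_less_le_trans)
  let ?m = "s i0"
  have m: "1 \<le> ?m" using s(2)[of i0] by (simp add: Leaps_def)
  define w where "w = (\<lambda>x. \<Sum>i\<in>{i0<..<n}. scale (\<kappa> i) (v i x))"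
  have "v i \<in> IDer scale ?m" if "i0 < i" for i
  proof -
    have "s i0 < s i" using s(1) that by (simp add: strict_mono_def)
    then have "IDer scale (s i - 1) \<subseteq> IDer scale ?m" by (intro IDer_antimono) simp
    then show ?thesis using v(1)[of i] by blast
  qed
  then have wI: "w \<in> IDer scale ?m" unfolding w_def by (intro IDer_sum IDer_scale m) auto
  have eq: "lincomb n \<kappa> v x = scale (\<kappa> i0) (v i0 x) + w x" for x
  proof -
    have "lincomb n \<kappa> v x = (\<Sum>i\<in>{i0..<n}. scale (\<kappa> i) (v i x))"
      unfolding lincomb_def using low by (intro sum.mono_neutral_right) auto
    also have "\<dots> = scale (\<kappa> i0) (v i0 x) + (\<Sum>i\<in>{Suc i0..<n}. scale (\<kappa> i) (v i x))"
      using i0n by (rule sum.atLeast_Suc_lessThan)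
    also have "{Suc i0..<n} = {i0<..<n}" by auto
    finally show ?thesis by (simp add: w_def)
  qed
  have "lincomb n \<kappa> v \<in> IDer scale ?m" using sub[OF \<kappa>(3,2) m] .
  then have "(\<lambda>x. scale (inverse (\<kappa> i0)) (lincomb n \<kappa> v x + scale (- 1) (w x))) \<in> IDer scale ?m"
    using wI by (intro IDer_scale IDer_add m)
  moreover have "scale (inverse (\<kappa> i0)) (lincomb n \<kappa> v x + scale (- 1) (w x)) = v i0 x" for x
    using i0 by (simp add: eq)
  ultimately have "v i0 \<in> IDer scale ?m" by simp
  then show False using v(2) by blast
qed

section \<open>One component of the curve\<close>

interpretation F: comm_algebra fscale
  by (rule comm_algebra_fscale)

text \<open>
  Apply \<open>lift_sep_tower\<close> with \<open>v = u\<close>. A lift with constant term zero has its coefficients in the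
  annihilator of \<open>u\<close> and also in \<open>u A\<close>, and these ideals meet in zero because \<open>A\<close> is reduced. So
  every element of \<open>A\<close> has a unique lift, lifting is a ring homomorphism, and its coefficients
  form a Hasse-Schmidt derivation of infinite length with \<open>D 1 t = h * u\<close>.
\<close>

lemma ex_hasse_schmidt_on_component:
  assumes red: "reduced_ring TYPE('a)" and P: "prime_ideal (annihilator u)"
    and tower: "sep_tower (annihilator u) t UNIV" and trans: "\<not> alg_over (annihilator u) (alg {}) t"
  shows "\<exists>D. (\<forall>m. hasse_schmidt scale m D) \<and> (\<forall>n>0. \<forall>a. u dvd D n a) \<and>
    (\<exists>n. \<forall>e::nat \<Rightarrow> 'a. \<exists>\<kappa>. (\<exists>j<n. \<kappa> j \<noteq> 0) \<and>
      (\<exists>a. u * ((\<Sum>j<n. scale (\<kappa> j) (e j)) - a * D 1 t) = 0))"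
proof -
  let ?P = "annihilator u"
  obtain h where h: "h \<notin> ?P" and ex: "\<And>v. \<exists>S. F.linear_growth (coeffs_in ?P) S \<and>
    fps_const t + fps_const (h * v) * fps_X \<in> F.alg S \<and>
    (\<forall>U\<in>F.alg S. \<forall>n>0. v dvd U $ n) \<and> UNIV \<subseteq> (\<lambda>U. U $ 0) ` F.alg S"
    using lift_sep_tower[OF P tower] by blast
  define T where "T = fps_const t + fps_const (h * u) * fps_X"
  obtain S where gr: "F.linear_growth (coeffs_in ?P) S" and TS: "T \<in> F.alg S"
    and dvd: "\<And>U n. U \<in> F.alg S \<Longrightarrow> 0 < n \<Longrightarrow> u dvd U $ n" and onto: "UNIV \<subseteq> (\<lambda>U. U $ 0) ` F.alg S"
    using ex[of u] unfolding T_def by blast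
  have T0: "T $ 0 = t" and T1: "T $ 1 = h * u" by (simp_all add: T_def mult.assoc)
  note sG = F.subring_alg[of S]
  have inj: "U = V" if UV: "U \<in> F.alg S" "V \<in> F.alg S" "U $ 0 = V $ 0" for U V
  proof (rule fps_ext)
    fix n
    let ?z = "U - V"
    have z: "?z \<in> F.alg S" using UV by (intro subring_diff[OF sG])
    have "?z \<in> coeffs_in ?P"
      using UV(3) trans ideal_0[OF ideal_annihilator]
      by (intro lift_zero_if_constant_zero[OF P gr TS _ z]) (simp_all add: T0)
    then have uz: "u * ?z $ n = 0" by (auto simp: coeffs_in_def annihilator_def)
    show "U $ n = V $ n"
    proof (cases "n = 0")
      case False
      then obtain b where b: "?z $ n = u * b" using dvd[OF z, of n] by (auto simp: dvd_def)
      have "?z $ n * ?z $ n = (u * ?z $ n) * b" by (subst b) (simp add: mult.assoc mult.left_commute)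
      then have "?z $ n * ?z $ n = 0" using uz by simp
      then have "?z $ n = 0" by (rule reduced_square_zero[OF red])
      then show ?thesis by simp
    qed (use UV in simp)
  qed
  have "\<exists>L. \<forall>a. L a \<in> F.alg S \<and> L a $ 0 = a"
  proof (rule choice, rule allI)
    fix a
    have "a \<in> (\<lambda>U. U $ 0) ` F.alg S" by (rule subsetD[OF onto UNIV_I])
    then show "\<exists>U. U \<in> F.alg S \<and> U $ 0 = a" by (auto simp: eq_commute)
  qed
  then obtain L where L: "\<And>a. L a \<in> F.alg S" "\<And>a. L a $ 0 = a" by blast
  define D where "D n a = L a $ n" for n a
  have hs: "hasse_schmidt scale m D" for m
  proof (rule hasse_schmidtI)
    fix n x y
    have "L (x + y) = L x + L y" by (intro inj subring_add[OF sG] L) (simp add: L)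
    then show "D n (x + y) = D n x + D n y" by (simp add: D_def)
    have "L (x * y) = L x * L y" by (intro inj subring_mult[OF sG] L) (simp add: L)
    then show "D n (x * y) = (\<Sum>i\<le>n. D i x * D (n - i) y)"
      by (simp add: D_def fps_mult_nth atLeast0AtMost)
    have "L (scale c x) = fscale c (L x)" for c
      by (intro inj F.subalgebra_scale[OF F.subalgebra_alg] L) (simp add: L fscale_nth)
    then show "D n (scale c x) = scale c (D n x)" for c by (simp add: D_def fscale_nth)
  qed (simp add: D_def L)
  have "L t = T" by (intro inj L TS) (simp add: L T0)
  then have D1: "D 1 t = h * u" by (simp add: D_def T1[unfolded One_nat_def])
  have "u \<notin> ?P"
  proof
    assume "u \<in> ?P"
    then have "u = 0" using reduced_square_zero[OF red, of u] by (simp add: annihilator_def)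
    then show False using prime_ideal_one[OF P] by (simp add: annihilator_def)
  qed
  then have "D 1 t \<notin> ?P" unfolding D1 using h prime_idealD[OF P] by blast
  then obtain n where n: "\<And>e::nat \<Rightarrow> 'a. \<exists>\<kappa>. (\<exists>j<n. \<kappa> j \<noteq> 0) \<and> (\<exists>a. (\<Sum>j<n. scale (\<kappa> j) (e j)) - D 1 t * a \<in> ?P)"
    using finite_codim_of_growth[OF P gr] L by blast
  have "\<forall>e::nat \<Rightarrow> 'a. \<exists>\<kappa>. (\<exists>j<n. \<kappa> j \<noteq> 0) \<and> (\<exists>a. u * ((\<Sum>j<n. scale (\<kappa> j) (e j)) - a * D 1 t) = 0)"
    using n by (simp add: annihilator_def mult.commute[of "D (Suc 0) t"])
  moreover have "\<forall>n>0. \<forall>a. u dvd D n a" using dvd L by (simp add: D_def)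
  ultimately show ?thesis using hs by blast
qed

lemma Der_annihilator:
  assumes red: "reduced_ring TYPE('a)" and \<delta>: "\<delta> \<in> Der scale" and x: "x \<in> annihilator u"
  shows "\<delta> x \<in> annihilator u"
proof -
  have ux: "u * x = 0" using x by (simp add: annihilator_def)
  then have eq: "u * \<delta> x + \<delta> u * x = 0" using DerD(3)[OF \<delta>, of u x] DerD(4)[OF \<delta>] by simp
  have "(u * \<delta> x) * (u * \<delta> x) = (u * \<delta> x + \<delta> u * x) * (u * \<delta> x) - \<delta> u * \<delta> x * (u * x)"
    by (simp add: algebra_simps)
  then have "(u * \<delta> x) * (u * \<delta> x) = 0" unfolding eq ux by simp
  then have "u * \<delta> x = 0" by (rule reduced_square_zero[OF red])
  then show ?thesis by (simp add: annihilator_def)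
qed

text \<open>
  What is needed on the component on which \<open>u\<close> lives: \<open>D\<close> moves only this component, a derivation
  is determined there by its value on \<open>t\<close>, and up to finite codimension that value is attained by
  a multiple of the integrable derivation \<open>D 1\<close>.
\<close>

definition component_data :: "'a \<Rightarrow> 'a \<Rightarrow> (nat \<Rightarrow> 'a \<Rightarrow> 'a) \<Rightarrow> bool" where
  "component_data u t D \<longleftrightarrow> (\<forall>m. hasse_schmidt scale m D) \<and> (\<forall>n>0. \<forall>a. u dvd D n a) \<and>
    (\<forall>\<delta>\<in>Der scale. u * \<delta> t = 0 \<longrightarrow> (\<forall>a. u * \<delta> a = 0)) \<and>
    fin_codim {\<delta>. \<exists>a. u * (\<delta> t - a * D 1 t) = 0}"

lemma ex_component_data:
  assumes perf: "perfect_field TYPE('k)" and red: "reduced_ring TYPE('a)"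
    and dim: "krull_dim TYPE('a) = 1" and S: "finite S" "alg S = UNIV"
    and P: "prime_ideal (annihilator u)"
  shows "\<exists>t D. component_data u t D"
proof -
  obtain t where t: "t = 0 \<or> \<not> alg_over (annihilator u) (alg {}) t"
    and tower: "sep_tower (annihilator u) t UNIV" using ex_sep_tower[OF perf dim P S] by blast
  have inj: "\<forall>\<delta>\<in>Der scale. u * \<delta> t = 0 \<longrightarrow> (\<forall>a. u * \<delta> a = 0)"
    using sep_tower_derivation[OF P tower _ Der_annihilator[OF red]] by (auto simp: annihilator_def)
  show ?thesis
  proof (cases "t = 0")
    case True
    \<comment> \<open>the component is a point, and all derivations vanish there\<close>
    define D where "D n x = (if n = 0 then x else 0)" for n :: nat and x :: 'a
    have "\<forall>m. hasse_schmidt scale m D"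
      unfolding D_def using hasse_schmidt_trivial by blast
    moreover have "fin_codim {\<delta>. \<exists>a. u * (\<delta> t - a * D 1 t) = 0}"
      unfolding fin_codim_def
    proof (rule exI[of _ 1], intro allI impI, rule exI[of _ "\<lambda>_. 1"], rule conjI)
      fix v assume "\<forall>i::nat. v i \<in> Der scale"
      then have "v 0 0 = 0" using DerD(4) by blast
      then show "lincomb 1 (\<lambda>_. 1) v \<in> {\<delta>. \<exists>a. u * (\<delta> t - a * D 1 t) = 0}"
        using True by (simp add: lincomb_def D_def)
    qed auto
    ultimately have "component_data u t D" using inj unfolding component_data_def by (simp add: D_def)
    then show ?thesis by blast
  next
    case False
    then obtain D n where D: "\<forall>m. hasse_schmidt scale m D" "\<forall>n>0. \<forall>a. u dvd D n a"
      and n: "\<forall>e::nat \<Rightarrow> 'a. \<exists>\<kappa>. (\<exists>j<n. \<kappa> j \<noteq> 0) \<and>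
        (\<exists>a. u * ((\<Sum>j<n. scale (\<kappa> j) (e j)) - a * D 1 t) = 0)"
      using ex_hasse_schmidt_on_component[OF red P tower] t by blast
    have "fin_codim {\<delta>. \<exists>a. u * (\<delta> t - a * D 1 t) = 0}"
      unfolding fin_codim_def
    proof (intro exI[of _ n] allI impI)
      fix v :: "nat \<Rightarrow> 'a \<Rightarrow> 'a"
      show "\<exists>\<kappa>. (\<exists>i<n. \<kappa> i \<noteq> 0) \<and> lincomb n \<kappa> v \<in> {\<delta>. \<exists>a. u * (\<delta> t - a * D 1 t) = 0}"
        using n[rule_format, of "\<lambda>j. v j t"] by (simp add: lincomb_def)
    qed
    then have "component_data u t D" using inj D unfolding component_data_def by blast
    then show ?thesis by blast
  qed
qed

text \<open>
  If the value of \<open>\<delta>\<close> on every \<open>t i\<close> is that of \<open>a i * D i 1\<close> on the \<open>i\<close>-th component, then \<open>\<delta>\<close>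
  equals the sum \<open>\<nu>\<close> of the derivations \<open>a i * D i 1\<close>: since \<open>D j 1\<close> is divisible by \<open>u j\<close>, it
  vanishes on the components other than the \<open>j\<close>-th. This \<open>\<nu>\<close> is integrable to every order, and the
  derivations with this property have finite codimension.
\<close>

lemma finite_Leaps_of_reduced_curve:
  assumes perf: "perfect_field TYPE('k)" and red: "reduced_ring TYPE('a)"
    and ft: "finite_type scale" and dim: "krull_dim TYPE('a) = 1"
  shows "finite (Leaps scale)"
proof -
  obtain S where S: "finite S" "alg S = UNIV" using ft by (auto simp: finite_type_def)
  have noeth: "noetherian_subring (UNIV :: 'a set)" using noetherian_alg[OF S(1)] S(2) by simp
  obtain l and u :: "nat \<Rightarrow> 'a" where P: "\<And>i. i < l \<Longrightarrow> prime_ideal (annihilator (u i))"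
    and orth: "\<And>i j. i < l \<Longrightarrow> j < l \<Longrightarrow> i \<noteq> j \<Longrightarrow> u i * u j = 0"
    and zero: "\<And>a. (\<And>i. i < l \<Longrightarrow> u i * a = 0) \<Longrightarrow> a = 0"
    using ex_orthogonal_prime_annihilators[OF noeth red] by blast
  have "\<exists>tD. \<forall>i\<in>{..<l}. component_data (u i) (fst (tD i)) (snd (tD i))"
  proof (rule bchoice, rule ballI)
    fix i assume "i \<in> {..<l}"
    then obtain t D where "component_data (u i) t D" using ex_component_data[OF perf red dim S P] by blast
    then show "\<exists>tD. component_data (u i) (fst tD) (snd tD)" by (intro exI[of _ "(t, D)"]) simp
  qed
  then obtain tD where tD: "\<forall>i\<in>{..<l}. component_data (u i) (fst (tD i)) (snd (tD i))"
    by (rule exE)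
  define t D where "t i = fst (tD i)" and "D i = snd (tD i)" for i
  have data: "component_data (u i) (t i) (D i)" if "i < l" for i
    using tD that by (simp add: t_def D_def)
  have hs: "\<And>i m. i < l \<Longrightarrow> hasse_schmidt scale m (D i)"
    and dvd: "\<And>i n a. i < l \<Longrightarrow> 0 < n \<Longrightarrow> u i dvd D i n a"
    and inj: "\<And>i \<delta> a. i < l \<Longrightarrow> \<delta> \<in> Der scale \<Longrightarrow> u i * \<delta> (t i) = 0 \<Longrightarrow> u i * \<delta> a = 0"
    and fc: "\<And>i. i < l \<Longrightarrow> fin_codim {\<delta>. \<exists>a. u i * (\<delta> (t i) - a * D i 1 (t i)) = 0}"
    using data unfolding component_data_def by blast+
  define V where "V i = {\<delta>. \<exists>a. u i * (\<delta> (t i) - a * D i 1 (t i)) = 0}" for i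
  have closed: "lincomb n \<kappa> v \<in> V i" if v: "\<And>j. j < n \<Longrightarrow> v j \<in> V i" for n \<kappa> v i
  proof -
    have "\<exists>a. \<forall>j\<in>{..<n}. u i * (v j (t i) - a j * D i 1 (t i)) = 0"
      by (rule bchoice) (use v in \<open>auto simp: V_def\<close>)
    then obtain a where a: "\<And>j. j < n \<Longrightarrow> u i * (v j (t i) - a j * D i 1 (t i)) = 0" by blast
    have "u i * (lincomb n \<kappa> v (t i) - (\<Sum>j<n. scale (\<kappa> j) (a j)) * D i 1 (t i))
      = (\<Sum>j<n. scale (\<kappa> j) (u i * (v j (t i) - a j * D i 1 (t i))))"
      by (simp add: lincomb_def sum_distrib_left sum_distrib_right right_diff_distrib sum_subtractf
          scale_mult_left scale_mult_right scale_right_diff_distrib)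
    also have "\<dots> = 0" using a by simp
    finally show ?thesis unfolding V_def by blast
  qed
  have "fin_codim (\<Inter>i<l. V i)"
    using fc unfolding V_def[symmetric] by (intro fin_codim_INT closed)
  then show ?thesis
  proof (rule finite_Leaps_of_fin_codim)
    fix \<delta> and m :: nat
    assume \<delta>: "\<delta> \<in> Der scale" and \<delta>V: "\<delta> \<in> (\<Inter>i<l. V i)" and m: "1 \<le> m"
    have "\<exists>a. \<forall>i\<in>{..<l}. u i * (\<delta> (t i) - a i * D i 1 (t i)) = 0"
      by (rule bchoice) (use \<delta>V in \<open>auto simp: V_def\<close>)
    then obtain a where a: "\<And>i. i < l \<Longrightarrow> u i * (\<delta> (t i) - a i * D i 1 (t i)) = 0" by blast
    define \<nu> where "\<nu> x = (\<Sum>i<l. a i * D i 1 x)" for x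
    have \<nu>I: "\<nu> \<in> IDer scale m"
      unfolding \<nu>_def using IDer_of_hasse_schmidt[OF hs m] by (intro IDer_sum IDer_mult m) auto
    then have \<nu>D: "\<nu> \<in> Der scale" by (simp add: IDer_def)
    have diff: "(\<lambda>x. \<delta> x - \<nu> x) \<in> Der scale"
      by (rule DerI) (simp_all add: DerD[OF \<delta>] DerD[OF \<nu>D] algebra_simps scale_right_diff_distrib)
    have "u i * (\<delta> (t i) - \<nu> (t i)) = 0" if i: "i < l" for i
    proof -
      have "u i * (a j * D j 1 (t i)) = 0" if "j \<in> {..<l} - {i}" for j
      proof -
        obtain b where "D j 1 (t i) = u j * b" using dvd[of j 1 "t i"] \<open>j \<in> _\<close> by (auto simp: dvd_def)
        then have "u i * (a j * D j 1 (t i)) = (u i * u j) * (a j * b)" by (simp add: algebra_simps)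
        then show ?thesis using orth[of i j] i that by auto
      qed
      then have "u i * \<nu> (t i) = u i * (a i * D i 1 (t i))"
        unfolding \<nu>_def sum_distrib_left using i by (subst sum.remove[of _ i]) auto
      then show ?thesis using a[OF i] by (simp add: right_diff_distrib)
    qed
    then have "u i * (\<delta> x - \<nu> x) = 0" if "i < l" for i x
      using inj[OF that diff] that by blast
    then have "\<delta> x - \<nu> x = 0" for x using zero by blast
    then have "\<delta> = \<nu>" by (intro ext) simp
    then show "\<delta> \<in> IDer scale m" using \<nu>I by simp
  qed
qed

end

theorem corollary6p3:
  fixes scale :: "'k::field \<Rightarrow> 'a::comm_ring_1 \<Rightarrow> 'a"
  assumes "comm_algebra scale"
    and "perfect_field TYPE('k)"
    and "reduced_ring TYPE('a)"
    and "finite_type scale"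
    and "krull_dim TYPE('a) = 1"
  shows "finite (Leaps scale)"
  using comm_algebra.finite_Leaps_of_reduced_curve[OF assms] .

end
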